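(* Let $p,q>1$ with $1/p+1/q=1$ and $T>0$. Let $(U,d)$ be a complete separable metric space and let $\sigma$ be the metric topology induced by $d$. Let $\phi:U\to(-\infty,\infty]$ be proper, with sequentially $\sigma$-compact sublevels, and such that the local slope $|\partial\phi|$ is a strong upper gradient for $\phi$ and is sequentially $\sigma$-lower semicontinuous on $d$-bounded sublevels of $\phi$. Let $u^0\in D(\phi)$. Assume the following generalized one-sided Taylor-expansion condition: there exists $\tau_*>0$ such that for every $C>0$ there exists $g:(0,\tau_* )\to[0,\infty]$ with $\frac1\tau\int_0^\tau g(r)\,dr\searrow0$ as $\tau\to0$ (i.e., monotonically decreasing to $0$ as $\tau\downarrow 0$) such that for all $\tau\in(0,\tau_* )$, all $v\in D(|\partial\phi|)$ with $\max\{\phi(v),\tau|\partial\phi|^q(v)\}\le C$, and all $u\in M_G(\tau,v)$, $$|\partial\phi|^q(u)-\big|\partial(\phi+\tau|\partial\phi|^q/q)\big|^q(u)\le g(\tau).$$ Let $\{0=t_0^n<t_1^n<\dots<t^n_{N^n}=T\}$, $n\in\mathbb{N}$, be a sequence of partitions with steps $\tau_i^n=t_i^n-t_{i-1}^n$, $\tau^n:=\max_i\tau_i^n<\tau_*$, $\tau^n\to0$ as $n\to\infty$, and $$\frac{(\tau_i^n-\tau_{i-1}^n)^+}{\tau_{i-1}^n}\le \widehat C\,\tau^n\quad\text{for }i=2,\dots,N^n,$$ with a constant $\widehat C>0$ independent of $i$ and $n$. Choose $u^{0n}\in M_E(\tau^n,u^0)$. Then all solutions $\{u_i^n\}_{i=0}^{N^n}$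 of the scheme $$u_0^n=u^{0n},\qquad u_i^n\in M_G(\tau_i^n,u_{i-1}^n)\quad\text{for }i=1,\dots,N^n,$$ fulfill $$\sum_{i=1}^{N^n}\big(G(\tau_i^n,u_{i-1}^n,u_i^n)\big)^+\to0\quad\text{as }n\to\infty .$$ Hence, up to subsequences, the backward piecewise constant interpolants $\overline u^n$ of $\{u_i^n\}$ converge pointwise on $[0,T]$ to a curve of maximal slope.
   Context: Notation: $r^+=\max\{r,0\}$. $D(\phi)=\{u\in U:\phi(u)<\infty\}$; $\phi$ is proper if $D(\phi)\neq\emptyset$. $AC^p([0,T];U)$ is the set of curves $u:[0,T]\to U$ for which there is $m\in L^p(0,T)$ with $d(u(s),u(t))\le\int_s^t m(r)\,dr$ for all $0\le s\le t\le T$. For such $u$ the metric derivative $|u'|(t)=\lim_{s\to t}d(u(s),u(t))/|t-s|$ exists for a.e. $t\in(0,T)$ and belongs to $L^p(0,T)$. Local slope: for a functional $\psi:U\to(-\infty,\infty]$ and $u\in D(\psi)$, $|\partial\psi|(u):=\limsup_{v\to u}\frac{(\psi(u)-\psi(v))^+}{d(u,v)}$ (convergence $v\to u$ in $d$). $D(|\partial\phi|)=\{u\in D(\phi):|\partial\phi|(u)<\infty\}$. The symbol $|\partial(\phi+\tau|\partial\phi|^q/q)|$ is the local slope of the functional $u\mapsto\phi(u)+\frac{\tau}{q}|\partial\phi|^q(u)$, with effective domain $D(|\partial\phi|)$ (and value $\infty$ elsewhere); it is finite at every $u\in M_G(\tau,v)$, so the difference in the Taylor-expansion condition makes sense. $|\partial\phi|$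 is a strong upper gradient for $\phi$ if for all $u\in AC^p([0,T];U)$ the map $r\mapsto|\partial\phi|(u(r))$ is Borel and $|\phi(u(t))-\phi(u(s))|\le\int_s^t|\partial\phi|(u(r))\,|u'|(r)\,dr$ for all $0\le s\le t\le T$. Incremental functionals: for $\tau>0$, $v\in D(\phi)$, $$G(\tau,v,u)=\phi(u)+\frac{\tau^{1-p}}{p}d^p(v,u)+\frac{\tau}{q}|\partial\phi|^q(u)-\phi(v)\quad(u\in D(|\partial\phi|)),$$ $$E(\tau,v,u)=\phi(u)+\frac{\tau^{1-p}}{p}d^p(v,u)-\phi(v)\quad(u\in D(\phi)),$$ and $M_G(\tau,v)=\operatorname{arg\,min}_{u\in D(|\partial\phi|)}G(\tau,v,u)$, $M_E(\tau,v)=\operatorname{arg\,min}_{u\in D(\phi)}E(\tau,v,u)$. Backward piecewise constant interpolant: $\overline u^n(0)=u_0^n$ and $\overline u^n(t)=u_i^n$ for $t\in(t_{i-1}^n,t_i^n]$, $i=1,\dots,N^n$. Curve of maximal slope: $u\in AC^p([0,T];U)$ such that $\phi\circ u\in W^{1,1}(0,T)$ and $$\phi(u(t))+\frac1p\int_0^t|u'|^p(r)\,dr+\frac1q\int_0^t|\partial\phi|^q(u(r))\,dr=\phi(u(0))\quad\forall t\in[0,T].$$ *)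

theory Defs
  imports "HOL-Analysis.Analysis"
begin

text \<open>
  Functionals with values in \<open>(-\<infinity>, \<infinity>]\<close> have type \<open>'a \<Rightarrow> ereal\<close>, the value \<open>-\<infinity>\<close> being excluded by a
  hypothesis; quantities with values in \<open>[0, \<infinity>]\<close> have type \<^typ>\<open>ennreal\<close>. Curves on \<open>[0, T]\<close> are total
  functions on \<^typ>\<open>real\<close> whose values outside \<open>[0, T]\<close> play no role.
\<close>

definition ennreal_powr :: "ennreal \<Rightarrow> real \<Rightarrow> ennreal" where
  "ennreal_powr x a = (if x = \<infinity> then \<infinity> else ennreal (enn2real x powr a))"

definition eff_dom :: "('a \<Rightarrow> ereal) \<Rightarrow> 'a set" where
  "eff_dom \<psi> = {u. \<psi> u < \<infinity>}"

text \<open>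
  \<^const>\<open>e2ennreal\<close> truncates negative values to 0, so it supplies the positive part in the local slope.
  The upper limit is taken in \<open>[0, \<infinity>]\<close>, so the slope vanishes at isolated points. Outside
  the effective domain the slope is \<open>\<infinity>\<close>.
\<close>

definition local_slope :: "('a::metric_space \<Rightarrow> ereal) \<Rightarrow> 'a \<Rightarrow> ennreal" where
  "local_slope \<psi> u =
     (if u \<in> eff_dom \<psi>
      then Limsup (at u) (\<lambda>v. e2ennreal (\<psi> u - \<psi> v) / ennreal (dist u v))
      else \<infinity>)"

definition slope_dom :: "('a::metric_space \<Rightarrow> ereal) \<Rightarrow> 'a set" where
  "slope_dom \<phi> = {u \<in> eff_dom \<phi>. local_slope \<phi> u < \<infinity>}"

text \<open>The functional \<open>\<phi> + (\<tau>/q) |\<partial>\<phi>|\<^sup>q\<close>, with effective domain \<open>D(|\<partial>\<phi>|)\<close>.\<close>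

definition slope_perturbed :: "real \<Rightarrow> ('a::metric_space \<Rightarrow> ereal) \<Rightarrow> real \<Rightarrow> 'a \<Rightarrow> ereal" where
  "slope_perturbed q \<phi> \<tau> u =
     (if u \<in> slope_dom \<phi>
      then \<phi> u + enn2ereal (ennreal (\<tau> / q) * ennreal_powr (local_slope \<phi> u) q)
      else \<infinity>)"

definition G_fun ::
  "real \<Rightarrow> real \<Rightarrow> ('a::metric_space \<Rightarrow> ereal) \<Rightarrow> real \<Rightarrow> 'a \<Rightarrow> 'a \<Rightarrow> ereal" where
  "G_fun p q \<phi> \<tau> v u =
     \<phi> u + ereal (\<tau> powr (1 - p) / p * dist v u powr p)
         + enn2ereal (ennreal (\<tau> / q) * ennreal_powr (local_slope \<phi> u) q) - \<phi> v"

definition E_fun :: "real \<Rightarrow> ('a::metric_space \<Rightarrow> ereal) \<Rightarrow> real \<Rightarrow> 'a \<Rightarrow> 'a \<Rightarrow> ereal" where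
  "E_fun p \<phi> \<tau> v u = \<phi> u + ereal (\<tau> powr (1 - p) / p * dist v u powr p) - \<phi> v"

definition M_G ::
  "real \<Rightarrow> real \<Rightarrow> ('a::metric_space \<Rightarrow> ereal) \<Rightarrow> real \<Rightarrow> 'a \<Rightarrow> 'a set" where
  "M_G p q \<phi> \<tau> v = {u. is_arg_min (G_fun p q \<phi> \<tau> v) (\<lambda>w. w \<in> slope_dom \<phi>) u}"

definition M_E :: "real \<Rightarrow> ('a::metric_space \<Rightarrow> ereal) \<Rightarrow> real \<Rightarrow> 'a \<Rightarrow> 'a set" where
  "M_E p \<phi> \<tau> v = {u. is_arg_min (E_fun p \<phi> \<tau> v) (\<lambda>w. w \<in> eff_dom \<phi>) u}"

definition AC_curve :: "real \<Rightarrow> real \<Rightarrow> (real \<Rightarrow> 'a::metric_space) \<Rightarrow> bool" where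
  "AC_curve p T u \<longleftrightarrow>
     (\<exists>m :: real \<Rightarrow> real.
        m \<in> borel_measurable (lebesgue_on {0<..<T}) \<and>
        integrable (lebesgue_on {0<..<T}) (\<lambda>r. \<bar>m r\<bar> powr p) \<and>
        (\<forall>s t. 0 \<le> s \<longrightarrow> s \<le> t \<longrightarrow> t \<le> T \<longrightarrow>
           dist (u s) (u t) \<le> integral\<^sup>L (lebesgue_on {s..t}) m))"

text \<open>Unspecified where the limit does not exist; for AC curves this is a null set.\<close>

definition metric_derivative :: "(real \<Rightarrow> 'a::metric_space) \<Rightarrow> real \<Rightarrow> real" where
  "metric_derivative u t = Lim (at t) (\<lambda>s. dist (u s) (u t) / \<bar>t - s\<bar>)"

text \<open>
  The inequality is vacuous for \<open>\<phi> (u s) = \<phi> (u t) = \<infinity>\<close>, that is, \<open>|\<infinity> - \<infinity>|\<close> is read as 0: in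
  \<^typ>\<open>ereal\<close> it would be \<open>\<infinity>\<close>, and already constant curves outside \<open>D(\<phi>)\<close> would violate the condition.
\<close>

definition strong_upper_gradient ::
  "real \<Rightarrow> real \<Rightarrow> ('a::metric_space \<Rightarrow> ereal) \<Rightarrow> ('a \<Rightarrow> ennreal) \<Rightarrow> bool" where
  "strong_upper_gradient p T \<phi> g \<longleftrightarrow>
     (\<forall>u. AC_curve p T u \<longrightarrow>
        (\<lambda>r. g (u r)) \<in> borel_measurable (restrict_space borel {0..T}) \<and>
        (\<forall>s t. 0 \<le> s \<longrightarrow> s \<le> t \<longrightarrow> t \<le> T \<longrightarrow>
           (\<phi> (u s) = \<infinity> \<and> \<phi> (u t) = \<infinity>) \<or>
           \<bar>\<phi> (u t) - \<phi> (u s)\<bar>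
             \<le> enn2ereal (\<integral>\<^sup>+ r. g (u r) * ennreal (metric_derivative u r) \<partial>lebesgue_on {s..t})))"

definition seq_lsc_on_bounded_sublevels ::
  "('a::metric_space \<Rightarrow> ereal) \<Rightarrow> ('a \<Rightarrow> ennreal) \<Rightarrow> bool" where
  "seq_lsc_on_bounded_sublevels \<phi> g \<longleftrightarrow>
     (\<forall>x x0 c. x \<longlonglongrightarrow> x0 \<longrightarrow> bounded (range x) \<longrightarrow> (\<forall>k. \<phi> (x k) \<le> ereal c) \<longrightarrow>
        g x0 \<le> liminf (\<lambda>k. g (x k)))"

text \<open>
  The generalized one-sided Taylor-expansion condition on \<open>(0, \<tau>s)\<close>. The slope powers are subtracted
  in \<^typ>\<open>ereal\<close>, as the difference may be negative.
\<close>

definition taylor_condition ::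
  "real \<Rightarrow> real \<Rightarrow> ('a::metric_space \<Rightarrow> ereal) \<Rightarrow> real \<Rightarrow> bool" where
  "taylor_condition p q \<phi> \<tau>s \<longleftrightarrow>
     (\<forall>C>0. \<exists>g :: real \<Rightarrow> ennreal.
        g \<in> borel_measurable (lebesgue_on {0<..<\<tau>s}) \<and>
        mono_on {0<..<\<tau>s} (\<lambda>\<tau>. ennreal (1 / \<tau>) * (\<integral>\<^sup>+ r. g r \<partial>lebesgue_on {0<..<\<tau>})) \<and>
        ((\<lambda>\<tau>. ennreal (1 / \<tau>) * (\<integral>\<^sup>+ r. g r \<partial>lebesgue_on {0<..<\<tau>})) \<longlongrightarrow> 0) (at_right 0) \<and>
        (\<forall>\<tau>\<in>{0<..<\<tau>s}. \<forall>v\<in>slope_dom \<phi>.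
           max (\<phi> v) (enn2ereal (ennreal \<tau> * ennreal_powr (local_slope \<phi> v) q)) \<le> ereal C \<longrightarrow>
           (\<forall>u\<in>M_G p q \<phi> \<tau> v.
              enn2ereal (ennreal_powr (local_slope \<phi> u) q)
              - enn2ereal (ennreal_powr (local_slope (slope_perturbed q \<phi> \<tau>) u) q)
                \<le> enn2ereal (g \<tau>))))"

text \<open>The partition points are \<open>t 0, \<dots>, t N\<close>; the step \<open>\<tau>\<^sub>i\<close> is used for \<open>1 \<le> i \<le> N\<close> only.\<close>

definition is_partition :: "real \<Rightarrow> nat \<Rightarrow> (nat \<Rightarrow> real) \<Rightarrow> bool" where
  "is_partition T N t \<longleftrightarrow> t 0 = 0 \<and> t N = T \<and> strict_mono_on {0..N} t"

definition step :: "(nat \<Rightarrow> real) \<Rightarrow> nat \<Rightarrow> real" where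
  "step t i = t i - t (i - 1)"

definition mesh :: "nat \<Rightarrow> (nat \<Rightarrow> real) \<Rightarrow> real" where
  "mesh N t = Max (step t ` {1..N})"

definition interpolant :: "nat \<Rightarrow> (nat \<Rightarrow> real) \<Rightarrow> (nat \<Rightarrow> 'a) \<Rightarrow> real \<Rightarrow> 'a" where
  "interpolant N t x r =
     (if r = 0 then x 0 else x (THE i. i \<in> {1..N} \<and> r \<in> {t (i - 1)<..t i}))"

definition test_function :: "real \<Rightarrow> (real \<Rightarrow> real) \<Rightarrow> bool" where
  "test_function T \<eta> \<longleftrightarrow>
     (\<forall>k. (deriv ^^ k) \<eta> differentiable_on UNIV) \<and>
     compact (closure {x. \<eta> x \<noteq> 0}) \<and> closure {x. \<eta> x \<noteq> 0} \<subseteq> {0<..<T}"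

definition W11 :: "real \<Rightarrow> (real \<Rightarrow> real) \<Rightarrow> bool" where
  "W11 T f \<longleftrightarrow>
     integrable (lebesgue_on {0<..<T}) f \<and>
     (\<exists>g. integrable (lebesgue_on {0<..<T}) g \<and>
        (\<forall>\<eta>. test_function T \<eta> \<longrightarrow>
           (\<integral>r. f r * deriv \<eta> r \<partial>lebesgue_on {0<..<T})
             = - (\<integral>r. g r * \<eta> r \<partial>lebesgue_on {0<..<T})))"

text \<open>
  Membership of \<open>\<phi> \<circ> u\<close> in \<open>W\<^sup>1\<^sup>,\<^sup>1(0, T)\<close> presupposes that \<open>\<phi> \<circ> u\<close> is real-valued, which is required
  explicitly because \<^const>\<open>real_of_ereal\<close> sends \<open>\<infinity>\<close> to 0.
\<close>

definition curve_of_maximal_slope ::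
  "real \<Rightarrow> real \<Rightarrow> real \<Rightarrow> ('a::metric_space \<Rightarrow> ereal) \<Rightarrow> (real \<Rightarrow> 'a) \<Rightarrow> bool" where
  "curve_of_maximal_slope p q T \<phi> u \<longleftrightarrow>
     AC_curve p T u \<and>
     (\<forall>t\<in>{0..T}. u t \<in> eff_dom \<phi>) \<and>
     W11 T (\<lambda>t. real_of_ereal (\<phi> (u t))) \<and>
     (\<forall>t\<in>{0..T}.
        \<phi> (u t)
        + enn2ereal (ennreal (1 / p) *
            (\<integral>\<^sup>+ r. ennreal (metric_derivative u r powr p) \<partial>lebesgue_on {0..t}))
        + enn2ereal (ennreal (1 / q) *
            (\<integral>\<^sup>+ r. ennreal_powr (local_slope \<phi> (u r)) q \<partial>lebesgue_on {0..t}))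
        = \<phi> (u 0))"

end

theory Submission
  imports Defs "HOL-Library.Diagonal_Subsequence"
begin

text \<open>
  \<^emph>\<open>Why the sum of the positive parts vanishes.\<close> For fixed \<open>v\<close> let \<open>\<gamma>(r)\<close> be the minimum of
  \<open>u \<mapsto> \<phi>(u) + r\<^sup>1\<^sup>-\<^sup>p d\<^sup>p(v,u)/p + r |\<partial>\<phi>|\<^sup>q(u)/q\<close>, attained at \<open>u\<^sub>r\<close>. By the envelope principle
  \<open>\<gamma>'(r) \<le> (|\<partial>\<phi>|\<^sup>q(u\<^sub>r) - d\<^sup>p(v,u\<^sub>r) r\<^sup>-\<^sup>p)/q\<close>, and the first-order condition at the minimizer bounds
  \<open>|\<partial>(\<phi> + r|\<partial>\<phi>|\<^sup>q/q)|\<^sup>q(u\<^sub>r)\<close> by \<open>d\<^sup>p(v,u\<^sub>r) r\<^sup>-\<^sup>p\<close>. The Taylor condition therefore says \<open>\<gamma>' \<le> g/q\<close>. Since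
  \<open>\<gamma>(r) \<rightarrow> \<phi>(v)\<close> as \<open>r \<rightarrow> 0\<close>, each step of the scheme has a defect \<open>G(\<tau>,v,u\<^sub>\<tau>)\<close> of at most \<open>(1/q) \<integral>\<^sub>0\<^sup>\<tau> g\<close>
  (\<open>value_le_integral_of_slope_defect\<close>, \<open>gap_le_taylor_integral\<close>). The mean of \<open>g\<close> over \<open>(0, \<tau>)\<close> is
  monotone in \<open>\<tau>\<close>, so summing the defects gives at most \<open>(T/q)\<close> times the mean of \<open>g\<close> over
  \<open>(0, \<tau>\<^sup>n)\<close>, which tends to 0. The constant \<open>C\<close> selecting \<open>g\<close> has to bound \<open>\<phi>\<close> and
  \<open>\<tau>|\<partial>\<phi>|\<^sup>q\<close> along the whole scheme; this comes from the estimate itself, by induction on the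
  step (\<open>scheme_energy_estimate\<close>), and the condition on the ratio of consecutive steps serves to
  replace \<open>\<tau>\<^sub>i\<close> by \<open>\<tau>\<^sub>i\<^sub>+\<^sub>1\<close> in the slope term.

  \<^emph>\<open>Why the interpolants converge to a curve of maximal slope.\<close> The summed defects give
  \<open>\<phi>(w\<^sub>n(t)) + A\<^sub>n(t)/p + (1/q) \<integral>\<^sub>0\<^sup>t |\<partial>\<phi>|\<^sup>q(w\<^sub>n) \<le> \<phi>(u\<^sup>0) + o(1)\<close>, where \<open>w\<^sub>n\<close> is the interpolant and \<open>A\<^sub>n\<close> the
  accumulated discrete action. A diagonal argument in the style of Helly and Arzela-Ascoli yields
  limits \<open>u\<close> of \<open>w\<^sub>n\<close> and \<open>A\<close> of \<open>A\<^sub>n\<close> (\<open>compactness_of_curves_with_energy\<close>). All increments of \<open>u\<close> are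
  dominated by those of \<open>t \<mapsto> (l\<^sup>q/q) t + (l\<^sup>-\<^sup>p/p) A(t)\<close>, for every \<open>l > 0\<close>; this one-parameter family
  of linear bounds expresses \<open>d(u(s),u(t)) \<le> (t-s)\<^sup>1\<^sup>/\<^sup>q (A(t)-A(s))\<^sup>1\<^sup>/\<^sup>p\<close> in a form that is stable under
  summation over partitions and under limits. It makes the arc length of \<open>u\<close> absolutely continuous,
  so that \<open>u\<close> has a metric derivative almost everywhere (\<open>metric_speed_exists\<close>), and it gives
  \<open>\<integral>\<^sub>0\<^sup>t |u'|\<^sup>p \<le> liminf A\<^sub>n(t)\<close> (\<open>speed_energy_le\<close>). Lower semicontinuity now passes the discrete
  inequality to the limit. The reverse inequality is the strong upper gradient property together
  with Young's inequality, and equality exhibits \<open>\<phi> \<circ> u\<close> as an indefinite integral, hence as a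
  function in \<open>W\<^sup>1\<^sup>,\<^sup>1\<close> (\<open>maximal_slope_of_energy_inequality\<close>).
\<close>

section \<open>Lebesgue differentiation on the line\<close>

text \<open>
  A Vitali covering argument. Every bad point \<open>x\<close> is an endpoint of arbitrarily short intervals on
  which the tagged contribution \<open>|I| f(x)\<close> misses the integral by more than \<open>\<epsilon>|I|\<close>. Disjoint intervals
  of this kind form a fine tagged partial division, so Henstock's lemma bounds their total length by
  any prescribed constant, while their fivefold enlargements cover all bad points.
\<close>

lemma negligible_bad_difference_quotients:
  fixes f :: "real \<Rightarrow> real"
  assumes f: "f integrable_on {a..b}" and \<epsilon>: "\<epsilon> > 0"
  shows "negligible {x \<in> {a<..<b}. \<forall>\<delta>>0. \<exists>y\<in>{a<..<b}. y \<noteq> x \<and> \<bar>y - x\<bar> < \<delta> \<and>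
            \<bar>integral {a..y} f - integral {a..x} f - (y - x) * f x\<bar> > \<epsilon> * \<bar>y - x\<bar>}"
    (is "negligible ?E")
  unfolding negligible_outer_le
proof (intro allI impI)
  fix e :: real assume e: "e > 0"
  define F where "F = (\<lambda>y. integral {a..y} f)"
  define J where "J = (\<lambda>(x, y). {min x y..max x y :: real})"
  define c where "c = (\<lambda>(x, y). (x + y) / 2 :: real)"
  define r where "r = (\<lambda>(x, y). \<bar>y - x\<bar> / 2 :: real)"
  have e': "\<epsilon> * e / 5 > 0" using \<epsilon> e by simp
  have f': "f integrable_on cbox a b" using f by simp
  obtain \<gamma> where \<gamma>: "gauge \<gamma>" and H: "\<And>p. \<lbrakk>p tagged_partial_division_of (cbox a b); \<gamma> fine p\<rbrakk> \<Longrightarrow>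
             sum (\<lambda>(x,k). norm(measure lborel k *\<^sub>R f x - integral k f)) p < \<epsilon> * e / 5"
    using Henstock_lemma[OF f' e'] by blast
  define K where "K = {(x, y). x \<in> {a<..<b} \<and> y \<in> {a<..<b} \<and> y \<noteq> x \<and> J (x, y) \<subseteq> \<gamma> x \<and>
      \<bar>F y - F x - (y - x) * f x\<bar> > \<epsilon> * \<bar>y - x\<bar>}"
  have J_cball: "J i = cball (c i) (r i)" for i
    by (cases i) (auto simp: J_def c_def r_def dist_real_def abs_if min_def max_def field_simps split: if_splits)
  have r0: "0 < r i \<and> r i \<le> b - a" if "i \<in> K" for i
    using that by (cases i) (auto simp: K_def r_def)
  obtain C where C: "countable C" "C \<subseteq> K"
     and disj: "pairwise (\<lambda>i j. disjnt (cball (c i) (r i)) (cball (c j) (r j))) C"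
     and cov: "\<And>i. i \<in> K \<Longrightarrow> \<exists>j. j \<in> C \<and>
                        \<not> disjnt (cball (c i) (r i)) (cball (c j) (r j)) \<and>
                        cball (c i) (r i) \<subseteq> ball (c j) (5 * r j)"
    using Vitali_covering_lemma_cballs_balls[of K r "b - a" c] r0 by blast
  have fin: "measure lebesgue (\<Union>i\<in>I. ball (c i) (5 * r i)) \<le> e" if I: "I \<subseteq> C" "finite I" for I
  proof -
    have IK: "i \<in> K" if "i \<in> I" for i using that I C by auto
    have disjI: "disjnt (J i) (J j)" if "i \<in> I" "j \<in> I" "i \<noteq> j" for i j
      using disj that I unfolding J_cball pairwise_def by blast
    have Jne: "interior (J i) \<inter> J i \<noteq> {}" if "i \<in> I" for i
    proof -
      have "c i \<in> interior (J i)" "c i \<in> J i"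
        using r0[OF IK[OF that]] by (auto simp: J_cball interior_cball)
      then show ?thesis by blast
    qed
    let ?p = "(\<lambda>i. (fst i, J i)) ` I"
    have inj: "inj_on (\<lambda>i. (fst i, J i)) I"
    proof (rule inj_onI)
      fix i j assume ij: "i \<in> I" "j \<in> I" "(fst i, J i) = (fst j, J j)"
      show "i = j"
      proof (rule ccontr)
        assume "i \<noteq> j"
        then have "J i \<inter> J j = {}" using disjI[OF ij(1,2)] by (simp add: disjnt_def)
        moreover have "J j = J i" using ij(3) by simp
        ultimately show False using Jne[OF ij(1)] by simp
      qed
    qed
    have tag: "?p tagged_partial_division_of (cbox a b)"
      unfolding tagged_partial_division_of_def
    proof (intro conjI allI impI)
      show "finite ?p" using I by simp
    next
      fix x k assume "(x, k) \<in> ?p"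
      then obtain i where i: "i \<in> I" "x = fst i" "k = J i" by auto
      show "x \<in> k" using i by (cases i) (auto simp: J_def)
      show "k \<subseteq> cbox a b" using i IK[of i] by (cases i) (auto simp: J_def K_def)
      show "\<exists>a b. k = cbox a b" using i by (cases i) (auto simp: J_def)
    next
      fix x1 k1 x2 k2 assume as: "(x1, k1) \<in> ?p \<and> (x2, k2) \<in> ?p \<and> (x1, k1) \<noteq> (x2, k2)"
      then obtain i j where i: "i \<in> I" "x1 = fst i" "k1 = J i" and j: "j \<in> I" "x2 = fst j" "k2 = J j" by auto
      then have "i \<noteq> j" using as by auto
      then have "J i \<inter> J j = {}" using disjI i j by (auto simp: disjnt_def)
      then show "interior k1 \<inter> interior k2 = {}" using i j interior_subset by blast
    qed
    have "\<gamma> fine ?p"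
    proof (rule fineI)
      fix x k assume "(x, k) \<in> ?p"
      then obtain i where i: "i \<in> I" "x = fst i" "k = J i" by auto
      then show "k \<subseteq> \<gamma> x" using IK[of i] by (cases i) (auto simp: K_def)
    qed
    from H[OF tag this] have S: "(\<Sum>i\<in>I. norm (measure lborel (J i) *\<^sub>R f (fst i) - integral (J i) f)) < \<epsilon> * e / 5"
      by (subst (asm) sum.reindex[OF inj]) (simp add: o_def)
    have each: "\<epsilon> * (2 * r i) \<le> norm (measure lborel (J i) *\<^sub>R f (fst i) - integral (J i) f)" if i: "i \<in> I" for i
    proof -
      obtain x y where xy: "i = (x, y)" by (cases i)
      with IK[OF i] have k: "x \<in> {a<..<b}" "y \<in> {a<..<b}" "y \<noteq> x"
        "\<bar>F y - F x - (y - x) * f x\<bar> > \<epsilon> * \<bar>y - x\<bar>" by (auto simp: K_def)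
      have comb: "F s + integral {s..t} f = F t" if "a \<le> s" "s \<le> t" "t \<le> b" for s t
        unfolding F_def using that
        by (intro Henstock_Kurzweil_Integration.integral_combine integrable_subinterval_real[OF f]) auto
      have "norm (measure lborel (J i) *\<^sub>R f (fst i) - integral (J i) f) = \<bar>F y - F x - (y - x) * f x\<bar>"
      proof (cases "x \<le> y")
        case True
        with comb[of x y] k have "integral (J i) f = F y - F x" by (auto simp: J_def xy)
        moreover have "measure lborel (J i) = y - x" "fst i = x" using True by (auto simp: J_def xy)
        ultimately show ?thesis by (simp add: abs_minus_commute)
      next
        case False
        with comb[of y x] k have "integral (J i) f = F x - F y" by (auto simp: J_def xy)
        moreover have "measure lborel (J i) = x - y" "fst i = x" using False by (auto simp: J_def xy)
        ultimately have "norm (measure lborel (J i) *\<^sub>R f (fst i) - integral (J i) f)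
            = \<bar>(x - y) * f x - (F x - F y)\<bar>" by simp
        also have "\<dots> = \<bar>F y - F x - (y - x) * f x\<bar>" by (simp add: algebra_simps)
        finally show ?thesis .
      qed
      moreover have "\<epsilon> * (2 * r i) = \<epsilon> * \<bar>y - x\<bar>" by (simp add: xy r_def)
      ultimately show ?thesis using k(4) by linarith
    qed
    have "(\<Sum>i\<in>I. \<epsilon> * (2 * r i)) \<le> \<epsilon> * e / 5"
      using sum_mono[of I "\<lambda>i. \<epsilon> * (2 * r i)", OF each] S by simp
    then have "\<epsilon> * (\<Sum>i\<in>I. 2 * r i) \<le> \<epsilon> * (e / 5)" by (simp add: sum_distrib_left)
    then have S2: "(\<Sum>i\<in>I. 2 * r i) \<le> e / 5" using \<epsilon> by (simp only: mult_le_cancel_left_pos)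
    have "measure lebesgue (\<Union>i\<in>I. ball (c i) (5 * r i)) \<le> (\<Sum>i\<in>I. measure lebesgue (ball (c i) (5 * r i)))"
      using I by (intro measure_UNION_le) auto
    also have "\<dots> = (\<Sum>i\<in>I. 5 * (2 * r i))"
    proof (rule sum.cong[OF refl])
      fix i assume "i \<in> I"
      then have "0 < r i" using r0 IK by blast
      then show "measure lebesgue (ball (c i) (5 * r i)) = 5 * (2 * r i)"
        by (simp add: ball_eq_greaterThanLessThan)
    qed
    also have "\<dots> \<le> e" using S2 by (simp flip: sum_distrib_left)
    finally show ?thesis .
  qed
  let ?T = "\<Union>i\<in>C. ball (c i) (5 * r i)"
  have "?E \<subseteq> ?T"
  proof
    fix x assume x: "x \<in> ?E"
    have "open (\<gamma> x)" "x \<in> \<gamma> x" using \<gamma> by (auto simp: gauge_def)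
    then obtain \<delta> where \<delta>: "\<delta> > 0" "ball x \<delta> \<subseteq> \<gamma> x" by (meson open_contains_ball)
    then obtain y where y: "y \<in> {a<..<b}" "y \<noteq> x" "\<bar>y - x\<bar> < \<delta>" "\<bar>F y - F x - (y - x) * f x\<bar> > \<epsilon> * \<bar>y - x\<bar>"
      using x unfolding F_def by blast
    have "J (x, y) \<subseteq> ball x \<delta>" using y by (auto simp: J_def dist_real_def abs_if split: if_splits)
    then have K: "(x, y) \<in> K" using x y \<delta> by (auto simp: K_def)
    have "x \<in> cball (c (x, y)) (r (x, y))" using J_cball[of "(x, y)"] by (auto simp: J_def)
    then show "x \<in> ?T" using cov[OF K] by blast
  qed
  then show "\<exists>T. ?E \<subseteq> T \<and> T \<in> lmeasurable \<and> measure lebesgue T \<le> e"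
    using fmeasurable_UN_bound[OF C(1), of "\<lambda>i. ball (c i) (5 * r i)" lebesgue e]
          measure_UN_bound[OF C(1), of "\<lambda>i. ball (c i) (5 * r i)" lebesgue e] fin
    by (intro exI[of _ ?T]) auto
qed

text \<open>
  Countably many of the exceptional sets above, for \<open>\<epsilon> = 1/(n+1)\<close>, exhaust the points where the
  indefinite integral fails to have the derivative \<open>f x\<close>.
\<close>

theorem Lebesgue_differentiation_interval:
  fixes f :: "real \<Rightarrow> real"
  assumes f: "f integrable_on {a..b}"
  shows "negligible {x \<in> {a<..<b}. \<not> ((\<lambda>y. integral {a..y} f) has_real_derivative f x) (at x)}"
proof -
  define E where "E = (\<lambda>n. {x \<in> {a<..<b}. \<forall>\<delta>>0. \<exists>y\<in>{a<..<b}. y \<noteq> x \<and> \<bar>y - x\<bar> < \<delta> \<and>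
            \<bar>integral {a..y} f - integral {a..x} f - (y - x) * f x\<bar> > 1 / real (Suc n) * \<bar>y - x\<bar>})"
  have "negligible (\<Union>n. E n)"
  proof (rule negligible_countable_Union)
    fix S assume "S \<in> range E"
    then obtain n where "S = E n" by blast
    then show "negligible S"
      unfolding E_def using negligible_bad_difference_quotients[OF f, of "1 / real (Suc n)"] by simp
  qed simp
  moreover have "{x \<in> {a<..<b}. \<not> ((\<lambda>y. integral {a..y} f) has_real_derivative f x) (at x)} \<subseteq> (\<Union>n. E n)"
  proof (rule subsetI, rule ccontr)
    fix x assume x: "x \<in> {x \<in> {a<..<b}. \<not> ((\<lambda>y. integral {a..y} f) has_real_derivative f x) (at x)}"
      and n: "x \<notin> (\<Union>n. E n)"
    have "((\<lambda>y. (integral {a..y} f - integral {a..x} f) / (y - x)) \<longlongrightarrow> f x) (at x)"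
    proof (rule tendstoI)
      fix e :: real assume "e > 0"
      then obtain n where n': "1 / real (Suc n) < e" using reals_Archimedean by (auto simp: inverse_eq_divide)
      from n have "x \<notin> E n" by blast
      with x have "\<exists>\<delta>>0. \<forall>y\<in>{a<..<b}. y \<noteq> x \<longrightarrow> \<bar>y - x\<bar> < \<delta> \<longrightarrow>
          \<bar>integral {a..y} f - integral {a..x} f - (y - x) * f x\<bar> \<le> 1 / real (Suc n) * \<bar>y - x\<bar>"
        unfolding E_def mem_Collect_eq not_less[symmetric] by blast
      then obtain \<delta> where \<delta>: "\<delta> > 0" "\<And>y. y \<in> {a<..<b} \<Longrightarrow> y \<noteq> x \<Longrightarrow> \<bar>y - x\<bar> < \<delta> \<Longrightarrow>
          \<bar>integral {a..y} f - integral {a..x} f - (y - x) * f x\<bar> \<le> 1 / real (Suc n) * \<bar>y - x\<bar>"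
        by blast
      have "eventually (\<lambda>y. y \<in> {a<..<b} \<and> y \<in> ball x \<delta> \<and> y \<noteq> x) (at x)"
        using x \<delta>(1) by (intro eventually_conj eventually_at_in_open' eventually_neq_at_within) auto
      then show "\<forall>\<^sub>F y in at x. dist ((integral {a..y} f - integral {a..x} f) / (y - x)) (f x) < e"
      proof eventually_elim
        case (elim y)
        then have "\<bar>integral {a..y} f - integral {a..x} f - (y - x) * f x\<bar> \<le> 1 / real (Suc n) * \<bar>y - x\<bar>"
          by (intro \<delta>(2)) (auto simp: dist_real_def abs_minus_commute)
        also have "\<dots> < e * \<bar>y - x\<bar>" using n' elim by (intro mult_strict_right_mono) auto
        finally have "\<bar>integral {a..y} f - integral {a..x} f - (y - x) * f x\<bar> / \<bar>y - x\<bar> < e"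
          using elim by (simp add: field_simps)
        moreover have "(integral {a..y} f - integral {a..x} f) / (y - x) - f x
            = (integral {a..y} f - integral {a..x} f - (y - x) * f x) / (y - x)"
          using elim by (simp add: field_simps)
        ultimately show ?case by (simp add: dist_real_def abs_divide)
      qed
    qed
    then show False using x by (simp add: has_field_derivative_iff)
  qed
  ultimately show ?thesis using negligible_subset by blast
qed

section \<open>Monotone functions with absolutely continuous increments\<close>

lemma interval_measure_unique:
  fixes F :: "real \<Rightarrow> real"
  assumes F: "mono F" "\<And>a. continuous (at_right a) F"
    and M: "sets M = sets borel" "\<And>a b. a \<le> b \<Longrightarrow> emeasure M {a<..b} = ennreal (F b - F a)"
  shows "M = interval_measure F"
proof (rule measure_eqI_generator_eq)
  let ?E = "range (\<lambda>(a, b). {a<..b::real})"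
  show "Int_stable ?E"
  proof (rule Int_stableI)
    fix X Y assume "X \<in> ?E" "Y \<in> ?E"
    then obtain a b c d where "X = {a<..b}" "Y = {c<..d}" by auto
    then have "X \<inter> Y = {max a c<..min b d}" by auto
    then show "X \<inter> Y \<in> ?E" by auto
  qed
  show "?E \<subseteq> Pow UNIV" by simp
  show "sets M = sigma_sets UNIV ?E" "sets (interval_measure F) = sigma_sets UNIV ?E"
    using M(1) by (simp_all add: borel_sigma_sets_Ioc)
  have F': "F a \<le> F b" if "a \<le> b" for a b using F(1) that by (auto simp: mono_def)
  fix X assume "X \<in> ?E"
  then obtain a b where X: "X = {a<..b}" by auto
  show "emeasure M X = emeasure (interval_measure F) X"
    using M(2)[of a b] emeasure_interval_measure_Ioc[of a b F] F' F(2)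
    by (cases "a \<le> b") (auto simp: X)
next
  let ?A = "\<lambda>n::nat. {- real n <..real n}"
  show "range ?A \<subseteq> range (\<lambda>(a, b). {a<..b::real})" by auto
  show "(\<Union>i. ?A i) = UNIV"
  proof safe
    fix x :: real
    obtain n where "\<bar>x\<bar> < real n" using reals_Archimedean2 by blast
    then show "x \<in> (\<Union>i. ?A i)" by (intro UN_I[of n]) auto
  qed simp
  show "emeasure M (?A i) \<noteq> \<infinity>" for i using M(2)[of "- real i" "real i"] by simp
qed

text \<open>
  The sum of the two measures is itself a measure and agrees with the one on the left on half-open
  intervals.
\<close>

lemma emeasure_interval_measure_add:
  fixes F G :: "real \<Rightarrow> real"
  assumes F: "mono F" "\<And>a. continuous (at_right a) F" and G: "mono G" "\<And>a. continuous (at_right a) G"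
    and B: "B \<in> sets borel"
  shows "emeasure (interval_measure (\<lambda>x. F x + G x)) B = emeasure (interval_measure F) B + emeasure (interval_measure G) B"
proof -
  define \<mu> where "\<mu> = (\<lambda>B. emeasure (interval_measure F) B + emeasure (interval_measure G) B)"
  define M where "M = measure_of UNIV (sets borel) \<mu>"
  have ca: "countably_additive (sets borel) \<mu>"
  proof (rule countably_additiveI)
    fix X :: "nat \<Rightarrow> real set" assume X: "range X \<subseteq> sets borel" "disjoint_family X"
    have "(\<Sum>i. emeasure (interval_measure F) (X i)) = emeasure (interval_measure F) (\<Union>i. X i)"
      "(\<Sum>i. emeasure (interval_measure G) (X i)) = emeasure (interval_measure G) (\<Union>i. X i)"
      using X by (intro suminf_emeasure; simp)+
    then show "(\<Sum>i. \<mu> (X i)) = \<mu> (\<Union> (range X))"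
      by (simp add: \<mu>_def suminf_add[symmetric])
  qed
  have pos: "positive (sets borel) \<mu>" by (simp add: positive_def \<mu>_def)
  have sM: "sets M = sets borel"
    unfolding M_def using sets.sigma_sets_eq[of "borel :: real measure"] by (simp add: sets_measure_of_conv)
  have em: "emeasure M X = \<mu> X" if "X \<in> sets borel" for X
  proof (rule emeasure_measure_of[OF M_def])
    show "positive (sets M) \<mu>" "countably_additive (sets M) \<mu>" using pos ca by (simp_all add: sM)
    show "X \<in> sets M" using that sM by simp
  qed simp
  have "M = interval_measure (\<lambda>x. F x + G x)"
  proof (rule interval_measure_unique)
    show "mono (\<lambda>x. F x + G x)" using F(1) G(1) by (auto simp: mono_def intro!: add_mono)
    show "continuous (at_right a) (\<lambda>x. F x + G x)" for a by (intro continuous_intros F G)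
    fix a b :: real assume ab: "a \<le> b"
    have F': "F x \<le> F y" if "x \<le> y" for x y using F(1) that by (auto simp: mono_def)
    have G': "G x \<le> G y" if "x \<le> y" for x y using G(1) that by (auto simp: mono_def)
    have "emeasure M {a<..b} = ennreal (F b - F a) + ennreal (G b - G a)"
      by (subst em) (auto simp: \<mu>_def emeasure_interval_measure_Ioc[OF ab F' F(2)] emeasure_interval_measure_Ioc[OF ab G' G(2)])
    also have "\<dots> = ennreal (F b + G b - (F a + G a))"
      using F'[OF ab] G'[OF ab] by (subst ennreal_plus[symmetric]) (auto simp: algebra_simps)
    finally show "emeasure M {a<..b} = ennreal (F b + G b - (F a + G a))" .
  qed (rule sM)
  then show ?thesis using em[OF B] by (simp add: \<mu>_def)
qed

lemma emeasure_interval_measure_le: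
  fixes F :: "real \<Rightarrow> real"
  assumes F: "mono F" "\<And>a. continuous (at_right a) F" and M: "\<And>s t. F t - F s \<le> M"
    and B: "B \<in> sets borel"
  shows "emeasure (interval_measure F) B \<le> ennreal M"
proof -
  have F': "F x \<le> F y" if "x \<le> y" for x y using F(1) that by (auto simp: mono_def)
  let ?A = "\<lambda>n::nat. {- real n <..real n}"
  have U: "(\<Union>i. ?A i) = UNIV"
  proof safe
    fix x :: real
    obtain n where "\<bar>x\<bar> < real n" using reals_Archimedean2 by blast
    then show "x \<in> (\<Union>i. ?A i)" by (intro UN_I[of n]) auto
  qed simp
  have "(SUP n. emeasure (interval_measure F) (?A n)) = emeasure (interval_measure F) (\<Union>i. ?A i)"
    by (intro SUP_emeasure_incseq) (auto simp: incseq_def)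
  moreover have "(SUP n. emeasure (interval_measure F) (?A n)) \<le> ennreal M"
  proof (rule SUP_least)
    fix n
    show "emeasure (interval_measure F) (?A n) \<le> ennreal M"
      using emeasure_interval_measure_Ioc[of "- real n" "real n" F] F' F(2) M by (simp add: ennreal_leI)
  qed
  ultimately have "emeasure (interval_measure F) UNIV \<le> ennreal M" by (simp add: U)
  moreover have "emeasure (interval_measure F) B \<le> emeasure (interval_measure F) UNIV"
    by (intro emeasure_mono) auto
  ultimately show ?thesis by (rule order_trans[rotated])
qed

lemma emeasure_interval_measure_linear:
  assumes "c \<ge> 0" "B \<in> sets borel"
  shows "emeasure (interval_measure (\<lambda>x. c * x)) B = ennreal c * emeasure lborel B"
proof -
  have "density lborel (\<lambda>_. ennreal c) = interval_measure (\<lambda>x. c * x)"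
  proof (rule interval_measure_unique)
    show "mono (\<lambda>x. c * x)" using assms by (auto simp: mono_def intro: mult_left_mono)
    show "continuous (at_right a) (\<lambda>x. c * x)" for a by (intro continuous_intros)
    fix a b :: real assume "a \<le> b"
    then show "emeasure (density lborel (\<lambda>_. ennreal c)) {a<..b} = ennreal (c * b - c * a)"
      using assms by (simp add: emeasure_density_const ennreal_mult[symmetric] algebra_simps)
  qed simp
  then show ?thesis using assms by (metis emeasure_density_const sets_lborel)
qed

text \<open>
  The family of bounds, with \<open>\<epsilon>\<close> arbitrarily small at the price of a large constant \<open>c\<close>, is a
  substitute for an epsilon-delta definition of absolute continuity: writing the dominating function
  as \<open>V + H\<close> with \<open>H\<close> monotone shows that the Stieltjes measure of \<open>V\<close> gives a Lebesgue null set at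
  most the mass \<open>\<epsilon> B\<close>. The density then comes from the Radon-Nikodym theorem and is the derivative
  of \<open>V\<close> almost everywhere by Lebesgue differentiation.
\<close>

theorem monotone_density_of_domination:
  fixes V A :: "real \<Rightarrow> real"
  assumes V: "mono V" "\<And>s t. V t - V s \<le> M"
    and A: "mono A" "\<And>a. continuous (at_right a) A" "\<And>s t. A t - A s \<le> B"
    and dom: "\<And>\<epsilon>. \<epsilon> > 0 \<Longrightarrow> \<exists>c\<ge>0. \<forall>s t. s \<le> t \<longrightarrow> V t - V s \<le> c * (t - s) + \<epsilon> * (A t - A s)"
  shows "\<exists>\<rho>. \<rho> \<in> borel_measurable borel \<and> (\<forall>x. 0 \<le> \<rho> x) \<and> integrable lborel \<rho> \<and>
     (\<integral>\<^sup>+ x. ennreal (\<rho> x) \<partial>lborel) \<le> ennreal M \<and>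
     (\<forall>s t. s \<le> t \<longrightarrow> (\<rho> has_integral (V t - V s)) {s..t}) \<and>
     (AE x in lborel. (V has_real_derivative \<rho> x) (at x))"
proof -
  have V': "V x \<le> V y" if "x \<le> y" for x y using V(1) that by (auto simp: mono_def)
  have A': "A x \<le> A y" if "x \<le> y" for x y using A(1) that by (auto simp: mono_def)
  obtain c1 where c: "c1 \<ge> 0" "\<And>s t. s \<le> t \<Longrightarrow> V t - V s \<le> c1 * (t - s) + 1 * (A t - A s)"
    using dom[of 1] by auto
  have Vc: "continuous (at_right a) V" for a
    unfolding continuous_within
  proof (rule tendsto_sandwich)
    show "\<forall>\<^sub>F x in at_right a. V x \<le> V a + (c1 * (x - a) + (A x - A a))"
      using c(2)[of a] by (auto simp: eventually_at_filter algebra_simps)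
    show "\<forall>\<^sub>F x in at_right a. V a \<le> V x" using V' by (auto simp: eventually_at_filter)
    have "((\<lambda>x. V a + (c1 * (x - a) + (A x - A a))) \<longlongrightarrow> V a + (c1 * (a - a) + (A a - A a))) (at_right a)"
      using A(2)[of a, unfolded continuous_within] by (intro tendsto_intros)
    then show "((\<lambda>x. V a + (c1 * (x - a) + (A x - A a))) \<longlongrightarrow> V a) (at_right a)" by simp
  qed simp
  let ?\<mu> = "interval_measure V"
  have B0: "B \<ge> 0" using A(3)[of 0 0] by simp
  have ac: "absolutely_continuous lborel ?\<mu>"
    unfolding absolutely_continuous_def
  proof
    fix N assume N: "N \<in> null_sets (lborel :: real measure)"
    then have Nb: "N \<in> sets borel" "emeasure lborel N = 0" by auto
    have "emeasure ?\<mu> N \<le> 0 + ennreal e" if e: "e > 0" for e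
    proof -
      define \<epsilon> where "\<epsilon> = e / (B + 1)"
      have \<epsilon>: "\<epsilon> > 0" "\<epsilon> * B \<le> e" using e B0 by (auto simp: \<epsilon>_def field_simps)
      obtain c where c: "c \<ge> 0" "\<And>s t. s \<le> t \<Longrightarrow> V t - V s \<le> c * (t - s) + \<epsilon> * (A t - A s)"
        using dom[OF \<epsilon>(1)] by auto
      define H where "H = (\<lambda>t. c * t + \<epsilon> * A t - V t)"
      have HV: "(\<lambda>t. V t + H t) = (\<lambda>t. c * t + \<epsilon> * A t)" by (auto simp: H_def)
      have H: "mono H" "continuous (at_right a) H" for a
      proof -
        show "mono H"
        proof (rule monoI)
          fix s t :: real assume "s \<le> t"
          then show "H s \<le> H t" using c(2)[of s t] by (simp add: H_def algebra_simps)
        qed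
        show "continuous (at_right a) H" unfolding H_def by (intro continuous_intros A Vc)
      qed
      have eA: "mono (\<lambda>t. \<epsilon> * A t)" "continuous (at_right a) (\<lambda>t. \<epsilon> * A t)" for a
        using A' \<epsilon> by (auto simp: mono_def intro!: continuous_intros A mult_left_mono)
      have ct: "mono (\<lambda>t. c * t)" using c by (auto simp: mono_def intro!: mult_left_mono)
      have "emeasure ?\<mu> N \<le> emeasure ?\<mu> N + emeasure (interval_measure H) N" by simp
      also have "\<dots> = emeasure (interval_measure (\<lambda>t. c * t + \<epsilon> * A t)) N"
        using emeasure_interval_measure_add[OF V(1) Vc H Nb(1)] by (simp add: HV)
      also have "\<dots> = emeasure (interval_measure (\<lambda>t. c * t)) N + emeasure (interval_measure (\<lambda>t. \<epsilon> * A t)) N"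
        by (rule emeasure_interval_measure_add[OF ct _ eA Nb(1)]) (intro continuous_intros)
      also have "emeasure (interval_measure (\<lambda>t. c * t)) N = 0"
        using emeasure_interval_measure_linear[OF c(1) Nb(1)] Nb(2) by simp
      also have "emeasure (interval_measure (\<lambda>t. \<epsilon> * A t)) N \<le> ennreal e"
      proof (rule emeasure_interval_measure_le[OF eA _ Nb(1)])
        fix s t
        have "\<epsilon> * (A t - A s) \<le> \<epsilon> * B" using A(3)[of t s] \<epsilon>(1) by (intro mult_left_mono) auto
        then show "\<epsilon> * A t - \<epsilon> * A s \<le> e" using \<epsilon>(2) by (simp add: algebra_simps)
      qed
      finally show ?thesis by simp
    qed
    then have "emeasure ?\<mu> N \<le> 0" by (rule ennreal_le_epsilon)
    then show "N \<in> null_sets ?\<mu>" using Nb by (auto simp: null_sets_def)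
  qed
  then obtain f where f: "f \<in> borel_measurable lborel" "density lborel f = ?\<mu>"
    using sigma_finite_measure.Radon_Nikodym[OF lborel.sigma_finite_measure_axioms ac] by auto
  have fm[measurable]: "f \<in> borel_measurable borel" using f(1) by simp
  define \<rho> where "\<rho> = (\<lambda>x. enn2real (f x))"
  have \<rho>m[measurable]: "\<rho> \<in> borel_measurable borel" unfolding \<rho>_def by measurable
  have ftot: "(\<integral>\<^sup>+ x. f x \<partial>lborel) \<le> ennreal M"
  proof -
    have "(\<integral>\<^sup>+ x. f x \<partial>lborel) = emeasure (density lborel f) UNIV" by (simp add: emeasure_density)
    also have "\<dots> \<le> ennreal M" unfolding f(2) by (rule emeasure_interval_measure_le[OF V(1) Vc V(2)]) simp
    finally show ?thesis .
  qed
  have "AE x in lborel. f x \<noteq> \<infinity>"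
    using ftot by (intro nn_integral_PInf_AE) (auto simp: top_unique)
  then have feq: "AE x in lborel. f x = ennreal (\<rho> x)"
    by eventually_elim (auto simp: \<rho>_def ennreal_enn2real_if)
  have tot: "(\<integral>\<^sup>+ x. ennreal (\<rho> x) \<partial>lborel) \<le> ennreal M"
    using ftot nn_integral_cong_AE[OF feq] by simp
  have int: "integrable lborel \<rho>"
    by (rule integrableI_bounded) (use tot in \<open>auto simp: \<rho>_def intro: le_less_trans\<close>)
  have hi: "(\<rho> has_integral (V t - V s)) {s..t}" if st: "s \<le> t" for s t
  proof -
    have "ennreal (V t - V s) = emeasure (density lborel f) {s<..t}"
      unfolding f(2) by (rule emeasure_interval_measure_Ioc[OF st V' Vc, symmetric])
    also have "\<dots> = (\<integral>\<^sup>+ x. f x * indicator {s<..t} x \<partial>lborel)" by (simp add: emeasure_density)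
    also have "\<dots> = (\<integral>\<^sup>+ x. ennreal (indicator {s..t} x * \<rho> x) \<partial>lborel)"
    proof (rule nn_integral_cong_AE)
      show "AE x in lborel. f x * indicator {s<..t} x = ennreal (indicator {s..t} x * \<rho> x)"
        using feq AE_lborel_singleton[of s] by eventually_elim (auto simp: indicator_def)
    qed
    finally have nn: "(\<integral>\<^sup>+ x. ennreal (indicator {s..t} x * \<rho> x) \<partial>lborel) = ennreal (V t - V s)" ..
    have "((\<lambda>x. indicator {s..t} x * \<rho> x) has_integral (V t - V s)) UNIV"
      by (rule nn_integral_has_integral) (use nn V'[OF st] in \<open>auto simp: \<rho>_def\<close>)
    moreover have "(\<lambda>x. indicator {s..t} x * \<rho> x) = (\<lambda>x. if x \<in> {s..t} then \<rho> x else 0)"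
      by (auto simp: indicator_def)
    ultimately show ?thesis by (simp only: has_integral_restrict_UNIV)
  qed
  have "negligible (\<Union>n::nat. {x \<in> {- real n<..<real n}. \<not> ((\<lambda>y. integral {- real n..y} \<rho>) has_real_derivative \<rho> x) (at x)})"
  proof (rule negligible_countable_Union)
    fix S assume "S \<in> range (\<lambda>n::nat. {x \<in> {- real n<..<real n}. \<not> ((\<lambda>y. integral {- real n..y} \<rho>) has_real_derivative \<rho> x) (at x)})"
    then obtain n :: nat where S: "S = {x \<in> {- real n<..<real n}. \<not> ((\<lambda>y. integral {- real n..y} \<rho>) has_real_derivative \<rho> x) (at x)}"
      by blast
    have "\<rho> integrable_on {- real n..real n}" using hi[of "- real n" "real n"] by auto
    then show "negligible S" unfolding S by (rule Lebesgue_differentiation_interval)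
  qed simp
  then have "AE x in lebesgue. x \<notin> (\<Union>n::nat. {x \<in> {- real n<..<real n}. \<not> ((\<lambda>y. integral {- real n..y} \<rho>) has_real_derivative \<rho> x) (at x)})"
    unfolding negligible_iff_null_sets by (rule AE_not_in)
  then have "AE x in lebesgue. (V has_real_derivative \<rho> x) (at x)"
  proof eventually_elim
    case (elim x)
    obtain n where n: "\<bar>x\<bar> < real n" using reals_Archimedean2 by blast
    then have "((\<lambda>y. integral {- real n..y} \<rho>) has_real_derivative \<rho> x) (at x)" using elim by auto
    then have "((\<lambda>y. V (- real n) + integral {- real n..y} \<rho>) has_real_derivative \<rho> x) (at x)"
      using DERIV_add[OF DERIV_const] by fastforce
    then show ?case
    proof (rule has_field_derivative_transform_within_open)
      show "open {- real n<..}" "x \<in> {- real n<..}" using n by auto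
      fix y assume "y \<in> {- real n<..}"
      then show "V (- real n) + integral {- real n..y} \<rho> = V y"
        using integral_unique[OF hi[of "- real n" y]] by auto
    qed
  qed
  then have "AE x in lborel. (V has_real_derivative \<rho> x) (at x)" by (simp add: AE_completion_iff)
  then show ?thesis using int tot hi \<rho>m by (intro exI[of _ \<rho>]) (auto simp: \<rho>_def)
qed

section \<open>Arc length and metric speed\<close>

text \<open>
  The times form an infinite sequence of which only the first \<open>n + 1\<close> members count: it can then be
  extended and clamped pointwise.
\<close>

definition chain_sum :: "(real \<Rightarrow> 'a::metric_space) \<Rightarrow> nat \<Rightarrow> (nat \<Rightarrow> real) \<Rightarrow> real" where
  "chain_sum u n c = (\<Sum>j<n. dist (u (c j)) (u (c (Suc j))))"

definition curve_length :: "(real \<Rightarrow> 'a::metric_space) \<Rightarrow> real \<Rightarrow> real" where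
  "curve_length u t = Sup {chain_sum u n c | n c. mono c \<and> (\<forall>j. c j \<le> t)}"

text \<open>
  All comparisons of \<open>u\<close> with real functions are phrased by this relation: it telescopes along
  partitions, and the arc length is its least solution (\<open>curve_length_least\<close> below).
\<close>

definition dominates_increments :: "(real \<Rightarrow> 'a::metric_space) \<Rightarrow> (real \<Rightarrow> real) \<Rightarrow> bool" where
  "dominates_increments u \<Lambda> \<longleftrightarrow> (\<forall>s t. s \<le> t \<longrightarrow> dist (u s) (u t) \<le> \<Lambda> t - \<Lambda> s)"

lemma dominates_increments_mono: "dominates_increments u \<Lambda> \<Longrightarrow> mono \<Lambda>"
  unfolding dominates_increments_def mono_def by (meson diff_ge_0_iff_ge order_trans zero_le_dist)

lemma chain_sum_le:
  assumes "dominates_increments u \<Lambda>" "mono c"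
  shows "chain_sum u n c \<le> \<Lambda> (c n) - \<Lambda> (c 0)"
proof (induction n)
  case (Suc n)
  have "dist (u (c n)) (u (c (Suc n))) \<le> \<Lambda> (c (Suc n)) - \<Lambda> (c n)"
    using assms by (auto simp: dominates_increments_def mono_def)
  then show ?case using Suc by (simp add: chain_sum_def)
qed (simp add: chain_sum_def)

context
  fixes u :: "real \<Rightarrow> 'a::metric_space" and \<Lambda> M
  assumes dom: "dominates_increments u \<Lambda>" and bnd: "\<And>s t. \<Lambda> t - \<Lambda> s \<le> M"
begin

lemma chain_sum_bdd: "bdd_above {chain_sum u n c | n c. mono c \<and> (\<forall>j. c j \<le> t)}"
proof (rule bdd_aboveI[of _ M])
  fix x assume "x \<in> {chain_sum u n c | n c. mono c \<and> (\<forall>j. c j \<le> t)}"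
  then obtain n c where x: "x = chain_sum u n c" "mono c" by auto
  show "x \<le> M" using chain_sum_le[OF dom x(2), of n] bnd[of "c n" "c 0"] x(1) by simp
qed

lemma chain_sum_le_length: "mono c \<Longrightarrow> (\<And>j. c j \<le> t) \<Longrightarrow> chain_sum u n c \<le> curve_length u t"
  unfolding curve_length_def by (rule cSup_upper[OF _ chain_sum_bdd]) blast

lemma curve_length_nonneg: "0 \<le> curve_length u t"
  using chain_sum_le_length[of "\<lambda>_. t" t 0] by (simp add: chain_sum_def)

lemma curve_length_leI:
  assumes "\<And>n c. mono c \<Longrightarrow> (\<And>j. c j \<le> t) \<Longrightarrow> chain_sum u n c \<le> K"
  shows "curve_length u t \<le> K"
proof -
  have "chain_sum u 0 (\<lambda>_. t) \<in> {chain_sum u n c | n c. mono c \<and> (\<forall>j. c j \<le> t)}"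
    by (auto simp: mono_def)
  then show ?thesis unfolding curve_length_def by (intro cSup_least) (use assms in blast)+
qed

lemma curve_length_bound: "curve_length u t \<le> M"
  using chain_sum_le[OF dom] bnd by (intro curve_length_leI) (meson order_trans)

lemma dominates_increments_length: "dominates_increments u (curve_length u)"
  unfolding dominates_increments_def
proof (intro allI impI)
  fix s t :: real assume st: "s \<le> t"
  have "curve_length u s \<le> curve_length u t - dist (u s) (u t)"
  proof (rule curve_length_leI)
    fix n and c :: "nat \<Rightarrow> real" assume c: "mono c" "\<And>j. c j \<le> s"
    \<comment> \<open>Append the times \<open>s\<close> and \<open>t\<close> to the chain.\<close>
    define c' where "c' = (\<lambda>j. if j \<le> n then c j else if j = Suc n then s else t)"
    have c': "mono c'" "\<And>j. c' j \<le> t"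
      using c st order_trans[OF c(2) st] by (auto simp: mono_def c'_def)
    have "chain_sum u n c + dist (u (c n)) (u s) + dist (u s) (u t) = chain_sum u (Suc (Suc n)) c'"
      by (simp add: chain_sum_def c'_def)
    then have "chain_sum u n c + dist (u s) (u t) \<le> chain_sum u (Suc (Suc n)) c'"
      using zero_le_dist[of "u (c n)" "u s"] by linarith
    also have "\<dots> \<le> curve_length u t" by (rule chain_sum_le_length[OF c'])
    finally show "chain_sum u n c \<le> curve_length u t - dist (u s) (u t)" by simp
  qed
  then show "dist (u s) (u t) \<le> curve_length u t - curve_length u s" by simp
qed

text \<open>
  Splitting a chain at time \<open>s\<close>: the part before \<open>s\<close> is a competitor for the length up to \<open>s\<close>, and
  the part after \<open>s\<close> telescopes to an increment of \<open>\<Theta>\<close>.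
\<close>

lemma curve_length_least:
  assumes \<Theta>: "dominates_increments u \<Theta>" and st: "s \<le> t"
  shows "curve_length u t - curve_length u s \<le> \<Theta> t - \<Theta> s"
proof -
  have \<Theta>': "\<Theta> x \<le> \<Theta> y" if "x \<le> y" for x y using dominates_increments_mono[OF \<Theta>] that by (auto simp: mono_def)
  have "curve_length u t \<le> curve_length u s + (\<Theta> t - \<Theta> s)"
  proof (rule curve_length_leI)
    fix n and c :: "nat \<Rightarrow> real" assume c: "mono c" "\<And>j. c j \<le> t"
    define a where "a = (\<lambda>j. min s (c j))"
    define b where "b = (\<lambda>j. max s (c j))"
    have cm: "c j \<le> c (Suc j)" for j using c(1) by (auto simp: mono_def)
    have "dist (u (c j)) (u (c (Suc j))) \<le> dist (u (a j)) (u (a (Suc j))) + (\<Theta> (b (Suc j)) - \<Theta> (b j))" for j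
    proof -
      have d: "dist (u x) (u y) \<le> \<Theta> y - \<Theta> x" if "x \<le> y" for x y
        using \<Theta> that by (auto simp: dominates_increments_def)
      consider "c (Suc j) \<le> s" | "s \<le> c j" | "c j < s" "s < c (Suc j)" by linarith
      then show ?thesis
      proof cases
        case 1
        then show ?thesis using cm[of j] by (simp add: a_def b_def min_def max_def)
      next
        case 2
        then show ?thesis using cm[of j] d[of "c j" "c (Suc j)"] by (simp add: a_def b_def)
      next
        case 3
        then show ?thesis using d[of s "c (Suc j)"] dist_triangle[of "u (c j)" "u (c (Suc j))" "u s"]
          by (simp add: a_def b_def)
      qed
    qed
    then have "chain_sum u n c \<le> (\<Sum>j<n. dist (u (a j)) (u (a (Suc j))) + (\<Theta> (b (Suc j)) - \<Theta> (b j)))"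
      unfolding chain_sum_def by (intro sum_mono) auto
    also have "\<dots> = chain_sum u n a + (\<Theta> (b n) - \<Theta> (b 0))"
      using sum_lessThan_telescope[of "\<lambda>j. \<Theta> (b j)" n] by (simp add: sum.distrib chain_sum_def)
    also have "chain_sum u n a \<le> curve_length u s"
      using c(1) by (intro chain_sum_le_length) (auto simp: a_def mono_def intro: min.coboundedI2)
    also have "\<Theta> (b n) - \<Theta> (b 0) \<le> \<Theta> t - \<Theta> s"
      using \<Theta>'[of "b n" t] \<Theta>'[of s "b 0"] c(2)[of n] st by (auto simp: b_def)
    finally show "chain_sum u n c \<le> curve_length u s + (\<Theta> t - \<Theta> s)" by simp
  qed
  then show ?thesis by simp
qed

end

text \<open>
  Clamping the chain at \<open>t\<close> turns the length of a fixed polygon into a function of time. Between two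
  consecutive times of the chain it is, up to a constant, the distance to the last vertex.
\<close>

definition chain_sum_upto :: "(real \<Rightarrow> 'a::metric_space) \<Rightarrow> nat \<Rightarrow> (nat \<Rightarrow> real) \<Rightarrow> real \<Rightarrow> real" where
  "chain_sum_upto u n c t = chain_sum u n (\<lambda>j. min t (c j))"

lemma chain_sum_upto_increment:
  assumes c: "mono c" and st: "s \<le> t"
  shows "\<bar>chain_sum_upto u n c t - chain_sum_upto u n c s\<bar> \<le> chain_sum u n (\<lambda>j. max s (min t (c j)))"
proof -
  have "\<bar>dist (u (min t a)) (u (min t b)) - dist (u (min s a)) (u (min s b))\<bar>
      \<le> dist (u (max s (min t a))) (u (max s (min t b)))" if "a \<le> b" for a b
  proof -
    consider "b \<le> s" | "s \<le> a" | "a < s" "s < b" by linarith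
    then show ?thesis
    proof cases
      case 1
      then have "min t b = b" "min s b = b" "min t a = a" "min s a = a" using st that by auto
      then show ?thesis by simp
    next
      case 2
      then show ?thesis using st that by (simp add: min_def max_def)
    next
      case 3
      have "\<bar>dist (u a) (u (min t b)) - dist (u a) (u s)\<bar> \<le> dist (u s) (u (min t b))"
        using dist_triangle[of "u a" "u (min t b)" "u s"] dist_triangle[of "u a" "u s" "u (min t b)"]
        by (simp add: abs_le_iff dist_commute)
      then show ?thesis using 3 st by (simp add: min_def max_def split: if_splits)
    qed
  qed
  then have "(\<Sum>j<n. \<bar>dist (u (min t (c j))) (u (min t (c (Suc j)))) - dist (u (min s (c j))) (u (min s (c (Suc j))))\<bar>)
      \<le> chain_sum u n (\<lambda>j. max s (min t (c j)))"
    unfolding chain_sum_def using c by (intro sum_mono) (auto simp: mono_def)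
  then show ?thesis
    unfolding chain_sum_upto_def chain_sum_def sum_subtractf[symmetric]
    by (rule order_trans[OF sum_abs])
qed

lemma clamped_chain_mono: "mono c \<Longrightarrow> mono (\<lambda>j::nat. max s (min t (c j :: real)))"
  unfolding mono_def by (meson max.mono min.mono order_refl)

lemma chain_sum_upto_increment_le:
  assumes \<Theta>: "dominates_increments u \<Theta>" and c: "mono c" and st: "s \<le> t"
  shows "\<bar>chain_sum_upto u n c t - chain_sum_upto u n c s\<bar> \<le> \<Theta> t - \<Theta> s"
proof -
  let ?z = "\<lambda>j. max s (min t (c j))"
  have \<Theta>': "\<Theta> x \<le> \<Theta> y" if "x \<le> y" for x y using dominates_increments_mono[OF \<Theta>] that by (auto simp: mono_def)
  have "chain_sum u n ?z \<le> \<Theta> (?z n) - \<Theta> (?z 0)"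
    by (rule chain_sum_le[OF \<Theta> clamped_chain_mono[OF c]])
  also have "\<dots> \<le> \<Theta> t - \<Theta> s"
    using \<Theta>'[of "?z n" t] \<Theta>'[of s "?z 0"] st by auto
  finally show ?thesis using chain_sum_upto_increment[OF c st, of u n] by linarith
qed

text \<open>
  If no time of the chain lies strictly between \<open>s\<close> and \<open>t\<close>, the clamped chain jumps directly from
  \<open>s\<close> to \<open>t\<close>, so its length is a single distance.
\<close>

lemma chain_sum_upto_increment_local:
  assumes c: "mono c" and st: "s \<le> t" and no: "\<And>j. j \<le> n \<Longrightarrow> c j \<le> s \<or> t \<le> c j"
  shows "\<bar>chain_sum_upto u n c t - chain_sum_upto u n c s\<bar> \<le> dist (u s) (u t)"
proof -
  let ?z = "\<lambda>j. max s (min t (c j))"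
  \<comment> \<open>The clamped chain takes only the two values \<open>s\<close> and \<open>t\<close>, in this order.\<close>
  define \<theta> where "\<theta> = (\<lambda>x. if x = s then 0 else dist (u s) (u t))"
  have z: "?z j = s \<or> ?z j = t" if "j \<le> n" for j using no[OF that] st by (auto simp: min_def max_def)
  have zm: "?z j \<le> ?z (Suc j)" for j using clamped_chain_mono[OF c, of s t] by (auto simp: mono_def)
  have "dist (u (?z j)) (u (?z (Suc j))) \<le> \<theta> (?z (Suc j)) - \<theta> (?z j)" if "j < n" for j
    using z[of j] z[of "Suc j"] zm[of j] that st by (auto simp: \<theta>_def)
  then have "chain_sum u n ?z \<le> (\<Sum>j<n. \<theta> (?z (Suc j)) - \<theta> (?z j))"
    unfolding chain_sum_def by (intro sum_mono) auto
  also have "\<dots> = \<theta> (?z n) - \<theta> (?z 0)" by (rule sum_lessThan_telescope)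
  also have "\<dots> \<le> dist (u s) (u t)" by (auto simp: \<theta>_def)
  finally show ?thesis using chain_sum_upto_increment[OF c st, of u n] by linarith
qed

text \<open>
  The length bounds the speed from above. From below, the speed is at least the derivative of any
  function whose increments near \<open>x\<close> are bounded by distances, and polygon lengths are such functions.
\<close>

lemma speed_eq_derivative_of_length:
  assumes V: "(V has_real_derivative m) (at x)" and dV: "dominates_increments u V"
    and W: "\<And>e. e > 0 \<Longrightarrow> \<exists>W w. (W has_real_derivative w) (at x) \<and> m - e < w \<and>
              (\<forall>\<^sub>F s in at x. \<bar>W s - W x\<bar> \<le> dist (u s) (u x))"
  shows "((\<lambda>s. dist (u s) (u x) / \<bar>s - x\<bar>) \<longlongrightarrow> m) (at x)"
proof (rule tendstoI)
  fix e :: real assume e: "e > 0"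
  obtain W w where W: "(W has_real_derivative w) (at x)" "m - e / 2 < w"
    "\<forall>\<^sub>F s in at x. \<bar>W s - W x\<bar> \<le> dist (u s) (u x)" using W[of "e / 2"] e by auto
  have squeeze: "dist b m < e" if "b \<le> a" "c \<le> b" "dist a m < e" "dist c w < e / 2" for a b c :: real
    using that W(2) unfolding dist_real_def abs_less_iff by linarith
  have "\<forall>\<^sub>F s in at x. dist ((V s - V x) / (s - x)) m < e"
    using V e unfolding has_field_derivative_iff by (auto dest: tendstoD)
  moreover have "\<forall>\<^sub>F s in at x. dist ((W s - W x) / (s - x)) w < e / 2"
    using tendstoD[OF W(1)[unfolded has_field_derivative_iff] half_gt_zero[OF e]] .
  moreover note W(3)
  moreover have "\<forall>\<^sub>F s in at x. s \<noteq> x" by (simp add: eventually_at_filter)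
  ultimately show "\<forall>\<^sub>F s in at x. dist (dist (u s) (u x) / \<bar>s - x\<bar>) m < e"
  proof eventually_elim
    case (elim s)
    have "dist (u s) (u x) / \<bar>s - x\<bar> \<le> (V s - V x) / (s - x)"
    proof (cases "x < s")
      case True
      then have "dist (u s) (u x) \<le> V s - V x"
        using dV by (simp add: dominates_increments_def dist_commute[of "u s"])
      then show ?thesis using True by (simp add: divide_right_mono)
    next
      case False
      then have "dist (u s) (u x) / (x - s) \<le> (V x - V s) / (x - s)"
        using dV by (auto simp: dominates_increments_def intro!: divide_right_mono)
      moreover have "(V x - V s) / (x - s) = (V s - V x) / (s - x)" using False elim by (simp add: field_simps)
      ultimately show ?thesis using False by simp
    qed
    moreover have "(W s - W x) / (s - x) \<le> \<bar>W s - W x\<bar> / \<bar>s - x\<bar>" by (metis abs_divide abs_ge_self)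
    moreover have "\<bar>W s - W x\<bar> / \<bar>s - x\<bar> \<le> dist (u s) (u x) / \<bar>s - x\<bar>"
      using elim by (intro divide_right_mono) auto
    ultimately show ?case using elim(1,2) W(2) squeeze by (meson order_trans)
  qed
qed

text \<open>
  Take polygons whose lengths approach the total length \<open>S\<close> of \<open>u\<close> with errors \<open>2\<^sup>-\<^sup>k\<close>. The excess
  \<open>F k\<close> of the arc length \<open>V\<close> over the \<open>k\<close>-th polygon is monotone with total increment at most
  \<open>2\<^sup>-\<^sup>k\<close>, so its derivatives \<open>\<rho> k\<close> have a summable series almost everywhere and tend to 0. Hence the
  derivatives of the polygon lengths tend to \<open>V'\<close>, and \<open>V'\<close> is the metric derivative of \<open>u\<close>. Since
  \<open>V\<close> is absolutely continuous, its increments are the integrals of \<open>V'\<close>. Clamping the time in the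
  hypothesis keeps the total length finite although \<open>u\<close> is defined on the whole line.
\<close>

theorem metric_speed_exists:
  fixes u :: "real \<Rightarrow> 'a::metric_space" and A :: "real \<Rightarrow> real"
  assumes T: "T \<ge> 0"
    and A: "mono A" "\<And>a. continuous (at_right a) A" "\<And>s t. A t - A s \<le> B"
    and dom: "\<And>\<epsilon>. \<epsilon> > 0 \<Longrightarrow> \<exists>c\<ge>0. dominates_increments u (\<lambda>t. c * max 0 (min T t) + \<epsilon> * A t)"
  shows "\<exists>m. m \<in> borel_measurable borel \<and> (\<forall>x. 0 \<le> m x) \<and> integrable lborel m \<and>
     (\<forall>s t. s \<le> t \<longrightarrow> m integrable_on {s..t} \<and> dist (u s) (u t) \<le> integral {s..t} m) \<and>
     (AE x in lborel. ((\<lambda>s. dist (u s) (u x) / \<bar>s - x\<bar>) \<longlongrightarrow> m x) (at x))"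
proof -
  obtain c1 where c1: "c1 \<ge> 0" and dom1: "dominates_increments u (\<lambda>t. c1 * max 0 (min T t) + 1 * A t)"
    using dom[of 1] by auto
  define \<Lambda> where "\<Lambda> = (\<lambda>t. c1 * max 0 (min T t) + 1 * A t)"
  define M where "M = c1 * T + B"
  have d\<Lambda>: "dominates_increments u \<Lambda>" using dom1 by (simp add: \<Lambda>_def)
  have b\<Lambda>: "\<Lambda> t - \<Lambda> s \<le> M" for s t
  proof -
    have "c1 * (max 0 (min T t) - max 0 (min T s)) \<le> c1 * T"
      using c1 T by (intro mult_left_mono) auto
    then show ?thesis using A(3)[of t s] by (simp add: \<Lambda>_def M_def algebra_simps)
  qed
  define V where "V = curve_length u"
  note dV = dominates_increments_length[OF d\<Lambda> b\<Lambda>, folded V_def]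
  note V0 = curve_length_nonneg[OF d\<Lambda> b\<Lambda>, folded V_def]
  note VM = curve_length_bound[OF d\<Lambda> b\<Lambda>, folded V_def]
  note Vleast = curve_length_least[OF d\<Lambda> b\<Lambda>, folded V_def]
  have Vmono: "mono V" by (rule dominates_increments_mono[OF dV])
  have clampd: "c * (max 0 (min T t) - max 0 (min T s)) \<le> c * (t - s)" if "c \<ge> 0" "s \<le> t" for c s t :: real
    using that by (intro mult_left_mono) auto
  have Vdom: "\<exists>c\<ge>0. \<forall>s t. s \<le> t \<longrightarrow> V t - V s \<le> c * (t - s) + \<epsilon> * (A t - A s)" if \<epsilon>: "\<epsilon> > 0" for \<epsilon>
  proof -
    obtain c where c: "c \<ge> 0" "dominates_increments u (\<lambda>t. c * max 0 (min T t) + \<epsilon> * A t)"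
      using dom[OF \<epsilon>] by auto
    have "V t - V s \<le> c * (t - s) + \<epsilon> * (A t - A s)" if "s \<le> t" for s t
      using Vleast[OF c(2) that] clampd[OF c(1) that] by (simp add: algebra_simps)
    then show ?thesis using c(1) by blast
  qed
  have VMM: "V t - V s \<le> M" for s t using V0[of s] VM[of t] by simp
  obtain m where m: "m \<in> borel_measurable borel" "\<And>x. 0 \<le> m x" "integrable lborel m"
     "\<And>s t. s \<le> t \<Longrightarrow> (m has_integral (V t - V s)) {s..t}"
     "AE x in lborel. (V has_real_derivative m x) (at x)"
    using monotone_density_of_domination[OF Vmono VMM A Vdom] by blast
  define S where "S = (SUP t. V t)"
  have VS: "V t \<le> S" for t unfolding S_def by (rule cSUP_upper) (use VM in \<open>auto intro!: bdd_aboveI\<close>)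
  have "\<exists>n c. mono c \<and> S - (1/2) ^ k < chain_sum u n c" for k :: nat
  proof -
    have "S - (1/2) ^ k < S" by simp
    then obtain t where t: "S - (1/2) ^ k < V t"
      unfolding S_def using less_cSUP_iff[of UNIV V, OF _ bdd_aboveI2[of _ V M, OF VM]] by auto
    show ?thesis
    proof (rule ccontr)
      assume "\<not> ?thesis"
      then have "chain_sum u n c \<le> S - (1/2) ^ k" if "mono c" for n c using that not_less by blast
      then have "V t \<le> S - (1/2) ^ k" unfolding V_def by (intro curve_length_leI[OF d\<Lambda> b\<Lambda>])
      then show False using t by simp
    qed
  qed
  then obtain N c where c: "\<And>k. mono (c k)" "\<And>k::nat. S - (1/2) ^ k < chain_sum u (N k) (c k)" by metis
  define W where "W = (\<lambda>k. chain_sum_upto u (N k) (c k))"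
  have W: "\<bar>W k t - W k s\<bar> \<le> V t - V s" if "s \<le> t" for k s t
    unfolding W_def by (rule chain_sum_upto_increment_le[OF dV c(1) that])
  define F where "F = (\<lambda>k t. V t - W k t)"
  have Fmono: "mono (F k)" for k
    using W[of _ _ k] by (fastforce simp: mono_def F_def abs_le_iff)
  have F1: "F k t \<le> (1/2) ^ k" for k t
  proof -
    let ?t = "max t (c k (N k))"
    have "W k ?t = chain_sum u (N k) (c k)"
      unfolding W_def chain_sum_upto_def chain_sum_def
    proof (rule sum.cong[OF refl])
      fix j assume "j \<in> {..<N k}"
      then have "c k j \<le> c k (N k)" "c k (Suc j) \<le> c k (N k)" using c(1)[of k] by (auto simp: mono_def)
      then have "min ?t (c k j) = c k j" "min ?t (c k (Suc j)) = c k (Suc j)" by auto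
      then show "dist (u (min ?t (c k j))) (u (min ?t (c k (Suc j)))) = dist (u (c k j)) (u (c k (Suc j)))" by simp
    qed
    then have "F k ?t \<le> (1/2) ^ k" using c(2)[of k] VS[of ?t] by (simp add: F_def)
    moreover have "F k t \<le> F k ?t" using Fmono[of k] by (auto simp: mono_def)
    ultimately show ?thesis by simp
  qed
  have F0: "0 \<le> F k t" for k t
  proof -
    let ?t = "min t (c k 0)"
    have "min ?t (c k j) = ?t" for j
    proof -
      have "c k 0 \<le> c k j" using c(1)[of k] by (auto simp: mono_def)
      then show ?thesis by auto
    qed
    then have "W k ?t = 0" unfolding W_def chain_sum_upto_def chain_sum_def by simp
    then have "0 \<le> F k ?t" using V0 by (simp add: F_def)
    moreover have "F k ?t \<le> F k t" using Fmono[of k] by (auto simp: mono_def)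
    ultimately show ?thesis by simp
  qed
  have Fd: "F k t - F k s \<le> (1/2) ^ k" for k s t using F0[of k s] F1[of k t] by simp
  have Fdom: "\<exists>c\<ge>0. \<forall>s t. s \<le> t \<longrightarrow> F k t - F k s \<le> c * (t - s) + \<epsilon> * (A t - A s)" if \<epsilon>: "\<epsilon> > 0" for k \<epsilon>
  proof -
    obtain c where c: "c \<ge> 0" "\<And>s t. s \<le> t \<Longrightarrow> V t - V s \<le> c * (t - s) + \<epsilon> / 2 * (A t - A s)"
      using Vdom[of "\<epsilon> / 2"] \<epsilon> by auto
    have "F k t - F k s \<le> (2 * c) * (t - s) + \<epsilon> * (A t - A s)" if "s \<le> t" for s t
    proof -
      have "F k t - F k s \<le> 2 * (V t - V s)" using W[OF that, of k] by (simp add: F_def abs_le_iff)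
      also have "\<dots> \<le> 2 * (c * (t - s) + \<epsilon> / 2 * (A t - A s))" using c(2)[OF that] by simp
      finally show ?thesis by simp
    qed
    then show ?thesis using c(1) by (intro exI[of _ "2 * c"]) auto
  qed
  have "\<exists>\<rho>. \<rho> \<in> borel_measurable borel \<and> (\<forall>x. 0 \<le> \<rho> x) \<and>
     (\<integral>\<^sup>+ x. ennreal (\<rho> x) \<partial>lborel) \<le> ennreal ((1/2) ^ k) \<and>
     (AE x in lborel. (F k has_real_derivative \<rho> x) (at x))" for k
    using monotone_density_of_domination[OF Fmono Fd A Fdom] by blast
  then obtain \<rho> where \<rho>: "\<And>k. \<rho> k \<in> borel_measurable borel" "\<And>k x. 0 \<le> \<rho> k x"
     "\<And>k::nat. (\<integral>\<^sup>+ x. ennreal (\<rho> k x) \<partial>lborel) \<le> ennreal ((1/2) ^ k)"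
     "\<And>k. AE x in lborel. (F k has_real_derivative \<rho> k x) (at x)"
    by metis
  have "AE x in lborel. (\<Sum>k. ennreal (\<rho> k x)) \<noteq> \<infinity>"
  proof (rule nn_integral_PInf_AE)
    show "(\<lambda>x. \<Sum>k. ennreal (\<rho> k x)) \<in> borel_measurable lborel" using \<rho>(1) by measurable
    have "(\<integral>\<^sup>+ x. (\<Sum>k. ennreal (\<rho> k x)) \<partial>lborel) = (\<Sum>k. \<integral>\<^sup>+ x. ennreal (\<rho> k x) \<partial>lborel)"
      using \<rho>(1) by (intro nn_integral_suminf) measurable
    also have "\<dots> \<le> (\<Sum>k. ennreal ((1/2) ^ k))" by (intro suminf_le \<rho>(3)) auto
    also have "\<dots> < \<infinity>" by (simp add: suminf_ennreal_eq[OF _ geometric_sums])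
    finally show "(\<integral>\<^sup>+ x. (\<Sum>k. ennreal (\<rho> k x)) \<partial>lborel) \<noteq> \<infinity>" by simp
  qed
  then have \<rho>lim: "AE x in lborel. (\<lambda>k. \<rho> k x) \<longlonglongrightarrow> 0"
  proof eventually_elim
    case (elim x)
    then have "summable (\<lambda>k. \<rho> k x)" by (intro summable_suminf_not_top) (auto simp: \<rho>(2))
    then show ?case by (rule summable_LIMSEQ_zero)
  qed
  have "AE x in lborel. x \<notin> (\<Union>k. range (c k))"
    by (intro AE_not_in countable_imp_null_set_lborel) auto
  moreover have "AE x in lborel. \<forall>k. (F k has_real_derivative \<rho> k x) (at x)"
    using \<rho>(4) by (simp add: AE_all_countable)
  moreover note \<rho>lim m(5)
  ultimately have "AE x in lborel. ((\<lambda>s. dist (u s) (u x) / \<bar>s - x\<bar>) \<longlongrightarrow> m x) (at x)"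
  proof eventually_elim
    case (elim x)
    show ?case
    proof (rule speed_eq_derivative_of_length[OF _ dV])
      show "(V has_real_derivative m x) (at x)" by (rule elim)
      fix e :: real assume "e > 0"
      with elim obtain k where k: "\<rho> k x < e"
        using order_tendstoD(2)[of "\<lambda>k. \<rho> k x" 0 sequentially e] by (auto dest!: eventually_happens)
      have "((\<lambda>t. V t - F k t) has_real_derivative m x - \<rho> k x) (at x)"
        using elim by (intro DERIV_diff) auto
      then have "(W k has_real_derivative m x - \<rho> k x) (at x)" by (simp add: F_def)
      moreover have "\<forall>\<^sub>F s in at x. \<bar>W k s - W k x\<bar> \<le> dist (u s) (u x)"
      proof -
        define d where "d = Min (insert 1 ((\<lambda>j. \<bar>c k j - x\<bar>) ` {..N k}))"
        have d: "d > 0" unfolding d_def using elim by (subst Min_gr_iff) auto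
        have dj: "d \<le> \<bar>c k j - x\<bar>" if "j \<le> N k" for j unfolding d_def using that by (intro Min_le) auto
        have "\<forall>\<^sub>F s in at x. dist s x < d" using d by (auto simp: eventually_at)
        then show ?thesis
        proof eventually_elim
          case (elim s)
          show ?case
          proof (cases "s \<le> x")
            case True
            have "c k j \<le> s \<or> x \<le> c k j" if "j \<le> N k" for j
              using dj[OF that] elim True by (auto simp: dist_real_def)
            then show ?thesis using chain_sum_upto_increment_local[OF c(1) True, of "N k" k u]
              by (simp add: W_def abs_minus_commute)
          next
            case False
            have "c k j \<le> x \<or> s \<le> c k j" if "j \<le> N k" for j
              using dj[OF that] elim False by (auto simp: dist_real_def)
            then show ?thesis using chain_sum_upto_increment_local[OF c(1), of x s "N k" k u] False
              by (simp add: W_def dist_commute)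
          qed
        qed
      qed
      ultimately show "\<exists>W w. (W has_real_derivative w) (at x) \<and> m x - e < w \<and> (\<forall>\<^sub>F s in at x. \<bar>W s - W x\<bar> \<le> dist (u s) (u x))"
        using k by (intro exI[of _ "W k"] exI[of _ "m x - \<rho> k x"]) auto
    qed
  qed
  moreover have "m integrable_on {s..t} \<and> dist (u s) (u t) \<le> integral {s..t} m" if "s \<le> t" for s t
    using m(4)[OF that] dV that by (auto simp: integral_unique dominates_increments_def)
  ultimately show ?thesis using m by (intro exI[of _ m]) auto
qed

section \<open>Integrating a one-sided bound on difference quotients\<close>

lemma powr_neg_diff_bounds:
  fixes p a r s :: real
  assumes "p > 0" "0 < a" "a \<le> r" "r \<le> s"
  shows "r powr (-p) - s powr (-p) \<le> p * a powr (-p - 1) * (s - r)" "s powr (-p) \<le> r powr (-p)"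
    and "s powr (-p) - r powr (-p) \<le> (-p) * s powr (-p - 1) * (s - r)"
proof -
  have "\<exists>z. r \<le> z \<and> z \<le> s \<and> s powr (-p) - r powr (-p) = (s - r) * ((-p) * z powr (-p - 1))"
  proof (cases "r = s")
    case False
    then have "r < s" using assms by simp
    then have "\<exists>z. r < z \<and> z < s \<and> s powr (-p) - r powr (-p) = (s - r) * ((-p) * z powr (-p - 1))"
      using assms has_real_derivative_powr[of _ "-p"] by (intro MVT2) auto
    then show ?thesis by (meson less_imp_le)
  qed (use assms in auto)
  then obtain z where z: "r \<le> z" "z \<le> s" "s powr (-p) - r powr (-p) = (s - r) * ((-p) * z powr (-p - 1))"
    by blast
  have "z powr (-p - 1) \<le> a powr (-p - 1)"
    using assms z by (intro powr_mono2') auto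
  then have "(s - r) * p * z powr (-p - 1) \<le> (s - r) * p * a powr (-p - 1)"
    using assms by (intro mult_left_mono) auto
  then show "r powr (-p) - s powr (-p) \<le> p * a powr (-p - 1) * (s - r)"
    using z by (simp add: algebra_simps)
  have "s powr (-p - 1) \<le> z powr (-p - 1)"
    using assms z by (intro powr_mono2') auto
  then have "(s - r) * p * s powr (-p - 1) \<le> (s - r) * p * z powr (-p - 1)"
    using assms by (intro mult_left_mono) auto
  then show "s powr (-p) - r powr (-p) \<le> (-p) * s powr (-p - 1) * (s - r)"
    using z by (simp add: algebra_simps)
  show "s powr (-p) \<le> r powr (-p)" using assms by (intro powr_mono2') auto
qed

lemma has_integral_le_off_negligible:
  fixes f g :: "real \<Rightarrow> real"
  assumes f: "(f has_integral i) S" and g: "(g has_integral j) S" and N: "negligible N"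
    and le: "\<And>x. x \<in> S - N \<Longrightarrow> f x \<le> g x"
  shows "i \<le> j"
proof (rule has_integral_le)
  show "((\<lambda>x. if x \<in> N then 0 else f x) has_integral i) S"
    by (rule has_integral_spike[OF N _ f]) auto
  show "((\<lambda>x. if x \<in> N then 0 else g x) has_integral j) S"
    by (rule has_integral_spike[OF N _ g]) auto
qed (use le in auto)

lemma has_integral_shift_difference:
  fixes \<gamma> :: "real \<Rightarrow> real"
  assumes \<gamma>: "\<gamma> integrable_on {a..b}" and \<delta>: "0 < \<delta>" "\<delta> < b - a"
  shows "((\<lambda>x. \<gamma> (x + \<delta>) - \<gamma> x) has_integral
      integral {b - \<delta>..b} \<gamma> - integral {a..a + \<delta>} \<gamma>) {a..b - \<delta>}"
proof -
  have gi: "\<gamma> integrable_on {c..d}" if "a \<le> c" "d \<le> b" for c d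
    by (rule integrable_subinterval_real[OF \<gamma>]) (use that in auto)
  have sh: "((\<lambda>x. \<gamma> (x + \<delta>)) has_integral integral {a + \<delta>..b} \<gamma>) {a..b - \<delta>}"
    using has_integral_affinity[of \<gamma> "integral {a + \<delta>..b} \<gamma>" "a + \<delta>" b 1 \<delta>] gi[of "a + \<delta>" b] \<delta>
    by (simp add: image_affinity_cbox integrable_integral flip: interval_cbox)
  have "((\<lambda>x. \<gamma> (x + \<delta>) - \<gamma> x) has_integral integral {a + \<delta>..b} \<gamma> - integral {a..b - \<delta>} \<gamma>) {a..b - \<delta>}"
    using \<delta> by (intro has_integral_diff sh integrable_integral gi) auto
  moreover have "integral {a + \<delta>..b} \<gamma> - integral {a..b - \<delta>} \<gamma>
      = integral {b - \<delta>..b} \<gamma> - integral {a..a + \<delta>} \<gamma>"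
    using Henstock_Kurzweil_Integration.integral_combine[of a "a + \<delta>" b \<gamma>]
          Henstock_Kurzweil_Integration.integral_combine[of a "b - \<delta>" b \<gamma>] \<gamma> \<delta> by simp
  ultimately show ?thesis by simp
qed

text \<open>
  Averaging the difference quotients with step \<open>\<delta>\<close> over \<open>{a..b - \<delta>}\<close> telescopes to means of \<open>\<gamma>\<close>
  over short intervals at the two endpoints, and the quadratic error disappears as \<open>\<delta>\<close> tends to 0.
  The one-sided bound \<open>L\<close> compares these means with \<open>\<gamma> b\<close> and \<open>\<gamma> a\<close>, and makes \<open>\<gamma>\<close> integrable as
  the difference of two monotone functions.
\<close>

lemma increment_le_integral_of_right_bound:
  fixes \<gamma> h :: "real \<Rightarrow> real"
  assumes ab: "a \<le> b" and L: "\<And>r s. a \<le> r \<Longrightarrow> r \<le> s \<Longrightarrow> s \<le> b \<Longrightarrow> \<gamma> s - \<gamma> r \<le> L * (s - r)"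
    and L0: "L \<ge> 0"
    and h: "h integrable_on {a..b}" "\<And>r. r \<in> {a..b} \<Longrightarrow> h r \<ge> 0"
    and N: "negligible N"
    and quad: "\<And>r s. a \<le> r \<Longrightarrow> r \<le> s \<Longrightarrow> s \<le> b \<Longrightarrow> r \<notin> N \<Longrightarrow>
                 \<gamma> s - \<gamma> r \<le> (s - r) * h r + K * (s - r)\<^sup>2"
  shows "\<gamma> b - \<gamma> a \<le> integral {a..b} h"
proof (cases "a = b")
  case False
  then have ab': "a < b" using ab by simp
  have "(\<lambda>x. L * x - \<gamma> x) integrable_on {a..b}"
    by (rule integrable_on_mono_on) (use L in \<open>fastforce simp: mono_on_def algebra_simps\<close>)
  moreover have "(\<lambda>x. L * x) integrable_on {a..b}"
    by (intro integrable_continuous_real continuous_intros)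
  ultimately have "\<gamma> integrable_on {a..b}" using integrable_diff by fastforce
  then have gi: "\<gamma> integrable_on {c..d}" if "a \<le> c" "d \<le> b" for c d
    using that integrable_subinterval_real by fastforce
  have main: "\<gamma> b - \<gamma> a \<le> integral {a..b} h + (2 * L + \<bar>K\<bar> * (b - a)) * \<delta>"
    if \<delta>: "0 < \<delta>" "\<delta> < b - a" for \<delta>
  proof -
    have "((\<lambda>x. \<gamma> (x + \<delta>) - \<gamma> x) has_integral integral {b - \<delta>..b} \<gamma> - integral {a..a + \<delta>} \<gamma>) {a..b - \<delta>}"
      using \<delta> by (intro has_integral_shift_difference gi) auto
    moreover have "((\<lambda>x. \<delta> * h x + \<bar>K\<bar> * \<delta>\<^sup>2) has_integral
        \<delta> * integral {a..b - \<delta>} h + \<bar>K\<bar> * \<delta>\<^sup>2 * (b - \<delta> - a)) {a..b - \<delta>}"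
    proof (rule has_integral_add)
      show "((\<lambda>x. \<delta> * h x) has_integral \<delta> * integral {a..b - \<delta>} h) {a..b - \<delta>}"
        using \<delta> by (intro has_integral_mult_right integrable_integral integrable_subinterval_real[OF h(1)]) auto
      show "((\<lambda>x. \<bar>K\<bar> * \<delta>\<^sup>2) has_integral \<bar>K\<bar> * \<delta>\<^sup>2 * (b - \<delta> - a)) {a..b - \<delta>}"
        using has_integral_const_real[of "\<bar>K\<bar> * \<delta>\<^sup>2" a "b - \<delta>"] \<delta> by (simp add: mult.commute)
    qed
    ultimately have "integral {b - \<delta>..b} \<gamma> - integral {a..a + \<delta>} \<gamma>
        \<le> \<delta> * integral {a..b - \<delta>} h + \<bar>K\<bar> * \<delta>\<^sup>2 * (b - \<delta> - a)"
    proof (rule has_integral_le_off_negligible[OF _ _ N])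
      fix x assume x: "x \<in> {a..b - \<delta>} - N"
      then have "\<gamma> (x + \<delta>) - \<gamma> x \<le> \<delta> * h x + K * \<delta>\<^sup>2"
        using quad[of x "x + \<delta>"] \<delta> by auto
      moreover have "K * \<delta>\<^sup>2 \<le> \<bar>K\<bar> * \<delta>\<^sup>2" by (intro mult_right_mono) auto
      ultimately show "\<gamma> (x + \<delta>) - \<gamma> x \<le> \<delta> * h x + \<bar>K\<bar> * \<delta>\<^sup>2" by simp
    qed
    moreover have "integral {a..b - \<delta>} h \<le> integral {a..b} h"
      using \<delta> h by (intro integral_subset_le) (auto intro: integrable_subinterval_real[OF h(1)])
    then have "\<delta> * integral {a..b - \<delta>} h \<le> \<delta> * integral {a..b} h"
      using \<delta> by (intro mult_left_mono) auto
    moreover have "\<bar>K\<bar> * \<delta>\<^sup>2 * (b - \<delta> - a) \<le> \<bar>K\<bar> * \<delta>\<^sup>2 * (b - a)"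
      using \<delta> by (intro mult_left_mono) auto
    moreover have "\<delta> * (\<gamma> b - L * \<delta>) \<le> integral {b - \<delta>..b} \<gamma>"
    proof -
      have "((\<lambda>x. \<gamma> b - L * \<delta>) has_integral \<delta> * (\<gamma> b - L * \<delta>)) {b - \<delta>..b}"
        using has_integral_const_real[of "\<gamma> b - L * \<delta>" "b - \<delta>" b] \<delta> by simp
      then show ?thesis
      proof (rule has_integral_le[OF _ integrable_integral])
        show "\<gamma> integrable_on {b - \<delta>..b}" using \<delta> by (intro gi) auto
        fix x assume x: "x \<in> {b - \<delta>..b}"
        then have "\<gamma> b - \<gamma> x \<le> L * (b - x)" using \<delta> by (intro L) auto
        moreover have "L * (b - x) \<le> L * \<delta>" using x L0 by (intro mult_left_mono) auto
        ultimately show "\<gamma> b - L * \<delta> \<le> \<gamma> x" by auto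
      qed
    qed
    moreover have "integral {a..a + \<delta>} \<gamma> \<le> \<delta> * (\<gamma> a + L * \<delta>)"
    proof -
      have "((\<lambda>x. \<gamma> a + L * \<delta>) has_integral \<delta> * (\<gamma> a + L * \<delta>)) {a..a + \<delta>}"
        using has_integral_const_real[of "\<gamma> a + L * \<delta>" a "a + \<delta>"] \<delta> by simp
      then show ?thesis
      proof (rule has_integral_le[OF integrable_integral, rotated])
        show "\<gamma> integrable_on {a..a + \<delta>}" using \<delta> by (intro gi) auto
        fix x assume x: "x \<in> {a..a + \<delta>}"
        then have "\<gamma> x - \<gamma> a \<le> L * (x - a)" using \<delta> by (intro L) auto
        moreover have "L * (x - a) \<le> L * \<delta>" using x L0 by (intro mult_left_mono) auto
        ultimately show "\<gamma> x \<le> \<gamma> a + L * \<delta>" by auto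
      qed
    qed
    ultimately have "\<delta> * (\<gamma> b - \<gamma> a) \<le> \<delta> * (integral {a..b} h + (2 * L + \<bar>K\<bar> * (b - a)) * \<delta>)"
      by (simp add: algebra_simps power2_eq_square)
    then show ?thesis using \<delta> by simp
  qed
  have "((\<lambda>\<delta>. integral {a..b} h + (2 * L + \<bar>K\<bar> * (b - a)) * \<delta>) \<longlongrightarrow> integral {a..b} h + (2 * L + \<bar>K\<bar> * (b - a)) * 0) (at_right 0)"
    by (intro tendsto_intros)
  moreover have "\<forall>\<^sub>F \<delta> in at_right 0. \<gamma> b - \<gamma> a \<le> integral {a..b} h + (2 * L + \<bar>K\<bar> * (b - a)) * \<delta>"
    using eventually_at_right_real[of 0 "b - a"] ab' by (auto intro!: main elim!: eventually_mono)
  ultimately show ?thesis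
    by (intro tendsto_lowerbound[of _ _ "at_right 0"]) auto
qed simp

text \<open>
  The envelope argument for \<open>\<gamma>(r)\<close>, the minimum over \<open>X\<close> at parameter \<open>r\<close>. Comparing the minimizer
  at \<open>r\<close> with later parameters bounds the increments of \<open>\<gamma>\<close> from above, and convexity of \<open>r\<^sup>1\<^sup>-\<^sup>p\<close>
  bounds the resulting slope by \<open>(S(U r) - D(U r) s\<^sup>-\<^sup>p)/q\<close>, hence by \<open>g(r)/q\<close> up to an error linear
  in \<open>s - r\<close>. On intervals \<open>[a, \<tau>]\<close> with \<open>a > 0\<close> the distances and slopes of the minimizers are bounded;
  testing minimality with \<open>v\<close> controls \<open>\<gamma>(a)\<close> as \<open>a\<close> tends to 0.
\<close>

lemma value_le_integral_of_slope_defect: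
  fixes f D S :: "'a \<Rightarrow> real" and U :: "real \<Rightarrow> 'a" and g :: "real \<Rightarrow> ennreal"
  assumes pq: "p > 1" "q > 1" "1 / p + 1 / q = 1" and \<tau>: "\<tau> > 0"
    and nn: "\<And>u. u \<in> X \<Longrightarrow> D u \<ge> 0 \<and> S u \<ge> 0 \<and> c \<le> f u"
    and v: "v \<in> X" "D v = 0"
    and UX: "\<And>r. 0 < r \<Longrightarrow> r \<le> \<tau> \<Longrightarrow> U r \<in> X"
    and min: "\<And>r u. 0 < r \<Longrightarrow> r \<le> \<tau> \<Longrightarrow> u \<in> X \<Longrightarrow>
        f (U r) + r powr (1 - p) / p * D (U r) + r / q * S (U r) \<le> f u + r powr (1 - p) / p * D u + r / q * S u"
    and g: "g \<in> borel_measurable (lebesgue_on {0<..<\<tau>})"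
    and slope: "\<And>r. 0 < r \<Longrightarrow> r < \<tau> \<Longrightarrow> ennreal (S (U r)) \<le> ennreal (D (U r) * r powr (- p)) + g r"
  shows "ennreal (f (U \<tau>) + \<tau> powr (1 - p) / p * D (U \<tau>) + \<tau> / q * S (U \<tau>) - f v)
     \<le> ennreal (1 / q) * (\<integral>\<^sup>+ r. g r \<partial>lebesgue_on {0<..<\<tau>})"
proof (cases "(\<integral>\<^sup>+ r. g r \<partial>lebesgue_on {0<..<\<tau>}) = \<infinity>")
  case True
  then show ?thesis using pq by (simp add: ennreal_mult_top)
next
  case False
  define \<Gamma> where "\<Gamma> = (\<lambda>r u. f u + r powr (1 - p) / p * D u + r / q * S u)"
  define \<gamma> where "\<gamma> = (\<lambda>r. \<Gamma> r (U r))"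
  define I where "I = (\<integral>\<^sup>+ r. g r \<partial>lebesgue_on {0<..<\<tau>})"
  have Ifin: "I < \<infinity>" using False by (simp add: I_def top.not_eq_extremum)
  define h where "h = (\<lambda>r. enn2real (g r))"
  have hint: "integrable (lebesgue_on {0<..<\<tau>}) h"
    unfolding h_def
  proof (rule integrableI_bounded)
    show "(\<lambda>r. enn2real (g r)) \<in> borel_measurable (lebesgue_on {0<..<\<tau>})" using g by measurable
    have "(\<integral>\<^sup>+ x. ennreal (norm (enn2real (g x))) \<partial>lebesgue_on {0<..<\<tau>}) \<le> I"
      unfolding I_def by (intro nn_integral_mono) (simp add: ennreal_enn2real_if)
    then show "(\<integral>\<^sup>+ x. ennreal (norm (enn2real (g x))) \<partial>lebesgue_on {0<..<\<tau>}) < \<infinity>"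
      using Ifin by (rule le_less_trans)
  qed
  have hab: "h absolutely_integrable_on {0<..<\<tau>}"
    using hint by (simp add: absolutely_integrable_on_def set_integrable_eq integrable_restrict_space set_integrable_def)
  have hsub: "h integrable_on {a<..<\<tau>}" if "0 < a" for a
    using that by (intro set_lebesgue_integral_eq_integral(1) set_integrable_subset[OF hab]) auto
  have hHK: "h integrable_on {0<..<\<tau>}" using hab set_lebesgue_integral_eq_integral(1) by blast
  have hI: "ennreal (integral {0<..<\<tau>} h) \<le> I"
  proof -
    have "integral {0<..<\<tau>} h = integral\<^sup>L (lebesgue_on {0<..<\<tau>}) h"
      using hint by (intro lebesgue_integral_eq_integral[symmetric]) auto
    also have "ennreal \<dots> = (\<integral>\<^sup>+ r. ennreal (h r) \<partial>lebesgue_on {0<..<\<tau>})"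
      using hint by (intro nn_integral_eq_integral[symmetric]) (auto simp: h_def)
    also have "\<dots> \<le> I"
      unfolding I_def h_def by (intro nn_integral_mono) (simp add: ennreal_enn2real_if)
    finally show ?thesis .
  qed
  have "AE r in lebesgue_on {0<..<\<tau>}. g r \<noteq> \<infinity>"
    using g False by (intro nn_integral_PInf_AE) auto
  then have "AE r in lebesgue. r \<in> {0<..<\<tau>} \<longrightarrow> g r \<noteq> \<infinity>"
    by (simp add: AE_restrict_space_iff)
  then obtain N where N: "{r. \<not> (r \<in> {0<..<\<tau>} \<longrightarrow> g r \<noteq> \<infinity>)} \<subseteq> N" "negligible N"
    unfolding eventually_ae_filter negligible_iff_null_sets by auto
  have gN: "g r = ennreal (h r)" if "0 < r" "r < \<tau>" "r \<notin> N" for r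
    using N that by (auto simp: h_def ennreal_enn2real_if)
  \<comment> \<open>Testing with \<open>v\<close>, where the distance term vanishes, bounds the minimal value by \<open>Q + c\<close>.\<close>
  define Q where "Q = f v - c + \<tau> / q * S v"
  have \<gamma>v: "\<gamma> r \<le> f v + r / q * S v" if "0 < r" "r \<le> \<tau>" for r
    using min[of r v] that v by (simp add: \<gamma>_def \<Gamma>_def)
  have bnd: "r powr (1 - p) / p * D (U r) \<le> Q \<and> r / q * S (U r) \<le> Q \<and> 0 \<le> Q"
    if "0 < r" "r \<le> \<tau>" for r
  proof -
    have "r / q * S v \<le> \<tau> / q * S v"
      using that nn[OF v(1)] pq by (intro mult_right_mono divide_right_mono) auto
    then have "\<gamma> r \<le> Q + c" using \<gamma>v[OF that] by (simp add: Q_def)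
    moreover have "0 \<le> r powr (1 - p) / p * D (U r)" "0 \<le> r / q * S (U r)" "c \<le> f (U r)"
      using nn[OF UX[OF that]] that pq by auto
    ultimately show ?thesis by (auto simp: \<gamma>_def \<Gamma>_def)
  qed
  have step: "\<gamma> \<tau> - \<gamma> a \<le> integral {0<..<\<tau>} h / q" if a: "0 < a" "a < \<tau>" for a
  proof -
    define D0 where "D0 = p * \<tau> powr (p - 1) * Q"
    define S0 where "S0 = q * Q / a"
    have D0: "D (U r) \<le> D0" and S0: "S (U r) \<le> S0" if "a \<le> r" "r \<le> \<tau>" for r
    proof -
      have r: "0 < r" using that a by simp
      have "D (U r) = p * r powr (p - 1) * (r powr (1 - p) / p * D (U r))"
        using pq r by (simp add: powr_add[symmetric] field_simps)
      also have "\<dots> \<le> p * \<tau> powr (p - 1) * Q"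
        using bnd[of r] r that pq nn[OF UX, of r] by (intro mult_mono powr_mono2) auto
      finally show "D (U r) \<le> D0" by (simp add: D0_def)
      have "S (U r) = q / r * (r / q * S (U r))" using pq r by simp
      also have "\<dots> \<le> q / a * Q"
        using bnd[of r] r that pq nn[OF UX, of r] a by (intro mult_mono divide_left_mono) auto
      finally show "S (U r) \<le> S0" by (simp add: S0_def)
    qed
    have D00: "0 \<le> D0" using D0[of \<tau>] nn[OF UX, of \<tau>] a \<tau> by auto
    have S00: "0 \<le> S0" using S0[of \<tau>] nn[OF UX, of \<tau>] a \<tau> by auto
    have up: "\<gamma> s - \<gamma> r \<le> (s powr (1 - p) - r powr (1 - p)) / p * D (U r) + (s - r) / q * S (U r)"
      if "0 < r" "r \<le> \<tau>" "0 < s" "s \<le> \<tau>" for r s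
      using min[OF that(3,4) UX[OF that(1,2)]]
      by (simp add: \<gamma>_def \<Gamma>_def diff_divide_distrib algebra_simps)
    have p1: "p - 1 > 0" using pq by simp
    note pb = powr_neg_diff_bounds[OF p1]
    \<comment> \<open>Conjugacy makes the factors of the distance and the slope term agree.\<close>
    have cpl: "(p - 1) / p = 1 / q" using pq by (simp add: field_simps)
    define K where "K = D0 * (p * a powr (-p - 1)) / q"
    have "\<gamma> \<tau> - \<gamma> a \<le> integral {a..\<tau>} (\<lambda>r. h r / q)"
    proof (rule increment_le_integral_of_right_bound[where L = "S0 / q" and K = K and N = "insert \<tau> N"])
      show "(\<lambda>r. h r / q) integrable_on {a..\<tau>}"
      proof -
        have "h integrable_on {a<..<\<tau>}"
          by (rule hsub[OF a(1)])
        then show ?thesis by (simp add: integrable_on_open_interval_real integrable_on_divide)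
      qed
      show "h r / q \<ge> 0" for r using pq by (simp add: h_def)
      show "negligible (insert \<tau> N)" using N by simp
    next
      fix r s assume rs: "a \<le> r" "r \<le> s" "s \<le> \<tau>" "r \<notin> insert \<tau> N"
      then have r: "0 < r" "r < \<tau>" "0 < s" using a by auto
      have Dn: "0 \<le> D (U r)" using nn[OF UX] r by auto
      have SD: "S (U r) \<le> D (U r) * r powr (- p) + h r"
      proof -
        have gr: "g r = ennreal (h r)" using gN[of r] rs r by blast
        have hn: "0 \<le> h r" by (simp add: h_def)
        have "ennreal (S (U r)) \<le> ennreal (D (U r) * r powr (- p)) + ennreal (h r)"
          using slope[OF r(1,2)] unfolding gr .
        also have "\<dots> = ennreal (D (U r) * r powr (- p) + h r)" using Dn hn by simp
        finally show ?thesis using Dn hn by (subst (asm) ennreal_le_iff) auto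
      qed
      have conv: "s powr (1 - p) - r powr (1 - p) \<le> - (p - 1) * s powr (-p) * (s - r)"
        using pb(3)[of r r s] r rs by simp
      have "(s powr (1 - p) - r powr (1 - p)) / p * D (U r) \<le> (- (p - 1) * s powr (-p) * (s - r)) / p * D (U r)"
        using conv pq Dn by (intro mult_right_mono divide_right_mono) auto
      also have "\<dots> = - ((p - 1) / p) * (s powr (-p) * (s - r) * D (U r))"
        using pq by (simp add: field_simps)
      finally have 1: "(s powr (1 - p) - r powr (1 - p)) / p * D (U r) \<le> - (s powr (-p) * (s - r) * D (U r)) / q"
        by (simp add: cpl)
      have "r powr (-p) - s powr (-p) \<le> p * a powr (-p - 1) * (s - r)"
        using powr_neg_diff_bounds(1)[of p a r s] pq a rs by simp
      then have *: "(s - r) / q * (D (U r) * (r powr (-p) - s powr (-p))) \<le> (s - r) / q * (D0 * (p * a powr (-p - 1) * (s - r)))"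
        using rs a D0[of r] Dn D00 pq powr_neg_diff_bounds(2)[of p a r s]
        by (intro mult_left_mono mult_mono) auto
      then have 2: "(s - r) / q * (D (U r) * (r powr (-p) - s powr (-p))) \<le> K * (s - r)\<^sup>2"
      proof -
        have "(s - r) / q * (D0 * (p * a powr (-p - 1) * (s - r))) = K * (s - r)\<^sup>2"
          by (simp add: K_def power2_eq_square)
        then show ?thesis using * by linarith
      qed
      have "(s - r) / q * S (U r) \<le> (s - r) / q * (D (U r) * r powr (- p) + h r)"
        using SD rs pq by (intro mult_left_mono) auto
      with up[of r s] r rs 1 have "\<gamma> s - \<gamma> r \<le> - (s powr (-p) * (s - r) * D (U r)) / q + (s - r) / q * (D (U r) * r powr (- p) + h r)"
        by simp
      also have "\<dots> = (s - r) * (h r / q) + (s - r) / q * (D (U r) * (r powr (-p) - s powr (-p)))"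
        using pq by (simp add: field_simps)
      finally show "\<gamma> s - \<gamma> r \<le> (s - r) * (h r / q) + K * (s - r)\<^sup>2" using 2 by simp
    next
      fix r s assume rs: "a \<le> r" "r \<le> s" "s \<le> \<tau>"
      then have r: "0 < r" "0 < s" "r \<le> \<tau>" using a by auto
      have mono: "s powr (1 - p) \<le> r powr (1 - p)" using pb(2)[of r r s] r rs by simp
      have n: "0 \<le> D (U r)" using nn[OF UX] r rs by auto
      have "(s powr (1 - p) - r powr (1 - p)) / p * D (U r) \<le> 0"
        using mono pq n by (intro mult_nonpos_nonneg divide_nonpos_pos) auto
      moreover have "(s - r) / q * S (U r) \<le> (s - r) / q * S0"
        using S0[of r] rs pq by (intro mult_left_mono) auto
      ultimately show "\<gamma> s - \<gamma> r \<le> S0 / q * (s - r)"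
        using up[of r s] r rs by (simp add: mult.commute)
    next
      show "0 \<le> S0 / q" using S00 pq by simp
    qed (use a in auto)
    also have "\<dots> = integral {a<..<\<tau>} h / q"
      by (simp add: integral_open_interval_real)
    also have "\<dots> \<le> integral {0<..<\<tau>} h / q"
    proof (intro divide_right_mono integral_subset_le)
      show "h integrable_on {a<..<\<tau>}"
        by (rule hsub[OF a(1)])
    qed (use a hHK pq in \<open>auto simp: h_def\<close>)
    finally show ?thesis .
  qed
  have "\<gamma> \<tau> - f v \<le> integral {0<..<\<tau>} h / q"
  proof (rule tendsto_lowerbound)
    have "((\<lambda>a. integral {0<..<\<tau>} h / q + a / q * S v) \<longlongrightarrow> integral {0<..<\<tau>} h / q + 0 / q * S v) (at_right 0)"
      using pq by (intro tendsto_intros) auto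
    then show "((\<lambda>a. integral {0<..<\<tau>} h / q + a / q * S v) \<longlongrightarrow> integral {0<..<\<tau>} h / q) (at_right 0)"
      by simp
    show "\<forall>\<^sub>F a in at_right 0. \<gamma> \<tau> - f v \<le> integral {0<..<\<tau>} h / q + a / q * S v"
      using eventually_at_right_real[OF \<tau>]
    proof eventually_elim
      case (elim a)
      then show ?case using step[of a] \<gamma>v[of a] by auto
    qed
  qed simp
  then have "ennreal (\<gamma> \<tau> - f v) \<le> ennreal (1 / q * integral {0<..<\<tau>} h)"
    by (intro ennreal_leI) simp
  also have "\<dots> = ennreal (1 / q) * ennreal (integral {0<..<\<tau>} h)"
    using pq by (intro ennreal_mult') auto
  also have "\<dots> \<le> ennreal (1 / q) * I" using hI by (intro mult_left_mono) auto
  finally show ?thesis by (simp add: I_def \<gamma>_def \<Gamma>_def)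
qed

section \<open>Slopes and minimizers of functionals with compact sublevels\<close>

lemma powr_increment_le:
  fixes a \<delta> p :: real
  assumes "p > 1" "a \<ge> 0" "\<delta> \<ge> 0"
  shows "(a + \<delta>) powr p - a powr p \<le> p * (a + \<delta>) powr (p - 1) * \<delta>"
proof (cases "\<delta> = 0")
  case False
  then have "a < a + \<delta>" using assms by simp
  then have "\<exists>l z. a < z \<and> z < a + \<delta> \<and> ((\<lambda>x. x powr p) has_real_derivative l) (at z) \<and>
      (a + \<delta>) powr p - a powr p = (a + \<delta> - a) * l"
  proof (rule MVT)
    show "continuous_on {a..a + \<delta>} (\<lambda>x. x powr p)"
      using assms by (intro continuous_on_powr' continuous_intros) auto
    fix x assume "a < x" "x < a + \<delta>"
    then show "(\<lambda>x. x powr p) differentiable (at x)"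
      using assms has_real_derivative_powr[of x p] by (auto simp: real_differentiable_def)
  qed
  then obtain l z where z: "a < z" "z < a + \<delta>" "((\<lambda>x. x powr p) has_real_derivative l) (at z)"
      "(a + \<delta>) powr p - a powr p = \<delta> * l" by auto
  have "l = p * z powr (p - 1)"
    using z assms by (intro DERIV_unique[OF z(3)] has_real_derivative_powr) auto
  moreover have "z powr (p - 1) \<le> (a + \<delta>) powr (p - 1)"
    using z assms by (intro powr_mono2) auto
  ultimately have "\<delta> * l \<le> \<delta> * (p * (a + \<delta>) powr (p - 1))"
    using assms by (intro mult_left_mono) auto
  then show ?thesis using z by (simp add: mult_ac)
qed simp

text \<open>
  First-order condition: moving from the minimizer \<open>u\<close> to \<open>w\<close> can lower \<open>\<psi>\<close> by no more than
  \<open>K (d\<^sup>p(v,w) - d\<^sup>p(v,u))\<close>, and the mean value theorem and the triangle inequality bound this by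
  \<open>K p (d(v,u) + d(u,w))\<^sup>p\<^sup>-\<^sup>1 d(u,w)\<close>.
\<close>

lemma local_slope_le_of_power_minimizer:
  fixes \<psi> :: "'a::metric_space \<Rightarrow> ereal"
  assumes p: "p > 1" and K: "K \<ge> 0" and fin: "\<bar>\<psi> u\<bar> \<noteq> \<infinity>"
    and min: "\<And>w. \<psi> u + ereal (K * dist v u powr p) \<le> \<psi> w + ereal (K * dist v w powr p)"
  shows "local_slope \<psi> u \<le> ennreal (K * p * dist v u powr (p - 1))"
proof -
  define Y where "Y = (\<lambda>w. ennreal (K * p * (dist v u + dist u w) powr (p - 1)))"
  have le: "e2ennreal (\<psi> u - \<psi> w) / ennreal (dist u w) \<le> Y w" if "w \<noteq> u" for w
  proof -
    have d: "dist u w > 0" using that by simp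
    have "dist v w powr p \<le> (dist v u + dist u w) powr p"
      using p by (intro powr_mono2 dist_triangle) auto
    then have "dist v w powr p - dist v u powr p \<le> p * (dist v u + dist u w) powr (p - 1) * dist u w"
      using powr_increment_le[OF p, of "dist v u" "dist u w"] by auto
    then have "K * (dist v w powr p - dist v u powr p) \<le> K * (p * (dist v u + dist u w) powr (p - 1) * dist u w)"
      by (intro mult_left_mono K)
    moreover have "\<psi> u - \<psi> w \<le> ereal (K * (dist v w powr p - dist v u powr p))"
      using min[of w] fin by (cases "\<psi> u"; cases "\<psi> w") (auto simp: algebra_simps)
    ultimately have "\<psi> u - \<psi> w \<le> ereal (K * p * (dist v u + dist u w) powr (p - 1) * dist u w)"
      by (smt (verit) ereal_less_eq(3) mult.assoc order_trans)
    then have "e2ennreal (\<psi> u - \<psi> w) \<le> ennreal (K * p * (dist v u + dist u w) powr (p - 1) * dist u w)"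
      using e2ennreal_mono by (metis e2ennreal_ereal)
    then have "e2ennreal (\<psi> u - \<psi> w) / ennreal (dist u w)
        \<le> ennreal (K * p * (dist v u + dist u w) powr (p - 1) * dist u w) / ennreal (dist u w)"
      by (rule divide_right_mono_ennreal)
    also have "\<dots> = Y w" using d K p by (simp add: Y_def divide_ennreal)
    finally show ?thesis .
  qed
  have "Limsup (at u) (\<lambda>w. e2ennreal (\<psi> u - \<psi> w) / ennreal (dist u w)) \<le> ennreal (K * p * dist v u powr (p - 1))"
  proof (cases "at u = bot")
    case False
    have "Limsup (at u) (\<lambda>w. e2ennreal (\<psi> u - \<psi> w) / ennreal (dist u w)) \<le> Limsup (at u) Y"
      using le by (intro Limsup_mono) (auto simp: eventually_at_filter)
    also have "\<dots> = ennreal (K * p * dist v u powr (p - 1))"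
    proof (rule lim_imp_Limsup[OF False])
      have "((\<lambda>w. K * p * (dist v u + dist u w) powr (p - 1)) \<longlongrightarrow> K * p * (dist v u + dist u u) powr (p - 1)) (at u)"
        using p by (intro tendsto_intros tendsto_powr') auto
      then show "(Y \<longlongrightarrow> ennreal (K * p * dist v u powr (p - 1))) (at u)"
        unfolding Y_def by (simp add: tendsto_ennrealI)
    qed
    finally show ?thesis .
  qed (simp add: Limsup_bot bot_ennreal)
  then show ?thesis using fin by (auto simp: local_slope_def eff_dom_def)
qed

text \<open>
  Solves the inequality for the base of the power; lower semicontinuity of the power on
  \<open>[0, \<infinity>]\<close> is read off from it.
\<close>

lemma scaled_ennreal_powr_gt_iff:
  assumes "q > 0" "a > 0" "c \<ge> 0"
  shows "ennreal c < ennreal a * ennreal_powr y q \<longleftrightarrow> ennreal ((c / a) powr (1 / q)) < y"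
proof (cases y)
  case (real b)
  have "ennreal c < ennreal a * ennreal_powr y q \<longleftrightarrow> c < a * b powr q"
    using real assms by (simp add: ennreal_powr_def ennreal_mult[symmetric] ennreal_less_iff)
  also have "\<dots> \<longleftrightarrow> c / a < b powr q" using assms by (simp add: field_simps)
  also have "\<dots> \<longleftrightarrow> (c / a) powr (1 / q) < b"
  proof
    assume "c / a < b powr q"
    then have "(c / a) powr (1 / q) < (b powr q) powr (1 / q)" using assms by (intro powr_less_mono2) auto
    then show "(c / a) powr (1 / q) < b" using assms real by (simp add: powr_powr)
  next
    assume "(c / a) powr (1 / q) < b"
    then have "((c / a) powr (1 / q)) powr q < b powr q" using assms by (intro powr_less_mono2) auto
    then show "c / a < b powr q" using assms by (simp add: powr_powr)
  qed
  finally show ?thesis using real by (simp add: ennreal_less_iff)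
next
  case top
  then show ?thesis using assms by (simp add: ennreal_powr_def ennreal_mult_top)
qed

lemma scaled_ennreal_powr_liminf:
  fixes y :: "nat \<Rightarrow> ennreal"
  assumes q: "q > 0" and a: "a > 0" and x: "x \<le> liminf y"
  shows "ennreal a * ennreal_powr x q \<le> liminf (\<lambda>k. ennreal a * ennreal_powr (y k) q)"
  unfolding le_Liminf_iff
proof (intro allI impI)
  fix z assume z: "z < ennreal a * ennreal_powr x q"
  then obtain c where c: "z = ennreal c" "c \<ge> 0" by (cases z) auto
  have "ennreal ((c / a) powr (1 / q)) < x"
    using z scaled_ennreal_powr_gt_iff[OF q a c(2)] c(1) by simp
  then have "\<forall>\<^sub>F k in sequentially. ennreal ((c / a) powr (1 / q)) < y k"
    using x by (simp add: le_Liminf_iff)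
  then show "\<forall>\<^sub>F k in sequentially. z < ennreal a * ennreal_powr (y k) q"
    using scaled_ennreal_powr_gt_iff[OF q a c(2)] c(1) by simp
qed

lemma ennreal_powr_mono: "x \<le> y \<Longrightarrow> q \<ge> 0 \<Longrightarrow> ennreal_powr x q \<le> ennreal_powr y q"
  unfolding ennreal_powr_def
  by (auto simp: top_unique less_top enn2real_mono intro!: ennreal_leI powr_mono2)

text \<open>
  The direct method, phrased for sequences. It serves for the incremental functionals and, applied to
  \<open>\<phi>\<close> itself, yields the lower bound of \<open>\<phi>\<close>.
\<close>

lemma minimizer_exists:
  fixes F :: "'a \<Rightarrow> ereal"
  assumes v: "F v < \<infinity>"
    and sub: "\<And>y c. (\<And>k. F (y k) \<le> ereal c) \<Longrightarrow> \<exists>x0 r. strict_mono (r :: nat \<Rightarrow> nat) \<and> F x0 \<le> liminf (\<lambda>k. F (y (r k)))"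
  shows "\<exists>x0. \<forall>w. F x0 \<le> F w"
proof -
  obtain z where z: "\<And>n. z n \<in> range F" "z \<longlonglongrightarrow> Inf (range F)"
    using Inf_as_limit[of "range F"] by auto
  define y where "y = (\<lambda>n. inv F (z n))"
  have y: "z n = F (y n)" for n using f_inv_into_f[OF z(1)[of n]] by (simp add: y_def)
  have "Inf (range F) < \<infinity>" using v by (meson INF_lower UNIV_I le_less_trans)
  then obtain c where c: "Inf (range F) < ereal c" using ereal_dense2 by blast
  then have "\<forall>\<^sub>F n in sequentially. z n < ereal c" using z(2) by (simp add: order_tendstoD)
  then obtain m where m: "\<And>n. n \<ge> m \<Longrightarrow> z n < ereal c" by (auto simp: eventually_sequentially)
  have "F (y (k + m)) \<le> ereal c" for k using m[of "k + m"] y[of "k + m"] by simp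
  then obtain x0 r where r: "strict_mono (r :: nat \<Rightarrow> nat)" "F x0 \<le> liminf (\<lambda>k. F (y (r k + m)))"
    using sub[of "\<lambda>k. y (k + m)" c] by auto
  have "(\<lambda>k. z (r k + m)) \<longlonglongrightarrow> Inf (range F)"
    using LIMSEQ_subseq_LIMSEQ[OF z(2), of "\<lambda>k. r k + m"] r(1) by (simp add: o_def strict_mono_def)
  then have "liminf (\<lambda>k. F (y (r k + m))) = Inf (range F)"
    using y by (intro lim_imp_Liminf) auto
  then show ?thesis using r(2) by (metis INF_lower UNIV_I order_trans)
qed

lemma ereal_le_liminf_add:
  fixes a b :: "nat \<Rightarrow> ereal"
  assumes "P \<le> liminf a" "Q \<le> liminf b" "P \<noteq> -\<infinity>" "Q \<noteq> -\<infinity>"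
  shows "P + Q \<le> liminf (\<lambda>n. a n + b n)"
proof -
  have "P + Q \<le> liminf a + liminf b" by (intro add_mono assms)
  also have "\<dots> \<le> liminf (\<lambda>n. a n + b n)"
    using assms by (intro ereal_liminf_add_mono) auto
  finally show ?thesis .
qed

text \<open>
  The standing hypotheses on the functional alone; scheme, curve and upper gradient enter later.
\<close>

locale compact_functional =
  fixes p q :: real and \<phi> :: "'a::metric_space \<Rightarrow> ereal"
  assumes p: "p > 1" and q: "q > 1" and pq: "1 / p + 1 / q = 1"
    and not_minf: "\<And>v. \<phi> v \<noteq> -\<infinity>"
    and proper: "eff_dom \<phi> \<noteq> {}"
    and compact_sublevels: "\<And>c :: real. seq_compact {v. \<phi> v \<le> ereal c}"
    and slope_lsc: "seq_lsc_on_bounded_sublevels \<phi> (local_slope \<phi>)"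
begin

lemma phi_lsc:
  assumes x: "x \<longlonglongrightarrow> x0"
  shows "\<phi> x0 \<le> liminf (\<lambda>k. \<phi> (x k))"
proof (rule ccontr)
  assume "\<not> ?thesis"
  then obtain c where c: "liminf (\<lambda>k. \<phi> (x k)) < ereal c" "ereal c < \<phi> x0"
    by (metis ereal_dense2 not_le)
  obtain r where r: "strict_mono (r :: nat \<Rightarrow> nat)" "((\<lambda>k. \<phi> (x k)) \<circ> r) \<longlonglongrightarrow> liminf (\<lambda>k. \<phi> (x k))"
    using liminf_subseq_lim by blast
  then have "\<forall>\<^sub>F k in sequentially. \<phi> (x (r k)) < ereal c" using c(1) order_tendstoD(2) by fastforce
  then obtain m where m: "\<And>n. n \<ge> m \<Longrightarrow> \<phi> (x (r n)) < ereal c" by (auto simp: eventually_sequentially)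
  have "(\<lambda>k. x (r (k + m))) \<longlonglongrightarrow> x0"
    using LIMSEQ_subseq_LIMSEQ[OF x, of "\<lambda>k. r (k + m)"] r(1) by (simp add: o_def strict_mono_def)
  moreover have "closed {v. \<phi> v \<le> ereal c}"
    using compact_sublevels[of c] by (simp add: compact_imp_closed flip: compact_eq_seq_compact_metric)
  moreover have "x (r (k + m)) \<in> {v. \<phi> v \<le> ereal c}" for k using m[of "k + m"] by auto
  ultimately have "x0 \<in> {v. \<phi> v \<le> ereal c}" by (meson closed_sequentially)
  then show False using c(2) by auto
qed

lemma slope_liminf:
  assumes x: "x \<longlonglongrightarrow> x0" and c: "\<And>k. \<phi> (x k) \<le> ereal c"
  shows "local_slope \<phi> x0 \<le> liminf (\<lambda>k. local_slope \<phi> (x k))"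
  using slope_lsc x c convergent_imp_bounded[OF x] unfolding seq_lsc_on_bounded_sublevels_def by blast

lemma sublevel_subseq:
  assumes "\<And>k::nat. \<phi> (y k) \<le> ereal c"
  obtains x0 r where "strict_mono (r :: nat \<Rightarrow> nat)" "(\<lambda>k. y (r k)) \<longlonglongrightarrow> x0" "\<phi> x0 \<le> ereal c"
  using compact_sublevels[of c] assms unfolding seq_compact_def by (fastforce simp: o_def)

lemma phi_bounded_below: "\<exists>c. \<forall>v. ereal c \<le> \<phi> v"
proof -
  obtain v where v: "\<phi> v < \<infinity>" using proper by (auto simp: eff_dom_def)
  have "\<exists>x0. \<forall>w. \<phi> x0 \<le> \<phi> w"
  proof (rule minimizer_exists[of \<phi> v])
    show "\<phi> v < \<infinity>" by (rule v)
  next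
    fix y :: "nat \<Rightarrow> 'a" and c assume "\<And>k. \<phi> (y k) \<le> ereal c"
    then obtain x0 r where "strict_mono (r :: nat \<Rightarrow> nat)" "(\<lambda>k. y (r k)) \<longlonglongrightarrow> x0"
      by (rule sublevel_subseq)
    then show "\<exists>x0 r. strict_mono (r :: nat \<Rightarrow> nat) \<and> \<phi> x0 \<le> liminf (\<lambda>k. \<phi> (y (r k)))"
      using phi_lsc by blast
  qed
  then obtain x0 where x0: "\<And>w. \<phi> x0 \<le> \<phi> w" by blast
  then have "\<bar>\<phi> x0\<bar> \<noteq> \<infinity>" using not_minf[of x0] x0[of v] v by auto
  then show ?thesis using x0 by (metis ereal_real')
qed

text \<open>
  Real-valued versions of \<open>\<phi>\<close> and \<open>|\<partial>\<phi>|\<^sup>q\<close>, faithful on \<open>D(\<phi>)\<close> and \<open>D(|\<partial>\<phi>|)\<close> respectively.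
\<close>

abbreviation "\<phi>r u \<equiv> real_of_ereal (\<phi> u)"
abbreviation "slope_pow u \<equiv> enn2real (local_slope \<phi> u) powr q"

lemma phi_eq: "u \<in> eff_dom \<phi> \<Longrightarrow> \<phi> u = ereal (\<phi>r u)"
  using not_minf[of u] by (cases "\<phi> u") (auto simp: eff_dom_def)

lemma slope_dom_subset: "u \<in> slope_dom \<phi> \<Longrightarrow> u \<in> eff_dom \<phi>"
  by (simp add: slope_dom_def)

lemma slope_power: "u \<in> slope_dom \<phi> \<Longrightarrow> ennreal_powr (local_slope \<phi> u) q = ennreal (slope_pow u)"
  by (auto simp: slope_dom_def ennreal_powr_def)

lemma penalty_eq:
  "u \<in> slope_dom \<phi> \<Longrightarrow> \<tau> \<ge> 0 \<Longrightarrow> enn2ereal (ennreal (\<tau> / q) * ennreal_powr (local_slope \<phi> u) q) = ereal (\<tau> / q * slope_pow u)"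
  using q by (simp add: slope_power ennreal_mult[symmetric])

lemma G_fun_eq:
  assumes "u \<in> slope_dom \<phi>" "v \<in> eff_dom \<phi>" "\<tau> \<ge> 0"
  shows "G_fun p q \<phi> \<tau> v u = ereal (\<phi>r u + \<tau> powr (1 - p) / p * dist v u powr p + \<tau> / q * slope_pow u - \<phi>r v)"
  unfolding G_fun_def penalty_eq[OF assms(1,3)]
  using phi_eq[OF slope_dom_subset[OF assms(1)]] phi_eq[OF assms(2)] by (metis ereal_minus(1) plus_ereal.simps(1))

lemma M_G_D:
  assumes u: "u \<in> M_G p q \<phi> \<tau> v" and v: "v \<in> eff_dom \<phi>" and \<tau>: "\<tau> > 0"
  shows "u \<in> slope_dom \<phi>"
    and "\<And>w. w \<in> slope_dom \<phi> \<Longrightarrow> \<phi>r u + \<tau> powr (1 - p) / p * dist v u powr p + \<tau> / q * slope_pow u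
            \<le> \<phi>r w + \<tau> powr (1 - p) / p * dist v w powr p + \<tau> / q * slope_pow w"
proof -
  show 1: "u \<in> slope_dom \<phi>" using u by (auto simp: M_G_def is_arg_min_def)
  fix w assume w: "w \<in> slope_dom \<phi>"
  then have "G_fun p q \<phi> \<tau> v u \<le> G_fun p q \<phi> \<tau> v w" using u by (auto simp: M_G_def is_arg_min_def not_less)
  then show "\<phi>r u + \<tau> powr (1 - p) / p * dist v u powr p + \<tau> / q * slope_pow u
            \<le> \<phi>r w + \<tau> powr (1 - p) / p * dist v w powr p + \<tau> / q * slope_pow w"
    using G_fun_eq[OF 1 v] G_fun_eq[OF w v] \<tau> by simp
qed

lemma M_G_nonempty:
  assumes v: "v \<in> slope_dom \<phi>" and \<tau>: "\<tau> > 0"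
  shows "\<exists>u. u \<in> M_G p q \<phi> \<tau> v"
proof -
  define d where "d = (\<lambda>u. \<tau> powr (1 - p) / p * dist v u powr p)"
  define s where "s = (\<lambda>u. enn2ereal (ennreal (\<tau> / q) * ennreal_powr (local_slope \<phi> u) q))"
  define F where "F = (\<lambda>u. \<phi> u + ereal (d u) + s u)"
  have d0: "0 \<le> d u" for u using p by (simp add: d_def)
  have s0: "0 \<le> s u" for u by (simp add: s_def)
  have fin: "F u < \<infinity> \<longleftrightarrow> u \<in> slope_dom \<phi>" for u
  proof
    assume "u \<in> slope_dom \<phi>"
    then show "F u < \<infinity>" using penalty_eq[of u \<tau>] slope_dom_subset[of u] \<tau> by (simp add: F_def s_def eff_dom_def)
  next
    assume F: "F u < \<infinity>"
    then have "\<phi> u < \<infinity>" "s u < \<infinity>" using s0[of u] not_minf[of u]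
      by (cases "\<phi> u"; cases "s u"; auto simp: F_def)+
    moreover have "local_slope \<phi> u < \<infinity>"
    proof (rule ccontr)
      assume "\<not> ?thesis"
      then have "s u = \<infinity>" using \<tau> q by (auto simp: s_def ennreal_powr_def ennreal_mult_top top.not_eq_extremum)
      then show False using \<open>s u < \<infinity>\<close> by simp
    qed
    ultimately show "u \<in> slope_dom \<phi>" by (simp add: slope_dom_def eff_dom_def)
  qed
  have "\<exists>x0. \<forall>w. F x0 \<le> F w"
  proof (rule minimizer_exists)
    show "F v < \<infinity>" using v fin by simp
    fix y :: "nat \<Rightarrow> 'a" and c assume y: "\<And>k. F (y k) \<le> ereal c"
    have \<phi>F: "\<phi> w \<le> F w" for w
      using d0[of w] s0[of w] not_minf[of w] by (cases "\<phi> w"; cases "s w") (auto simp: F_def)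
    then have yc: "\<phi> (y k) \<le> ereal c" for k using y order_trans by blast
    then obtain x0 r where r: "strict_mono (r :: nat \<Rightarrow> nat)" "(\<lambda>k. y (r k)) \<longlonglongrightarrow> x0"
      by (rule sublevel_subseq)
    have 1: "\<phi> x0 \<le> liminf (\<lambda>k. \<phi> (y (r k)))" by (rule phi_lsc[OF r(2)])
    have "(\<lambda>k. ereal (d (y (r k)))) \<longlonglongrightarrow> ereal (d x0)"
      unfolding d_def using p r(2) by (intro tendsto_ereal tendsto_intros tendsto_powr') auto
    then have 2: "liminf (\<lambda>k. ereal (d (y (r k)))) = ereal (d x0)" by (intro lim_imp_Liminf) auto
    have "local_slope \<phi> x0 \<le> liminf (\<lambda>k. local_slope \<phi> (y (r k)))" by (rule slope_liminf[OF r(2) yc])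
    then have "ennreal (\<tau> / q) * ennreal_powr (local_slope \<phi> x0) q
        \<le> liminf (\<lambda>k. ennreal (\<tau> / q) * ennreal_powr (local_slope \<phi> (y (r k))) q)"
      using \<tau> q by (intro scaled_ennreal_powr_liminf) auto
    then have 3: "s x0 \<le> liminf (\<lambda>k. s (y (r k)))"
      unfolding s_def
      by (subst Liminf_compose_continuous_mono[OF continuous_on_enn2ereal])
         (auto simp: mono_def less_eq_ennreal.rep_eq)
    have nm: "\<phi> x0 + ereal (d x0) \<noteq> -\<infinity>" "s x0 \<noteq> -\<infinity>" using not_minf[of x0] s0[of x0] by auto
    have "F x0 \<le> liminf (\<lambda>k. F (y (r k)))"
      unfolding F_def
      by (intro ereal_le_liminf_add[OF _ 3 nm] ereal_le_liminf_add[OF 1 _ not_minf]) (simp_all add: 2)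
    then show "\<exists>x0 r. strict_mono (r :: nat \<Rightarrow> nat) \<and> F x0 \<le> liminf (\<lambda>k. F (y (r k)))"
      using r(1) by blast
  qed
  then obtain u where u: "\<And>w. F u \<le> F w" by blast
  have "F u < \<infinity>" using u[of v] v fin[of v] by (auto intro: le_less_trans)
  then have us: "u \<in> slope_dom \<phi>" using fin by simp
  have "G_fun p q \<phi> \<tau> v u \<le> G_fun p q \<phi> \<tau> v w" for w
    using u[of w] unfolding G_fun_def F_def d_def s_def by (rule ereal_minus_mono) simp
  then show ?thesis using us by (auto simp: M_G_def is_arg_min_def not_less)
qed

end

section \<open>Defect of one step and energy bounds along the scheme\<close>

text \<open>
  The estimate inside the Taylor condition for one choice of \<open>C\<close> and \<open>g\<close>.
\<close>

definition taylor_estimate ::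
  "real \<Rightarrow> real \<Rightarrow> ('a::metric_space \<Rightarrow> ereal) \<Rightarrow> real \<Rightarrow> real \<Rightarrow> (real \<Rightarrow> ennreal) \<Rightarrow> bool" where
  "taylor_estimate p q \<phi> \<tau>s C g \<longleftrightarrow>
     (\<forall>r\<in>{0<..<\<tau>s}. \<forall>v\<in>slope_dom \<phi>.
           max (\<phi> v) (enn2ereal (ennreal r * ennreal_powr (local_slope \<phi> v) q)) \<le> ereal C \<longrightarrow>
           (\<forall>u\<in>M_G p q \<phi> r v.
              enn2ereal (ennreal_powr (local_slope \<phi> u) q)
              - enn2ereal (ennreal_powr (local_slope (slope_perturbed q \<phi> r) u) q)
                \<le> enn2ereal (g r)))"

text \<open>
  The action \<open>\<integral> |u'|\<^sup>p\<close> of the piecewise affine interpolation, as \<open>\<tau>\<^sup>1\<^sup>-\<^sup>p d\<^sup>p = \<tau> (d/\<tau>)\<^sup>p\<close>.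
\<close>

definition discrete_action :: "real \<Rightarrow> (nat \<Rightarrow> real) \<Rightarrow> (nat \<Rightarrow> 'a::metric_space) \<Rightarrow> nat \<Rightarrow> real" where
  "discrete_action p t x i = (\<Sum>j = 1..i. step t j powr (1 - p) * dist (x (j - 1)) (x j) powr p)"

context compact_functional
begin

lemma conjugate_exponent: "(p - 1) * q = p" "(1 - p) * q = - p"
proof -
  show *: "(p - 1) * q = p" using pq p q by (simp add: field_simps)
  show "(1 - p) * q = - p" using * by (simp add: algebra_simps)
qed

text \<open>
  Passes from the first-order condition to its \<open>q\<close>-th power, using \<open>(p - 1) q = p\<close>.
\<close>

lemma power_of_slope_bound:
  assumes s: "s \<le> ennreal (\<tau> powr (1 - p) / p * p * d powr (p - 1))" and \<tau>: "\<tau> > 0" and d: "d \<ge> 0"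
  shows "ennreal_powr s q \<le> ennreal (d powr p * \<tau> powr (- p))"
proof -
  have "s \<le> ennreal (\<tau> powr (1 - p) * d powr (p - 1))" using s p by simp
  then have "ennreal_powr s q \<le> ennreal_powr (ennreal (\<tau> powr (1 - p) * d powr (p - 1))) q"
    using q by (intro ennreal_powr_mono) auto
  also have "\<dots> = ennreal ((\<tau> powr (1 - p) * d powr (p - 1)) powr q)"
    by (simp add: ennreal_powr_def)
  also have "(\<tau> powr (1 - p) * d powr (p - 1)) powr q = \<tau> powr (- p) * d powr p"
    by (simp add: powr_mult powr_powr conjugate_exponent)
  also have "\<dots> = d powr p * \<tau> powr (- p)" by simp
  finally show ?thesis .
qed

lemma M_G_perturbed_slope:
  assumes u: "u \<in> M_G p q \<phi> \<tau> v" and v: "v \<in> eff_dom \<phi>" and \<tau>: "\<tau> > 0"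
  shows "ennreal_powr (local_slope (slope_perturbed q \<phi> \<tau>) u) q \<le> ennreal (dist v u powr p * \<tau> powr (- p))"
proof (rule power_of_slope_bound[OF _ \<tau>])
  note us = M_G_D(1)[OF u v \<tau>]
  have val: "slope_perturbed q \<phi> \<tau> w = ereal (\<phi>r w + \<tau> / q * slope_pow w)" if "w \<in> slope_dom \<phi>" for w
  proof -
    have "slope_perturbed q \<phi> \<tau> w = ereal (\<phi>r w) + ereal (\<tau> / q * slope_pow w)"
      unfolding slope_perturbed_def
      by (simp only: that if_True penalty_eq[OF that less_imp_le[OF \<tau>]] flip: phi_eq[OF slope_dom_subset[OF that]])
    then show ?thesis by simp
  qed
  show "local_slope (slope_perturbed q \<phi> \<tau>) u \<le> ennreal (\<tau> powr (1 - p) / p * p * dist v u powr (p - 1))"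
  proof (rule local_slope_le_of_power_minimizer[OF p])
    fix w
    show "slope_perturbed q \<phi> \<tau> u + ereal (\<tau> powr (1 - p) / p * dist v u powr p)
         \<le> slope_perturbed q \<phi> \<tau> w + ereal (\<tau> powr (1 - p) / p * dist v w powr p)"
    proof (cases "w \<in> slope_dom \<phi>")
      case True
      show ?thesis unfolding val[OF us] val[OF True] using M_G_D(2)[OF u v \<tau> True] by simp
    qed (simp add: slope_perturbed_def)
  qed (use p val[OF us] in auto)
qed simp

lemma M_E_D:
  assumes u: "u \<in> M_E p \<phi> \<tau> v" and v: "v \<in> eff_dom \<phi>" and \<tau>: "\<tau> > 0"
  shows "u \<in> slope_dom \<phi>" and "\<phi>r u + \<tau> powr (1 - p) / p * dist v u powr p \<le> \<phi>r v"
    and "slope_pow u \<le> dist v u powr p * \<tau> powr (- p)"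
proof -
  have ue: "u \<in> eff_dom \<phi>" and min: "\<And>w. w \<in> eff_dom \<phi> \<Longrightarrow> E_fun p \<phi> \<tau> v u \<le> E_fun p \<phi> \<tau> v w"
    using u by (auto simp: M_E_def is_arg_min_def not_less)
  have val: "E_fun p \<phi> \<tau> v w = ereal (\<phi>r w + \<tau> powr (1 - p) / p * dist v w powr p - \<phi>r v)" if "w \<in> eff_dom \<phi>" for w
    unfolding E_fun_def using phi_eq[OF that] phi_eq[OF v] by (metis ereal_minus(1) plus_ereal.simps(1))
  have min': "\<phi>r u + \<tau> powr (1 - p) / p * dist v u powr p \<le> \<phi>r w + \<tau> powr (1 - p) / p * dist v w powr p"
    if "w \<in> eff_dom \<phi>" for w
    using min[OF that] by (simp add: val ue that)
  show "\<phi>r u + \<tau> powr (1 - p) / p * dist v u powr p \<le> \<phi>r v" using min'[OF v] p by simp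
  have "ennreal_powr (local_slope \<phi> u) q \<le> ennreal (dist v u powr p * \<tau> powr (- p))"
  proof (rule power_of_slope_bound[OF _ \<tau>])
    show "local_slope \<phi> u \<le> ennreal (\<tau> powr (1 - p) / p * p * dist v u powr (p - 1))"
    proof (rule local_slope_le_of_power_minimizer[OF p])
      fix w
      show "\<phi> u + ereal (\<tau> powr (1 - p) / p * dist v u powr p) \<le> \<phi> w + ereal (\<tau> powr (1 - p) / p * dist v w powr p)"
      proof (cases "w \<in> eff_dom \<phi>")
        case True
        have "\<phi> u = ereal (\<phi>r u)" "\<phi> w = ereal (\<phi>r w)" using phi_eq ue True by blast+
        then show ?thesis using min'[OF True] by (metis ereal_less_eq(3) plus_ereal.simps(1))
      qed (simp add: eff_dom_def)
    qed (use p phi_eq[OF ue] in \<open>auto simp: not_minf ue[unfolded eff_dom_def, simplified]\<close>)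
  qed simp
  moreover from this have "local_slope \<phi> u < \<infinity>"
    by (auto simp: ennreal_powr_def top_unique less_top split: if_splits)
  then show "u \<in> slope_dom \<phi>" using ue by (simp add: slope_dom_def)
  ultimately show "slope_pow u \<le> dist v u powr p * \<tau> powr (- p)" using slope_power by (simp add: ennreal_le_iff)
qed

abbreviation "gap \<tau> v u \<equiv> \<phi>r u + \<tau> powr (1 - p) / p * dist v u powr p + \<tau> / q * slope_pow u - \<phi>r v"

text \<open>
  The Taylor condition and the first-order condition at the minimizers for all parameters
  \<open>r \<le> \<tau>\<close> supply the slope bound of the envelope argument; its bound on \<open>\<tau>|\<partial>\<phi>|\<^sup>q(v)\<close> passes to
  smaller parameters. At \<open>r = \<tau>\<close> the given minimizer \<open>u\<close> is used.
\<close>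

lemma gap_le_taylor_integral:
  assumes v: "v \<in> slope_dom \<phi>" and \<tau>: "0 < \<tau>" "\<tau> < \<tau>s" and u: "u \<in> M_G p q \<phi> \<tau> v"
    and g: "g \<in> borel_measurable (lebesgue_on {0<..<\<tau>s})"
    and taylor: "taylor_estimate p q \<phi> \<tau>s C g"
    and C: "\<phi>r v \<le> C" "\<tau> * slope_pow v \<le> C"
  shows "ennreal (gap \<tau> v u) \<le> ennreal (1 / q) * (\<integral>\<^sup>+ r. g r \<partial>lebesgue_on {0<..<\<tau>})"
proof -
  note ve = slope_dom_subset[OF v]
  obtain c where c: "\<And>w. ereal c \<le> \<phi> w" using phi_bounded_below by blast
  define U where "U = (\<lambda>r. if r = \<tau> then u else (SOME w. w \<in> M_G p q \<phi> r v))"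
  have U: "U r \<in> M_G p q \<phi> r v" if "0 < r" for r
    using someI_ex[OF M_G_nonempty[OF v that]] u by (simp add: U_def)
  have "ennreal (\<phi>r (U \<tau>) + \<tau> powr (1 - p) / p * dist v (U \<tau>) powr p + \<tau> / q * slope_pow (U \<tau>) - \<phi>r v)
     \<le> ennreal (1 / q) * (\<integral>\<^sup>+ r. g r \<partial>lebesgue_on {0<..<\<tau>})"
  proof (rule value_le_integral_of_slope_defect[OF p q pq \<tau>(1), where X = "slope_dom \<phi>" and c = c])
    fix w assume w: "w \<in> slope_dom \<phi>"
    have "ereal c \<le> ereal (\<phi>r w)" using c[of w] phi_eq[OF slope_dom_subset[OF w]] by metis
    then show "0 \<le> dist v w powr p \<and> 0 \<le> slope_pow w \<and> c \<le> \<phi>r w" by simp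
  next
    show "g \<in> borel_measurable (lebesgue_on {0<..<\<tau>})"
      by (rule measurable_restrict_mono[OF g]) (use \<tau> in auto)
  next
    fix r assume r: "0 < r" "r < \<tau>"
    note Us = M_G_D(1)[OF U[OF r(1)] ve r(1)]
    have "ereal (\<phi>r v) \<le> ereal C" "ereal (r * slope_pow v) \<le> ereal C"
    proof -
      have "r * slope_pow v \<le> \<tau> * slope_pow v" using r by (intro mult_right_mono) auto
      then show "ereal (r * slope_pow v) \<le> ereal C" using C(2) by simp
    qed (use C in simp)
    moreover have "enn2ereal (ennreal r * ennreal_powr (local_slope \<phi> v) q) = ereal (r * slope_pow v)"
      using r by (simp add: slope_power[OF v] ennreal_mult[symmetric])
    ultimately have "max (\<phi> v) (enn2ereal (ennreal r * ennreal_powr (local_slope \<phi> v) q)) \<le> ereal C"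
      using phi_eq[OF ve] by (metis max.bounded_iff)
    then have "enn2ereal (ennreal_powr (local_slope \<phi> (U r)) q)
              - enn2ereal (ennreal_powr (local_slope (slope_perturbed q \<phi> r) (U r)) q) \<le> enn2ereal (g r)"
      using taylor v U[OF r(1)] r \<tau> unfolding taylor_estimate_def by auto
    moreover have "enn2ereal (ennreal_powr (local_slope (slope_perturbed q \<phi> r) (U r)) q)
        \<le> enn2ereal (ennreal (dist v (U r) powr p * r powr (- p)))"
      using M_G_perturbed_slope[OF U[OF r(1)] ve r(1)] by (simp only: less_eq_ennreal.rep_eq)
    ultimately have "ereal (slope_pow (U r)) - ereal (dist v (U r) powr p * r powr (- p)) \<le> enn2ereal (g r)"
      using ereal_minus_mono[of "ereal (slope_pow (U r))" "ereal (slope_pow (U r))"] slope_power[OF Us] order_trans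
      by (smt (verit) enn2ereal_ennreal mult_nonneg_nonneg order_refl powr_ge_zero)
    then have "ereal (slope_pow (U r)) \<le> enn2ereal (g r) + ereal (dist v (U r) powr p * r powr (- p))"
      by (subst (asm) ereal_minus_le) auto
    then show "ennreal (slope_pow (U r)) \<le> ennreal (dist v (U r) powr p * r powr (- p)) + g r"
      by (simp add: less_eq_ennreal.rep_eq plus_ennreal.rep_eq add.commute)
  next
    fix r w assume r: "0 < r" "r \<le> \<tau>" and w: "w \<in> slope_dom \<phi>"
    show "\<phi>r (U r) + r powr (1 - p) / p * dist v (U r) powr p + r / q * slope_pow (U r)
         \<le> \<phi>r w + r powr (1 - p) / p * dist v w powr p + r / q * slope_pow w"
      by (rule M_G_D(2)[OF U[OF r(1)] ve r(1) w])
  next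
    fix r assume r: "0 < r" "r \<le> \<tau>"
    show "U r \<in> slope_dom \<phi>" by (rule M_G_D(1)[OF U[OF r(1)] ve r(1)])
  qed (use v p in auto)
  then show ?thesis by (simp add: U_def)
qed

end

lemma step_pos: "is_partition T N t \<Longrightarrow> i \<in> {1..N} \<Longrightarrow> 0 < step t i"
  by (auto simp: is_partition_def step_def strict_mono_on_def)

lemma step_le_mesh: "i \<in> {1..N} \<Longrightarrow> step t i \<le> mesh N t"
  unfolding mesh_def by (intro Max_ge) auto

lemma partition_mono: "is_partition T N t \<Longrightarrow> i \<le> j \<Longrightarrow> j \<le> N \<Longrightarrow> t i \<le> t j"
  using strict_mono_onD[of "{0..N}" t i j] by (cases "i = j") (auto simp: is_partition_def)

lemma sum_step: "is_partition T N t \<Longrightarrow> (\<Sum>i = 1..k. step t i) = t k"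
  by (induction k) (auto simp: is_partition_def step_def)

context compact_functional
begin

text \<open>
  Induction on the step. As long as \<open>\<phi>(x\<^sub>i) \<le> C\<close> and \<open>\<tau>\<^sub>i\<^sub>+\<^sub>1|\<partial>\<phi>|\<^sup>q(x\<^sub>i) \<le> C\<close>, the next defect is at most
  \<open>\<tau>\<^sub>i\<^sub>+\<^sub>1 \<eta>/q\<close>. The sum of all defects is at most 1, which bounds \<open>\<phi>(x\<^sub>i\<^sub>+\<^sub>1)\<close> and \<open>\<tau>\<^sub>i\<^sub>+\<^sub>1|\<partial>\<phi>|\<^sup>q(x\<^sub>i\<^sub>+\<^sub>1)\<close> in
  terms of \<open>\<phi>(u0)\<close> and the lower bound \<open>c\<close> of \<open>\<phi>\<close> only; growth of the steps by at most the factor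
  \<open>1 + C' \<tau>s\<close> restores the second bound for the next step. Of the last two summands of \<open>C\<close>, one
  covers the initial step and the other the later ones.
\<close>

lemma scheme_energy_estimate:
  assumes T: "T > 0" and part: "is_partition T N t" and mesh: "mesh N t < \<tau>s"
    and C': "C' > 0" "\<And>i. i \<in> {2..N} \<Longrightarrow> max (step t i - step t (i - 1)) 0 / step t (i - 1) \<le> C' * mesh N t"
    and u0: "u0 \<in> eff_dom \<phi>" and x0: "x 0 \<in> M_E p \<phi> (mesh N t) u0"
    and x: "\<And>i. i \<in> {1..N} \<Longrightarrow> x i \<in> M_G p q \<phi> (step t i) (x (i - 1))"
    and c: "\<And>w. ereal c \<le> \<phi> w"
    and C: "C = 1 + \<bar>\<phi>r u0\<bar> + p * (\<phi>r u0 - c) + (1 + C' * \<tau>s) * q * (\<phi>r u0 + 1 - c)"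
    and g: "g \<in> borel_measurable (lebesgue_on {0<..<\<tau>s})"
    and mono: "mono_on {0<..<\<tau>s} (\<lambda>\<tau>. ennreal (1 / \<tau>) * (\<integral>\<^sup>+ r. g r \<partial>lebesgue_on {0<..<\<tau>}))"
    and taylor: "taylor_estimate p q \<phi> \<tau>s C g"
    and \<eta>: "ennreal (1 / mesh N t) * (\<integral>\<^sup>+ r. g r \<partial>lebesgue_on {0<..<mesh N t}) \<le> ennreal \<eta>" "\<eta> \<ge> 0" "T * \<eta> \<le> q"
  shows "\<And>i. i \<le> N \<Longrightarrow> x i \<in> slope_dom \<phi>"
    and "\<And>i. i \<in> {1..N} \<Longrightarrow> gap (step t i) (x (i - 1)) (x i) \<le> step t i * \<eta> / q"
    and "\<And>i. i \<le> N \<Longrightarrow> \<phi>r (x i) + discrete_action p t x i / p + (\<Sum>j = 1..i. step t j * slope_pow (x j)) / q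
             \<le> \<phi>r u0 + t i * \<eta> / q"
proof -
  have N: "N \<ge> 1" using part T by (cases N) (auto simp: is_partition_def)
  have mp: "0 < mesh N t" using step_pos[OF part, of 1] step_le_mesh[of 1 N t] N by simp
  note E = M_E_D[OF x0 u0 mp]
  have cf: "c \<le> \<phi>r w" if "w \<in> eff_dom \<phi>" for w using c[of w] phi_eq[OF that] by (metis ereal_less_eq(3))
  have cu0: "c \<le> \<phi>r u0" by (rule cf[OF u0])
  let ?e = "\<lambda>j. step t j powr (1 - p) / p * dist (x (j - 1)) (x j) powr p + step t j / q * slope_pow (x j)"
  have e0: "0 \<le> ?e j" if "j \<in> {1..N}" for j using step_pos[OF part that] p q by simp
  have \<tau>s: "\<tau>s > 0" using mp mesh by simp
  have gapb: "gap (step t i) (x (i - 1)) (x i) \<le> step t i * \<eta> / q"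
    if i: "i \<in> {1..N}" and "x (i - 1) \<in> slope_dom \<phi>" "\<phi>r (x (i - 1)) \<le> C" "step t i * slope_pow (x (i - 1)) \<le> C" for i
  proof -
    have \<tau>: "0 < step t i" "step t i \<le> mesh N t" using step_pos[OF part i] step_le_mesh[OF i] by auto
    define I where "I = (\<integral>\<^sup>+ r. g r \<partial>lebesgue_on {0<..<step t i})"
    have "ennreal (1 / step t i) * I \<le> ennreal (1 / mesh N t) * (\<integral>\<^sup>+ r. g r \<partial>lebesgue_on {0<..<mesh N t})"
      unfolding I_def using \<tau> mesh by (intro mono_onD[OF mono]) auto
    also note \<eta>(1)
    finally have "ennreal (step t i) * (ennreal (1 / step t i) * I) \<le> ennreal (step t i) * ennreal \<eta>"
      by (intro mult_left_mono) auto
    then have I: "I \<le> ennreal (step t i * \<eta>)"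
      using \<tau> \<eta>(2) by (simp add: mult.assoc[symmetric] ennreal_mult[symmetric])
    have "ennreal (gap (step t i) (x (i - 1)) (x i)) \<le> ennreal (1 / q) * I"
      unfolding I_def using that \<tau> mesh by (intro gap_le_taylor_integral[OF _ _ _ x g taylor]) auto
    also have "\<dots> \<le> ennreal (1 / q) * ennreal (step t i * \<eta>)" using I by (intro mult_left_mono) auto
    also have "\<dots> = ennreal (step t i * \<eta> / q)" using q \<tau> \<eta>(2) by (simp add: ennreal_mult[symmetric])
    finally show ?thesis using q \<tau> \<eta>(2) by (subst (asm) ennreal_le_iff) auto
  qed
  have tT: "t i * \<eta> / q \<le> 1" if "i \<le> N" for i
  proof -
    have "t i \<le> T" using partition_mono[OF part that, of ] part by (simp add: is_partition_def)
    then have "t i * \<eta> \<le> q" using \<eta> by (meson mult_right_mono order_trans)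
    then show ?thesis using q by simp
  qed
  have Cge: "\<phi>r u0 + 1 \<le> C" "p * (\<phi>r u0 - c) \<le> C" "(1 + C' * \<tau>s) * q * (\<phi>r u0 + 1 - c) \<le> C"
  proof -
    have "0 \<le> p * (\<phi>r u0 - c)" "0 \<le> (1 + C' * \<tau>s) * q * (\<phi>r u0 + 1 - c)"
      using cu0 p q C'(1) \<tau>s by auto
    then show "\<phi>r u0 + 1 \<le> C" "p * (\<phi>r u0 - c) \<le> C" "(1 + C' * \<tau>s) * q * (\<phi>r u0 + 1 - c) \<le> C"
      unfolding C using abs_ge_self[of "\<phi>r u0"] abs_ge_zero[of "\<phi>r u0"] by linarith+
  qed
  have main: "x i \<in> slope_dom \<phi> \<and> \<phi>r (x i) + (\<Sum>j = 1..i. ?e j) \<le> \<phi>r u0 + t i * \<eta> / q \<and>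
      \<phi>r (x i) \<le> C \<and> (i < N \<longrightarrow> step t (Suc i) * slope_pow (x i) \<le> C)" if "i \<le> N" for i
    using that
  proof (induction i)
    case 0
    have "0 \<le> mesh N t powr (1 - p) / p * dist u0 (x 0) powr p" using p by simp
    then have fx: "\<phi>r (x 0) \<le> \<phi>r u0" using E(2) by simp
    have "step t 1 * slope_pow (x 0) \<le> mesh N t * slope_pow (x 0)"
      using step_le_mesh[of 1 N t] N by (intro mult_right_mono) auto
    also have "\<dots> \<le> mesh N t * (dist u0 (x 0) powr p * mesh N t powr (- p))"
      using E(3) mp by (intro mult_left_mono) auto
    also have "\<dots> = p * (mesh N t powr (1 - p) / p * dist u0 (x 0) powr p)"
      using p mp by (simp add: powr_diff powr_minus field_simps)
    also have "\<dots> \<le> p * (\<phi>r u0 - c)"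
      using E(2) cf[OF slope_dom_subset[OF E(1)]] p by (intro mult_left_mono) auto
    finally have "step t (Suc 0) * slope_pow (x 0) \<le> C" using Cge by simp
    then show ?case using E(1) fx Cge part by (auto simp: is_partition_def)
  next
    case (Suc i)
    then have IH: "x i \<in> slope_dom \<phi>" "\<phi>r (x i) + (\<Sum>j = 1..i. ?e j) \<le> \<phi>r u0 + t i * \<eta> / q"
      "\<phi>r (x i) \<le> C" "step t (Suc i) * slope_pow (x i) \<le> C" by auto
    have i: "Suc i \<in> {1..N}" using Suc.prems by auto
    note \<tau> = step_pos[OF part i]
    have xs: "x (Suc i) \<in> slope_dom \<phi>"
      using M_G_D(1)[OF x[OF i] _ \<tau>] slope_dom_subset[OF IH(1)] by simp
    have "gap (step t (Suc i)) (x i) (x (Suc i)) \<le> step t (Suc i) * \<eta> / q"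
      using gapb[OF i] IH by simp
    then have "\<phi>r (x (Suc i)) + (\<Sum>j = 1..Suc i. ?e j) \<le> \<phi>r u0 + t i * \<eta> / q + step t (Suc i) * \<eta> / q"
      using IH(2) by simp
    also have "\<dots> = \<phi>r u0 + t (Suc i) * \<eta> / q"
      by (simp add: step_def algebra_simps add_divide_distrib[symmetric] diff_divide_distrib)
    finally have en: "\<phi>r (x (Suc i)) + (\<Sum>j = 1..Suc i. ?e j) \<le> \<phi>r u0 + t (Suc i) * \<eta> / q" .
    have en1: "\<phi>r (x (Suc i)) + (\<Sum>j = 1..Suc i. ?e j) \<le> \<phi>r u0 + 1" using en tT[OF Suc.prems] by simp
    have "0 \<le> (\<Sum>j = 1..Suc i. ?e j)" using Suc.prems by (intro sum_nonneg e0) auto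
    then have fC: "\<phi>r (x (Suc i)) \<le> C" using en1 Cge by simp
    have "step t (Suc (Suc i)) * slope_pow (x (Suc i)) \<le> C" if "Suc i < N"
    proof -
      have "(step t (Suc (Suc i)) - step t (Suc i)) / step t (Suc i)
          \<le> max (step t (Suc (Suc i)) - step t (Suc i)) 0 / step t (Suc i)"
        using \<tau> by (intro divide_right_mono) auto
      also have "\<dots> \<le> C' * mesh N t" using C'(2)[of "Suc (Suc i)"] that by simp
      also have "\<dots> \<le> C' * \<tau>s" using C'(1) mesh by simp
      finally have "step t (Suc (Suc i)) \<le> (1 + C' * \<tau>s) * step t (Suc i)" using \<tau> by (simp add: field_simps)
      then have "step t (Suc (Suc i)) * slope_pow (x (Suc i)) \<le> (1 + C' * \<tau>s) * step t (Suc i) * slope_pow (x (Suc i))"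
        by (intro mult_right_mono) auto
      also have "\<dots> = (1 + C' * \<tau>s) * q * (step t (Suc i) / q * slope_pow (x (Suc i)))" using q by simp
      also have "\<dots> \<le> (1 + C' * \<tau>s) * q * (\<phi>r u0 + 1 - c)"
      proof (rule mult_left_mono)
        have "step t (Suc i) / q * slope_pow (x (Suc i)) \<le> ?e (Suc i)" using p by simp
        also have "?e (Suc i) \<le> (\<Sum>j = 1..Suc i. ?e j)"
          using Suc.prems by (intro member_le_sum e0) auto
        also have "\<dots> \<le> \<phi>r u0 + 1 - c" using en1 cf[OF slope_dom_subset[OF xs]] by simp
        finally show "step t (Suc i) / q * slope_pow (x (Suc i)) \<le> \<phi>r u0 + 1 - c" .
        show "0 \<le> (1 + C' * \<tau>s) * q" using C'(1) \<tau>s q by simp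
      qed
      finally show ?thesis using Cge by simp
    qed
    then show ?case using xs en fC by blast
  qed
  show "x i \<in> slope_dom \<phi>" if "i \<le> N" for i using main[OF that] by blast
  have "(\<Sum>j = 1..i. ?e j) = discrete_action p t x i / p + (\<Sum>j = 1..i. step t j * slope_pow (x j)) / q" for i
    by (simp add: discrete_action_def sum.distrib sum_divide_distrib)
  then show "\<phi>r (x i) + discrete_action p t x i / p + (\<Sum>j = 1..i. step t j * slope_pow (x j)) / q \<le> \<phi>r u0 + t i * \<eta> / q"
    if "i \<le> N" for i using main[OF that] by simp
  show "gap (step t i) (x (i - 1)) (x i) \<le> step t i * \<eta> / q" if i: "i \<in> {1..N}" for i
  proof -
    have "i - 1 \<le> N" "i - 1 < N" "Suc (i - 1) = i" using i by auto
    then show ?thesis using main[of "i - 1"] by (intro gapb[OF i]) auto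
  qed
qed

end

section \<open>Compactness of curves with bounded action\<close>

text \<open>
  Large weights make the action term in Young's inequality arbitrarily small.
\<close>

lemma young_weight_small:
  assumes "p > 0" "e > 0" "B \<ge> 0"
  obtains l :: real where "l > 0" "l powr (- p) / p * B < e"
proof
  define l where "l = ((B + 1) / (p * e)) powr (1 / p)"
  show "l > 0" using assms by (simp add: l_def)
  have "l powr (- p) = p * e / (B + 1)"
    using assms by (simp add: l_def powr_powr powr_minus_divide)
  then have "l powr (- p) / p * B = e * (B / (B + 1))" using assms by simp
  also have "\<dots> < e" using assms by (simp add: field_simps)
  finally show "l powr (- p) / p * B < e" .
qed

lemma pointwise_subsequence_on_countable:
  fixes Y :: "nat \<Rightarrow> 'b \<Rightarrow> 'a::metric_space"
  assumes K: "compact K" "\<And>n r. Y n r \<in> K" and D: "countable D"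
  obtains k :: "nat \<Rightarrow> nat" where "strict_mono k" "\<And>r. r \<in> D \<Longrightarrow> convergent (\<lambda>j. Y (k j) r)"
proof (cases "D = {}")
  case False
  define e where "e = from_nat_into D"
  interpret subseqs "\<lambda>i s. convergent (\<lambda>j. Y (s j) (e i))"
  proof
    fix n and s :: "nat \<Rightarrow> nat" assume "strict_mono s"
    have "seq_compact K" using K(1) by (simp add: compact_eq_seq_compact_metric)
    then obtain l r where "strict_mono r" "((\<lambda>j. Y (s j) (e n)) \<circ> r) \<longlonglongrightarrow> l"
      using K(2) unfolding seq_compact_def by meson
    then show "\<exists>r'. strict_mono r' \<and> convergent (\<lambda>j. Y ((s \<circ> r') j) (e n))"
      by (auto simp: o_def convergent_def)
  qed
  have "convergent (\<lambda>j. Y (diagseq j) (e i))" for i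
  proof -
    have "convergent (\<lambda>j. Y ((diagseq \<circ> ((+) (Suc i))) j) (e i))"
    proof (rule diagseq_holds)
      fix r s :: "nat \<Rightarrow> nat" and n assume "strict_mono r" "convergent (\<lambda>j. Y (s j) (e n))"
      then show "convergent (\<lambda>j. Y ((s \<circ> r) j) (e n))"
        using convergent_subseq_convergent[of "\<lambda>j. Y (s j) (e n)" r] by (simp add: o_def)
    qed
    then obtain l where "(\<lambda>j. Y (diagseq (j + Suc i)) (e i)) \<longlonglongrightarrow> l" by (auto simp: convergent_def o_def add.commute)
    then have "(\<lambda>j. Y (diagseq j) (e i)) \<longlonglongrightarrow> l" by (rule LIMSEQ_offset)
    then show ?thesis by (auto simp: convergent_def)
  qed
  moreover have "\<exists>i. r = e i" if "r \<in> D" for r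
    using from_nat_into_surj[OF D that] by (auto simp: e_def)
  ultimately show ?thesis using that[OF subseq_diagseq] by metis
qed (use that[of id] in \<open>auto simp: strict_mono_def\<close>)

text \<open>
  A diagonal subsequence converges at all rational times, for the curves and for their actions. The
  curves are Hoelder continuous up to the vanishing error \<open>\<delta>\<close>, so they converge at every time. For the
  actions the limit at rational times is replaced by its right-continuous version, the infimum over
  later rational times: right-continuity makes it a distribution function, and the shift to later
  times costs only a strict inequality in the comparison with the lower limit of the actions.
\<close>

theorem compactness_of_curves_with_energy:
  fixes w :: "nat \<Rightarrow> real \<Rightarrow> 'a::complete_space" and A :: "nat \<Rightarrow> real \<Rightarrow> real" and \<kappa> :: "real \<Rightarrow> real"
  assumes pq: "p > 0" "q > 0"
    and K: "compact K" "\<And>n r. w n r \<in> K"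
    and A: "\<And>n. mono (A n)" "\<And>n r. 0 \<le> A n r" "\<And>n r. A n r \<le> B"
    and \<delta>: "\<delta> \<longlonglongrightarrow> 0"
    and \<kappa>: "mono \<kappa>" "\<And>s t. s \<le> t \<Longrightarrow> \<kappa> t - \<kappa> s \<le> t - s"
    and est: "\<And>n s t l. l > 0 \<Longrightarrow> s \<le> t \<Longrightarrow>
        dist (w n s) (w n t) \<le> l powr q / q * (\<kappa> t - \<kappa> s + \<delta> n) + l powr (- p) / p * (A n t - A n s)"
  shows "\<exists>(k :: nat \<Rightarrow> nat) u A'. strict_mono k \<and> (\<forall>r. (\<lambda>j. w (k j) r) \<longlonglongrightarrow> u r) \<and>
     mono A' \<and> (\<forall>a. continuous (at_right a) A') \<and> (\<forall>s. 0 \<le> A' s \<and> A' s \<le> B) \<and>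
     (\<forall>l>0. dominates_increments u (\<lambda>t. l powr q / q * \<kappa> t + l powr (- p) / p * A' t)) \<and>
     (\<forall>s t. s < t \<longrightarrow> ereal (A' s) \<le> liminf (\<lambda>j. ereal (A (k j) t)))"
proof -
  have B0: "0 \<le> B" using A(2,3)[of 0 0] by linarith
  have Amono: "A n s \<le> A n t" if "s \<le> t" for n s t using A(1) that by (auto simp: mono_def)
  have AB: "A n t - A n s \<le> B" for n s t using A(2)[of n s] A(3)[of n t] by linarith
  have "compact (K \<times> {0..B})" by (intro compact_Times K) auto
  then obtain k :: "nat \<Rightarrow> nat" where k: "strict_mono k"
    and conv: "\<And>r. r \<in> \<rat> \<Longrightarrow> convergent (\<lambda>j. (w (k j) r, A (k j) r))"
    using pointwise_subsequence_on_countable[of "K \<times> {0..B}" "\<lambda>n r. (w n r, A n r)" \<rat>] K(2) A(2,3) countable_rat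
    by auto
  have wQ: "convergent (\<lambda>j. w (k j) r)" and AQ: "convergent (\<lambda>j. A (k j) r)" if "r \<in> \<rat>" for r
  proof -
    obtain l where "(\<lambda>j. (w (k j) r, A (k j) r)) \<longlonglongrightarrow> l" using conv[OF \<open>r \<in> \<rat>\<close>] by (auto simp: convergent_def)
    from tendsto_fst[OF this] tendsto_snd[OF this]
    show "convergent (\<lambda>j. w (k j) r)" "convergent (\<lambda>j. A (k j) r)" by (auto simp: convergent_def)
  qed
  define A0 where "A0 = (\<lambda>r. lim (\<lambda>j. A (k j) r))"
  have A0: "(\<lambda>j. A (k j) r) \<longlonglongrightarrow> A0 r" if "r \<in> \<rat>" for r
    using AQ[OF that] by (simp add: A0_def convergent_LIMSEQ_iff)
  have \<delta>k: "(\<lambda>j. \<delta> (k j)) \<longlonglongrightarrow> 0" using LIMSEQ_subseq_LIMSEQ[OF \<delta> k] by (simp add: o_def)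
  have est': "dist (w n s) (w n t) \<le> l powr q / q * (t - s + \<delta> n) + l powr (- p) / p * B"
    if "l > 0" "s \<le> t" for l n s t
  proof -
    have "l powr q / q * (\<kappa> t - \<kappa> s + \<delta> n) \<le> l powr q / q * (t - s + \<delta> n)"
      using \<kappa>(2)[OF that(2)] pq by (intro mult_left_mono) auto
    moreover have "l powr (- p) / p * (A n t - A n s) \<le> l powr (- p) / p * B"
      using AB pq by (intro mult_left_mono) auto
    ultimately show ?thesis using est[OF that, of n] by linarith
  qed
  have scale_to: "\<exists>\<eta>>0. a * \<eta> = e" if "a > 0" "e > 0" for a e :: real
    using that by (intro exI[of _ "e / a"]) auto
  have Cau: "Cauchy (\<lambda>j. w (k j) r)" for r
  proof (rule metric_CauchyI)
    fix e :: real assume e: "e > 0"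
    obtain l where l: "l > 0" "l powr (- p) / p * B < e / 8"
      using young_weight_small[of p "e / 8" B] pq e B0 by auto
    have lq: "l powr q / q > 0" using l pq by simp
    then obtain \<eta> where \<eta>: "\<eta> > 0" "l powr q / q * \<eta> = e / 8"
      using scale_to[of "l powr q / q" "e / 8"] e by auto
    obtain s where s: "s \<in> \<rat>" "r - \<eta> < s" "s < r" using Rats_dense_in_real[of "r - \<eta>" r] \<eta> by auto
    obtain N1 where N1: "\<And>j. j \<ge> N1 \<Longrightarrow> \<delta> (k j) < \<eta>"
      using order_tendstoD(2)[OF \<delta>k \<eta>(1)] by (auto simp: eventually_sequentially)
    obtain N2 where N2: "\<And>i j. i \<ge> N2 \<Longrightarrow> j \<ge> N2 \<Longrightarrow> dist (w (k i) s) (w (k j) s) < e / 4"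
      using metric_CauchyD[OF convergent_Cauchy[OF wQ[OF s(1)]], of "e / 4"] e by auto
    have near: "dist (w (k j) s) (w (k j) r) < 3 * e / 8" if "j \<ge> N1" for j
    proof -
      have "l powr q / q * (r - s + \<delta> (k j)) \<le> l powr q / q * (\<eta> + \<eta>)"
        using s N1[OF that] lq by (intro mult_left_mono) auto
      also have "\<dots> = e / 4" using \<eta>(2) by (simp add: algebra_simps)
      finally show ?thesis using est'[OF l(1) less_imp_le[OF s(3)], of "k j"] l(2) by linarith
    qed
    have "dist (w (k i) r) (w (k j) r) < e" if "i \<ge> max N1 N2" "j \<ge> max N1 N2" for i j
    proof -
      have "dist (w (k i) r) (w (k j) r) \<le> dist (w (k i) s) (w (k i) r) + dist (w (k i) s) (w (k j) s) + dist (w (k j) s) (w (k j) r)"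
        using dist_triangle[of "w (k i) r" "w (k j) r" "w (k i) s"] dist_triangle[of "w (k i) s" "w (k j) r" "w (k j) s"]
          dist_commute[of "w (k i) r" "w (k i) s"] by linarith
      then show ?thesis using near[of i] near[of j] N2[of i j] that by simp
    qed
    then show "\<exists>M. \<forall>m\<ge>M. \<forall>n\<ge>M. dist (w (k m) r) (w (k n) r) < e" by blast
  qed
  define u where "u = (\<lambda>r. lim (\<lambda>j. w (k j) r))"
  have u: "(\<lambda>j. w (k j) r) \<longlonglongrightarrow> u r" for r
    using Cauchy_convergent[OF Cau[of r]] by (simp add: u_def convergent_LIMSEQ_iff)
  have ulim: "dist (u s) (u t) \<le> l powr q / q * (t - s) + l powr (- p) / p * B" if "l > 0" "s \<le> t" for l s t
  proof (rule LIMSEQ_le)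
    show "(\<lambda>j. dist (w (k j) s) (w (k j) t)) \<longlonglongrightarrow> dist (u s) (u t)" by (intro tendsto_dist u)
    have "(\<lambda>j. l powr q / q * (t - s + \<delta> (k j)) + l powr (- p) / p * B)
        \<longlonglongrightarrow> l powr q / q * (t - s + 0) + l powr (- p) / p * B"
      by (intro tendsto_intros \<delta>k)
    then show "(\<lambda>j. l powr q / q * (t - s + \<delta> (k j)) + l powr (- p) / p * B)
        \<longlonglongrightarrow> l powr q / q * (t - s) + l powr (- p) / p * B" by simp
  qed (use est'[OF that] in auto)
  have ucont: "\<exists>\<eta>>0. \<forall>s t. s \<le> t \<and> t < s + \<eta> \<longrightarrow> dist (u s) (u t) < e" if e: "e > 0" for e
  proof -
    obtain l where l: "l > 0" "l powr (- p) / p * B < e / 2"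
      using young_weight_small[of p "e / 2" B] pq e B0 by auto
    have lq: "l powr q / q > 0" using l pq by simp
    then obtain \<eta> where \<eta>: "\<eta> > 0" "l powr q / q * \<eta> = e / 2"
      using scale_to[of "l powr q / q" "e / 2"] e by auto
    define a where "a = l powr q / q"
    define b where "b = l powr (- p) / p * B"
    have "dist (u s) (u t) < e" if "s \<le> t" "t < s + \<eta>" for s t
    proof -
      have "l powr q / q * (t - s) \<le> l powr q / q * \<eta>" using that lq by (intro mult_left_mono) auto
      with ulim[OF l(1) that(1)] l(2) \<eta>(2)
      show ?thesis unfolding a_def[symmetric] b_def[symmetric] by linarith
    qed
    then show ?thesis using \<eta>(1) by blast
  qed
  have A0b: "0 \<le> A0 r" "A0 r \<le> B" if "r \<in> \<rat>" for r
    using LIMSEQ_le_const[OF A0[OF that], of 0] LIMSEQ_le_const2[OF A0[OF that], of B] A(2,3) by auto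
  define A' where "A' = (\<lambda>t. Inf (A0 ` {r \<in> \<rat>. t < r}))"
  have ne: "A0 ` {r \<in> \<rat>. t < r} \<noteq> {}" for t
    using Rats_no_top_le[of "t + 1"] by (auto intro: less_le_trans[of t "t + 1"])
  have bb: "bdd_below (A0 ` {r \<in> \<rat>. t < r})" for t
    using A0b by (intro bdd_belowI[of _ 0]) auto
  have A'le: "A' t \<le> A0 r" if "r \<in> \<rat>" "t < r" for t r
    unfolding A'_def by (rule cInf_lower[OF _ bb]) (use that in auto)
  have A'near: "\<exists>r\<in>\<rat>. t < r \<and> r < t + \<eta> \<and> A0 r < A' t + e" if e: "e > 0" "\<eta> > 0" for t e \<eta>
  proof -
    define z where "z = A' t + e"
    have "Inf (A0 ` {r \<in> \<rat>. t < r}) < z" using e by (simp add: z_def A'_def)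
    from cInf_lessD[OF ne this] obtain r where r: "r \<in> \<rat>" "t < r" "A0 r < A' t + e"
      unfolding z_def by auto
    obtain r' where r': "r' \<in> \<rat>" "t < r'" "r' < min r (t + \<eta>)"
      using Rats_dense_in_real[of t "min r (t + \<eta>)"] r e by auto
    have "A0 r' \<le> A0 r"
      by (rule LIMSEQ_le[OF A0[OF r'(1)] A0[OF r(1)]]) (use r' Amono in auto)
    then show ?thesis using r r' by (intro bexI[of _ r']) auto
  qed
  have A'mono: "A' s \<le> A' t" if "s \<le> t" for s t
  proof (rule field_le_epsilon)
    fix e :: real assume "e > 0"
    then obtain r where "r \<in> \<rat>" "t < r" "A0 r < A' t + e" using A'near[of e 1 t] by auto
    then show "A' s \<le> A' t + e" using A'le[of r s] that by linarith
  qed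
  have A'b: "0 \<le> A' s \<and> A' s \<le> B" for s
  proof
    show "0 \<le> A' s" unfolding A'_def by (rule cInf_greatest[OF ne]) (use A0b in auto)
    obtain r where "r \<in> \<rat>" "s < r" using ne[of s] by auto
    then show "A' s \<le> B" using A'le[of r s] A0b[of r] by linarith
  qed
  have A'cont: "continuous (at_right a) A'" for a
    unfolding continuous_within
  proof (rule tendstoI)
    fix e :: real assume "e > 0"
    then obtain r where r: "r \<in> \<rat>" "a < r" "A0 r < A' a + e" using A'near[of e 1 a] by auto
    show "\<forall>\<^sub>F x in at_right a. dist (A' x) (A' a) < e"
      using eventually_at_right_real[OF r(2)]
    proof eventually_elim
      case (elim x)
      then show ?case using A'le[OF r(1), of x] A'mono[of a x] r(3) by (auto simp: dist_real_def)
    qed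
  qed
  have dom: "dist (u s) (u t) \<le> l powr q / q * (\<kappa> t - \<kappa> s) + l powr (- p) / p * (A' t - A' s)"
    if l: "l > 0" and st: "s < t" for l s t
  proof (rule field_le_epsilon)
    fix e :: real assume e: "e > 0"
    define a where "a = l powr q / q"
    define b where "b = l powr (- p) / p"
    have ab: "a > 0" "b > 0" using l pq by (auto simp: a_def b_def)
    obtain \<eta>0 where \<eta>0: "\<eta>0 > 0" "\<And>x y. x \<le> y \<Longrightarrow> y < x + \<eta>0 \<Longrightarrow> dist (u x) (u y) < e / 4"
      using ucont[of "e / 4"] e by auto
    define \<eta> where "\<eta> = min \<eta>0 (e / 4 / a)"
    have \<eta>: "\<eta> > 0" "\<eta> \<le> \<eta>0" "a * \<eta> \<le> e / 4" using \<eta>0 e ab by (auto simp: \<eta>_def min_def field_simps)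
    obtain r where r: "r \<in> \<rat>" "s < r" "r < min t (s + \<eta>)" using Rats_dense_in_real[of s "min t (s + \<eta>)"] \<eta> st by auto
    obtain r' where r': "r' \<in> \<rat>" "t < r'" "r' < t + \<eta>" "A0 r' < A' t + e / 4 / b"
      using A'near[of "e / 4 / b" \<eta> t] e ab \<eta> by auto
    have rr: "r \<le> r'" using r r' by auto
    have "dist (u r) (u r') \<le> a * (\<kappa> r' - \<kappa> r + 0) + b * (A0 r' - A0 r)"
    proof (rule LIMSEQ_le)
      show "(\<lambda>j. dist (w (k j) r) (w (k j) r')) \<longlonglongrightarrow> dist (u r) (u r')" by (intro tendsto_dist u)
      show "(\<lambda>j. a * (\<kappa> r' - \<kappa> r + \<delta> (k j)) + b * (A (k j) r' - A (k j) r)) \<longlonglongrightarrow> a * (\<kappa> r' - \<kappa> r + 0) + b * (A0 r' - A0 r)"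
        by (intro tendsto_intros \<delta>k A0 r r')
    qed (use est[OF l rr] in \<open>auto simp: a_def b_def\<close>)
    moreover have "a * (\<kappa> r' - \<kappa> r) \<le> a * (\<kappa> t - \<kappa> s) + e / 4"
    proof -
      have "\<kappa> r' \<le> \<kappa> t + \<eta>" "\<kappa> s \<le> \<kappa> r" using \<kappa>(2)[of t r'] \<kappa>(1) r r' by (auto simp: mono_def)
      then have "a * (\<kappa> r' - \<kappa> r) \<le> a * (\<kappa> t - \<kappa> s + \<eta>)" using ab by (intro mult_left_mono) auto
      then show ?thesis using \<eta>(3) by (simp add: algebra_simps)
    qed
    moreover have "b * (A0 r' - A0 r) \<le> b * (A' t - A' s) + e / 4"
    proof -
      have "b * (A0 r' - A0 r) \<le> b * (A' t - A' s + e / 4 / b)"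
        using A'le[of r s] r r' ab by (intro mult_left_mono) auto
      then show ?thesis using ab by (simp add: algebra_simps)
    qed
    moreover have "dist (u s) (u r) < e / 4" "dist (u t) (u r') < e / 4" using \<eta>0(2)[of s r] \<eta>0(2)[of t r'] r r' \<eta> by auto
    moreover have "dist (u s) (u t) \<le> dist (u s) (u r) + dist (u r) (u r') + dist (u t) (u r')"
      using dist_triangle[of "u s" "u t" "u r"] dist_triangle2[of "u r" "u t" "u r'"] by linarith
    ultimately show "dist (u s) (u t) \<le> l powr q / q * (\<kappa> t - \<kappa> s) + l powr (- p) / p * (A' t - A' s) + e"
      by (simp add: a_def b_def)
  qed
  have "dominates_increments u (\<lambda>t. l powr q / q * \<kappa> t + l powr (- p) / p * A' t)" if "l > 0" for l
    unfolding dominates_increments_def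
  proof (intro allI impI)
    fix s t :: real assume "s \<le> t"
    then show "dist (u s) (u t) \<le> l powr q / q * \<kappa> t + l powr (- p) / p * A' t - (l powr q / q * \<kappa> s + l powr (- p) / p * A' s)"
      using dom[OF that, of s t] by (cases "s = t") (auto simp: right_diff_distrib)
  qed
  moreover have "ereal (A' s) \<le> liminf (\<lambda>j. ereal (A (k j) t))" if st: "s < t" for s t
  proof -
    obtain r where r: "r \<in> \<rat>" "s < r" "r < t" using Rats_dense_in_real[OF st] by auto
    have "ereal (A' s) \<le> ereal (A0 r)" using A'le[of r s] r by simp
    also have "ereal (A0 r) = liminf (\<lambda>j. ereal (A (k j) r))"
      using A0[OF r(1)] by (intro lim_imp_Liminf[symmetric]) auto
    also have "\<dots> \<le> liminf (\<lambda>j. ereal (A (k j) t))" using r Amono by (intro Liminf_mono) auto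
    finally show ?thesis .
  qed
  moreover have "mono A'" using A'mono by (simp add: mono_def)
  ultimately show ?thesis using k u A'cont A'b by blast
qed

section \<open>Action of the limit curve and indefinite integrals\<close>

text \<open>
  Optimizing the weight in Young's inequality recovers the multiplicative bound; the minimum is
  attained at \<open>l\<^sup>p\<^sup>q = Y/X\<close>.
\<close>

lemma young_optimal:
  fixes p q d X Y :: real
  assumes pq: "p > 1" "q > 1" "1 / p + 1 / q = 1" and X: "X > 0" and Y: "Y \<ge> 0" and d: "d \<ge> 0"
    and le: "\<And>l. l > 0 \<Longrightarrow> d \<le> l powr q / q * X + l powr (- p) / p * Y"
  shows "d powr p \<le> X powr (p - 1) * Y"
proof (cases "Y = 0")
  case True
  have "d \<le> 0 + e" if e: "e > 0" for e
  proof -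
    define l where "l = (q * e / X) powr (1 / q)"
    have "l > 0" "l powr q = q * e / X" using e X pq by (auto simp: l_def powr_powr)
    then have "d \<le> (q * e / X) / q * X" using le[of l] True by simp
    then show ?thesis using X pq by simp
  qed
  then have "d = 0" using d field_le_epsilon[of d 0] by force
  then show ?thesis using pq Y by simp
next
  case False
  define Z where "Z = Y / X"
  have Z: "Z > 0" "Y = Z * X" using False Y X by (auto simp: Z_def)
  define l where "l = Z powr (1 / (p * q))"
  have l: "l > 0" "l powr q = Z powr (1 / p)" "l powr (- p) = Z powr (- (1 / q))"
    using Z pq by (auto simp: l_def powr_powr)
  have "Z powr (- (1 / q)) * Z = Z powr (- (1 / q) + 1)" using powr_add[of Z "- (1 / q)" 1] Z(1) by simp
  also have "- (1 / q) + 1 = 1 / p" using pq(3) by simp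
  finally have eq: "Z powr (- (1 / q)) / p * Y = Z powr (1 / p) * X / p" using Z by (simp add: mult.assoc[symmetric])
  have "d \<le> Z powr (1 / p) / q * X + Z powr (1 / p) * X / p"
    using le[OF l(1)] unfolding l(2,3) eq .
  also have "\<dots> = Z powr (1 / p) * X * (1 / p + 1 / q)" by (simp add: distrib_left)
  finally have "d \<le> Z powr (1 / p) * X" by (simp add: pq(3))
  then have "d powr p \<le> (Z powr (1 / p) * X) powr p" using d pq by (intro powr_mono2) auto
  also have "\<dots> = Z * X powr p" using Z X pq by (simp add: powr_mult powr_powr)
  also have "X powr p = X powr (p - 1) * X" using X by (simp add: powr_diff)
  finally show ?thesis using Z(2) by (simp add: mult_ac)
qed

text \<open>
  The difference quotients of \<open>u\<close> with step \<open>h\<close> satisfy \<open>(d(u(r),u(r+h))/h)\<^sup>p \<le> (A(r+h) - A(r))/h\<close>. The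
  integral of the right-hand side over \<open>[0, t - h]\<close> telescopes to the mean of \<open>A\<close> over \<open>[t - h, t]\<close>
  minus a nonnegative term, and Fatou's lemma applies to the left-hand side.
\<close>

theorem speed_energy_le:
  fixes u :: "real \<Rightarrow> 'a::metric_space" and A :: "real \<Rightarrow> real"
  assumes pq: "p > 1" "q > 1" "1 / p + 1 / q = 1"
    and A: "mono A" "\<And>s. 0 \<le> A s"
    and \<kappa>: "\<And>s t. s \<le> t \<Longrightarrow> \<kappa> t - \<kappa> s \<le> t - s"
    and dom: "\<And>l. l > 0 \<Longrightarrow> dominates_increments u (\<lambda>t. l powr q / q * \<kappa> t + l powr (- p) / p * A t)"
    and m: "m \<in> borel_measurable borel" "\<And>x. 0 \<le> m x"
    and speed: "AE x in lborel. ((\<lambda>s. dist (u s) (u x) / \<bar>s - x\<bar>) \<longlongrightarrow> m x) (at x)"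
    and t: "t > 0" and b: "\<And>s. s < t \<Longrightarrow> A s \<le> b"
  shows "(\<integral>\<^sup>+ r. ennreal (m r powr p) * indicator {0..t} r \<partial>lborel) \<le> ennreal b"
proof -
  have A': "A x \<le> A y" if "x \<le> y" for x y using A(1) that by (auto simp: mono_def)
  obtain k0 :: nat where k0: "inverse (real (Suc k0)) < t" using reals_Archimedean[OF t] by blast
  \<comment> \<open>Steps tending to 0, all of them smaller than \<open>t\<close>.\<close>
  define h where "h = (\<lambda>k. 1 / real (k + Suc k0))"
  have h: "0 < h k" "h k < t" for k
  proof -
    have "h k \<le> inverse (real (Suc k0))" unfolding h_def inverse_eq_divide by (intro divide_left_mono) auto
    then show "h k < t" using k0 by simp
  qed (simp add: h_def)
  have hlim: "h \<longlonglongrightarrow> 0"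
    unfolding h_def using LIMSEQ_ignore_initial_segment[OF lim_inverse_n, of "Suc k0"] by (simp add: inverse_eq_divide)
  have incr: "(dist (u r) (u (r + h k)) / h k) powr p \<le> (A (r + h k) - A r) / h k" for k r
  proof -
    have "dist (u r) (u (r + h k)) powr p \<le> h k powr (p - 1) * (A (r + h k) - A r)"
    proof (rule young_optimal[OF pq h(1)])
      show "0 \<le> A (r + h k) - A r" using A'[of r "r + h k"] h[of k] by simp
      fix l :: real assume l: "l > 0"
      have "dist (u r) (u (r + h k)) \<le> l powr q / q * \<kappa> (r + h k) + l powr (- p) / p * A (r + h k)
          - (l powr q / q * \<kappa> r + l powr (- p) / p * A r)"
        using dom[OF l, unfolded dominates_increments_def, rule_format, of r "r + h k"] h(1)[of k] by simp
      then have "dist (u r) (u (r + h k)) \<le> l powr q / q * (\<kappa> (r + h k) - \<kappa> r) + l powr (- p) / p * (A (r + h k) - A r)"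
        by (simp add: right_diff_distrib)
      moreover have "l powr q / q * (\<kappa> (r + h k) - \<kappa> r) \<le> l powr q / q * h k"
        using \<kappa>[of r "r + h k"] h(1)[of k] pq by (intro mult_left_mono) auto
      ultimately show "dist (u r) (u (r + h k)) \<le> l powr q / q * h k + l powr (- p) / p * (A (r + h k) - A r)"
        by linarith
    qed simp
    then have "dist (u r) (u (r + h k)) powr p / h k powr p \<le> h k powr (p - 1) * (A (r + h k) - A r) / h k powr p"
      using h(1)[of k] by (intro divide_right_mono) auto
    also have "\<dots> = (A (r + h k) - A r) / h k" using h(1)[of k] by (simp add: powr_diff)
    finally show ?thesis using h(1)[of k] by (simp add: powr_divide)
  qed
  define F where "F = (\<lambda>k r. (if r \<in> {0..t - h k} then (A (r + h k) - A r) / h k else 0))"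
  have Am[measurable]: "A \<in> borel_measurable borel" by (rule borel_measurable_mono[OF A(1)])
  have Fm[measurable]: "F k \<in> borel_measurable borel" for k unfolding F_def by measurable
  have F0: "0 \<le> F k r" for k r using A'[of r "r + h k"] h(1)[of k] by (auto simp: F_def)
  have Fint: "(\<integral>\<^sup>+ r. ennreal (F k r) \<partial>lborel) \<le> ennreal b" for k
  proof -
    have Ai: "A integrable_on {c..d}" for c d
      by (rule integrable_on_mono_on) (use A' in \<open>auto simp: mono_on_def\<close>)
    define I where "I = (integral {t - h k..t} A - integral {0..h k} A) / h k"
    have "((\<lambda>r. (A (r + h k) - A r) / h k) has_integral I) {0..t - h k}"
      unfolding I_def
      using has_integral_shift_difference[OF Ai[of 0 t], of "h k"] h[of k] by (intro has_integral_divide) simp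
    then have "(F k has_integral I) UNIV" unfolding F_def by (simp only: has_integral_restrict_UNIV)
    then have "(\<integral>\<^sup>+ r. ennreal (F k r) \<partial>lborel) = ennreal I"
      by (intro nn_integral_has_integral_lborel Fm F0)
    moreover have "I \<le> b"
    proof -
      have "integral {t - h k..t} A \<le> h k * b"
      proof (rule has_integral_le_off_negligible[OF integrable_integral[OF Ai] _ negligible_sing[of t]])
        show "((\<lambda>_. b) has_integral h k * b) {t - h k..t}"
          using has_integral_const_real[of b "t - h k" t] h(1)[of k] by simp
      qed (use b in auto)
      moreover have "0 \<le> integral {0..h k} A" by (rule integral_nonneg[OF Ai]) (use A(2) in auto)
      ultimately have "integral {t - h k..t} A - integral {0..h k} A \<le> b * h k" by (simp add: mult.commute)
      then show ?thesis using h(1)[of k] by (simp add: I_def pos_divide_le_eq)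
    qed
    ultimately show ?thesis by (simp add: ennreal_leI)
  qed
  have "(\<integral>\<^sup>+ r. ennreal (m r powr p) * indicator {0..t} r \<partial>lborel) \<le> (\<integral>\<^sup>+ r. liminf (\<lambda>k. ennreal (F k r)) \<partial>lborel)"
  proof (rule nn_integral_mono_AE)
    show "AE r in lborel. ennreal (m r powr p) * indicator {0..t} r \<le> liminf (\<lambda>k. ennreal (F k r))"
      using speed AE_lborel_singleton[of t]
    proof eventually_elim
      case (elim r)
      show ?case
      proof (cases "r \<in> {0..t}")
        case True
        then have rt: "0 \<le> r" "r < t" using elim by auto
        have lim1: "(\<lambda>k. r + h k) \<longlonglongrightarrow> r" using tendsto_add[OF tendsto_const[of r] hlim] by simp
        then have "filterlim (\<lambda>k. r + h k) (at r) sequentially"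
          unfolding filterlim_at using h(1) by (auto simp: less_imp_neq[OF h(1), symmetric])
        from filterlim_compose[OF elim(1) this]
        have "(\<lambda>k. dist (u (r + h k)) (u r) / \<bar>r + h k - r\<bar>) \<longlonglongrightarrow> m r" .
        then have "(\<lambda>k. dist (u r) (u (r + h k)) / h k) \<longlonglongrightarrow> m r" using h(1) by (simp add: dist_commute abs_of_pos)
        then have "(\<lambda>k. (dist (u r) (u (r + h k)) / h k) powr p) \<longlonglongrightarrow> m r powr p"
          using pq h(1) less_imp_le[OF h(1)] by (intro tendsto_powr') auto
        then have "(\<lambda>k. ennreal ((dist (u r) (u (r + h k)) / h k) powr p)) \<longlonglongrightarrow> ennreal (m r powr p)"
          by (rule tendsto_ennrealI)
        then have "ennreal (m r powr p) = liminf (\<lambda>k. ennreal ((dist (u r) (u (r + h k)) / h k) powr p))"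
          by (intro lim_imp_Liminf[symmetric]) auto
        also have "\<dots> \<le> liminf (\<lambda>k. ennreal (F k r))"
        proof (rule Liminf_mono)
          have "\<forall>\<^sub>F k in sequentially. h k < t - r" using order_tendstoD(2)[OF hlim, of "t - r"] rt by simp
          then show "\<forall>\<^sub>F k in sequentially. ennreal ((dist (u r) (u (r + h k)) / h k) powr p) \<le> ennreal (F k r)"
          proof eventually_elim
            case (elim k)
            then show ?case using incr[of r k] rt by (auto simp: F_def intro!: ennreal_leI)
          qed
        qed
        finally show ?thesis using True by simp
      qed simp
    qed
  qed
  also have "\<dots> \<le> liminf (\<lambda>k. \<integral>\<^sup>+ r. ennreal (F k r) \<partial>lborel)"
    by (intro nn_integral_liminf) measurable
  also have "\<dots> \<le> ennreal b"
    using Fint by (intro Liminf_le) (auto intro!: eventually_frequently)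
  finally show ?thesis .
qed

text \<open>
  The weak derivative is \<open>- h\<close>: exchanging the order of integration in \<open>\<integral>\<integral>\<^sub>r\<^sub>\<le>\<^sub>t h(r) \<eta>'(t)\<close> leaves
  \<open>\<integral> h(r) (\<eta>(T) - \<eta>(r))\<close>, and \<open>\<eta>\<close> vanishes at the endpoints.
\<close>

lemma W11_indefinite_integral:
  fixes h :: "real \<Rightarrow> real"
  assumes T: "T > 0" and h: "integrable lborel h"
    and f: "\<And>t. t \<in> {0..T} \<Longrightarrow> f t = c - (\<integral>r. indicator {0..t} r * h r \<partial>lborel)"
  shows "W11 T f"
proof -
  have hm[measurable]: "h \<in> borel_measurable borel" using h by auto
  define H where "H = (\<lambda>t. \<integral>r. indicator {0..t} r * h r \<partial>lborel)"
  have hi: "integrable lborel (\<lambda>r. indicator B r * h r)" if "B \<in> sets borel" for B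
    using integrable_mult_indicator[OF _ h, of B] that by simp
  have conv: "integrable (lebesgue_on {0<..<T}) g \<longleftrightarrow> integrable lborel (\<lambda>r. indicator {0<..<T} r * g r)"
    "integral\<^sup>L (lebesgue_on {0<..<T}) g = (\<integral>r. indicator {0<..<T} r * g r \<partial>lborel)"
    if "(\<lambda>r. indicator {0<..<T} r * g r) \<in> borel_measurable borel" for g :: "real \<Rightarrow> real"
    using that by (simp_all add: integrable_restrict_space integral_restrict_space integrable_completion integral_completion)
  have Hm[measurable]: "H \<in> borel_measurable borel"
  proof -
    have "H = (\<lambda>t. \<integral>r. (if 0 \<le> r \<and> r \<le> t then h r else 0) \<partial>lborel)"
      unfolding H_def by (intro ext Bochner_Integration.integral_cong) (auto simp: indicator_def)
    also have "\<dots> \<in> borel_measurable borel" by measurable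
    finally show ?thesis .
  qed
  have Hb: "\<bar>H t\<bar> \<le> (\<integral>r. \<bar>h r\<bar> \<partial>lborel)" for t
  proof -
    have "\<bar>H t\<bar> \<le> (\<integral>r. \<bar>indicator {0..t} r * h r\<bar> \<partial>lborel)" unfolding H_def by (rule integral_abs_bound)
    also have "\<dots> \<le> (\<integral>r. \<bar>h r\<bar> \<partial>lborel)"
      by (intro integral_mono integrable_abs hi h) (auto simp: indicator_def)
    finally show ?thesis .
  qed
  have bint: "integrable lborel (\<lambda>r. indicator {0<..<T} r * g r)"
    if "g \<in> borel_measurable borel" "\<And>r. \<bar>g r\<bar> \<le> B" for g :: "real \<Rightarrow> real" and B
  proof (rule Bochner_Integration.integrable_bound)
    show "integrable lborel (\<lambda>r. indicator {0<..<T} r * B)" using T by simp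
    show "(\<lambda>r. indicator {0<..<T} r * g r) \<in> borel_measurable lborel" using that(1) by simp
    show "AE x in lborel. norm (indicator {0<..<T} x * g x) \<le> norm (indicator {0<..<T} x * B)"
      by (intro always_eventually allI) (auto simp: indicator_def intro: order_trans[OF that(2) abs_ge_self])
  qed
  have fH: "indicator {0<..<T} r * f r = indicator {0<..<T} r * (c - H r)" for r
    using f[of r] by (auto simp: H_def indicator_def)
  show ?thesis unfolding W11_def
  proof (intro conjI exI[of _ "\<lambda>r. - h r"] allI impI)
    show "integrable (lebesgue_on {0<..<T}) f"
    proof -
      have "integrable lborel (\<lambda>r. indicator {0<..<T} r * (c - H r))"
        by (rule bint[of _ "\<bar>c\<bar> + (\<integral>r. \<bar>h r\<bar> \<partial>lborel)"]) (use Hb in \<open>auto intro: order_trans[OF abs_triangle_ineq4]\<close>)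
      then show ?thesis by (subst conv) (auto simp: fH)
    qed
    show "integrable (lebesgue_on {0<..<T}) (\<lambda>r. - h r)"
      using hi[of "{0<..<T}"] by (subst conv) auto
    fix \<eta> assume "test_function T \<eta>"
    then have diff: "\<And>k. (deriv ^^ k) \<eta> differentiable_on UNIV"
      and supp: "closure {x. \<eta> x \<noteq> 0} \<subseteq> {0<..<T}" by (auto simp: test_function_def)
    have \<eta>0: "\<eta> x = 0" if "x \<notin> {0<..<T}" for x using supp closure_subset[of "{x. \<eta> x \<noteq> 0}"] that by blast
    have d: "(\<eta> has_real_derivative deriv \<eta> x) (at x)" for x
      using diff[of 0] by (simp add: differentiable_on_def real_differentiable_def DERIV_deriv_iff_real_differentiable)
    have contd: "continuous_on UNIV (deriv \<eta>)" using differentiable_imp_continuous_on[OF diff[of 1]] by simp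
    have dm[measurable]: "deriv \<eta> \<in> borel_measurable borel" by (rule borel_measurable_continuous_onI[OF contd])
    have \<eta>m[measurable]: "\<eta> \<in> borel_measurable borel"
      by (rule borel_measurable_continuous_onI) (use d in \<open>auto intro: continuous_at_imp_continuous_on DERIV_isCont\<close>)
    have "bounded (deriv \<eta> ` {0..T})"
      by (intro compact_imp_bounded compact_continuous_image continuous_on_subset[OF contd]) auto
    then obtain D where "\<forall>x\<in>{0..T}. \<bar>deriv \<eta> x\<bar> \<le> D" by (auto simp: bounded_iff)
    then have D: "\<bar>deriv \<eta> x\<bar> \<le> D" if "x \<in> {0..T}" for x using that by blast
    have D0: "0 \<le> D" using D[of 0] T by (auto intro: order_trans[OF abs_ge_zero])
    have ftc: "(\<integral>x. deriv \<eta> x * indicator {a..T} x \<partial>lborel) = \<eta> T - \<eta> a" if "a \<le> T" for a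
      by (rule integral_FTC_Icc_real[OF that]) (use d contd in \<open>auto simp: continuous_on_eq_continuous_at\<close>)
    define K where "K = (\<lambda>r t. (if 0 \<le> r \<and> r \<le> t \<and> t \<le> T then h r * deriv \<eta> t else 0))"
    have Kint: "integrable (lborel \<Otimes>\<^sub>M lborel) (\<lambda>(r, t). K r t)"
    proof (rule lborel_pair.Fubini_integrable)
      show "(\<lambda>(r, t). K r t) \<in> borel_measurable (lborel \<Otimes>\<^sub>M lborel)" unfolding K_def by measurable
      have Kb: "norm (K r t) \<le> indicator {0..T} t * (\<bar>h r\<bar> * D)" for r t
        using D[of t] D0 by (auto simp: K_def indicator_def abs_mult intro!: mult_left_mono)
      have i1: "integrable lborel (\<lambda>t. indicator {0..T} t * (\<bar>h r\<bar> * D))" for r using T by simp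
      have i2: "integrable lborel (\<lambda>t. K r t)" for r
      proof (rule Bochner_Integration.integrable_bound[OF i1[of r]])
        show "K r \<in> borel_measurable lborel" unfolding K_def by measurable
        show "AE t in lborel. norm (K r t) \<le> norm (indicator {0..T} t * (\<bar>h r\<bar> * D))"
          using Kb[of r] D0 by (intro always_eventually allI) (auto intro: order_trans)
      qed
      then show "AE x in lborel. integrable lborel (\<lambda>y. case (x, y) of (r, t) \<Rightarrow> K r t)" by simp
      show "integrable lborel (\<lambda>x. \<integral>y. norm (case (x, y) of (r, t) \<Rightarrow> K r t) \<partial>lborel)"
      proof (rule Bochner_Integration.integrable_bound)
        show "integrable lborel (\<lambda>r. T * D * \<bar>h r\<bar>)" using h by simp
        show "(\<lambda>x. \<integral>y. norm (case (x, y) of (r, t) \<Rightarrow> K r t) \<partial>lborel) \<in> borel_measurable lborel"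
          unfolding K_def by measurable
        have "(\<integral>t. norm (K r t) \<partial>lborel) \<le> T * D * \<bar>h r\<bar>" for r
        proof -
          have "(\<integral>t. norm (K r t) \<partial>lborel) \<le> (\<integral>t. indicator {0..T} t * (\<bar>h r\<bar> * D) \<partial>lborel)"
            by (intro integral_mono integrable_norm i2 i1 Kb)
          also have "\<dots> = T * D * \<bar>h r\<bar>" using T by simp
          finally show ?thesis .
        qed
        then show "AE x in lborel. norm (\<integral>y. norm (case (x, y) of (r, t) \<Rightarrow> K r t) \<partial>lborel) \<le> norm (T * D * \<bar>h x\<bar>)"
          using T D0 by (intro always_eventually allI) (simp add: abs_mult)
      qed
    qed
    have inner1: "(\<integral>t. K r t \<partial>lborel) = - (indicator {0<..<T} r * (h r * \<eta> r))" for r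
    proof (cases "0 \<le> r \<and> r \<le> T")
      case True
      have "(\<integral>t. K r t \<partial>lborel) = (\<integral>t. h r * (deriv \<eta> t * indicator {r..T} t) \<partial>lborel)"
        using True by (intro Bochner_Integration.integral_cong) (auto simp: K_def indicator_def)
      also have "\<dots> = h r * (\<eta> T - \<eta> r)" using ftc[of r] True by simp
      also have "\<dots> = - (indicator {0<..<T} r * (h r * \<eta> r))"
        using \<eta>0[of T] \<eta>0[of r] by (auto simp: indicator_def)
      finally show ?thesis .
    next
      case False
      then have "K r t = 0" for t by (auto simp: K_def)
      then show ?thesis using False by (auto simp: indicator_def)
    qed
    have inner2: "(\<integral>r. K r t \<partial>lborel) = indicator {0..T} t * (H t * deriv \<eta> t)" for t
    proof -
      have "(\<integral>r. K r t \<partial>lborel) = (\<integral>r. (indicator {0..T} t * deriv \<eta> t) * (indicator {0..t} r * h r) \<partial>lborel)"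
        by (intro Bochner_Integration.integral_cong) (auto simp: K_def indicator_def)
      then show ?thesis by (simp add: H_def)
    qed
    have Fub: "(\<integral>t. indicator {0..T} t * (H t * deriv \<eta> t) \<partial>lborel) = - (\<integral>r. indicator {0<..<T} r * (h r * \<eta> r) \<partial>lborel)"
      using lborel_pair.Fubini_integral[OF Kint] by (simp add: inner1 inner2)
    have open_closed: "(\<integral>t. indicator {0<..<T} t * g t \<partial>lborel) = (\<integral>t. indicator {0..T} t * g t \<partial>lborel)"
      if [measurable]: "g \<in> borel_measurable borel" for g :: "real \<Rightarrow> real"
    proof (rule integral_cong_AE)
      show "AE t in lborel. indicator {0<..<T} t * g t = indicator {0..T} t * g t"
        using AE_lborel_singleton[of 0] AE_lborel_singleton[of T] by eventually_elim (auto simp: indicator_def)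
    qed measurable
    have di: "integrable lborel (\<lambda>t. indicator {0..T} t * (g t * deriv \<eta> t))"
      if [measurable]: "g \<in> borel_measurable borel" and "\<And>t. \<bar>g t\<bar> \<le> B" for g :: "real \<Rightarrow> real" and B
    proof (rule Bochner_Integration.integrable_bound)
      show "integrable lborel (\<lambda>t. indicator {0..T} t * (B * D))" using T by simp
      have gd: "\<bar>g t * deriv \<eta> t\<bar> \<le> B * D" if "t \<in> {0..T}" for t
        unfolding abs_mult using D[OF that] \<open>\<And>t. \<bar>g t\<bar> \<le> B\<close>[of t] by (intro mult_mono) auto
      show "AE t in lborel. norm (indicator {0..T} t * (g t * deriv \<eta> t)) \<le> norm (indicator {0..T} t * (B * D))"
        by (intro always_eventually allI) (auto simp: indicator_def intro: order_trans[OF gd abs_ge_self])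
    qed measurable
    have c0: "(\<integral>t. indicator {0..T} t * (c * deriv \<eta> t) \<partial>lborel) = 0"
    proof -
      have "(\<integral>t. indicator {0..T} t * (c * deriv \<eta> t) \<partial>lborel) = (\<integral>t. c * (deriv \<eta> t * indicator {0..T} t) \<partial>lborel)"
        by (intro Bochner_Integration.integral_cong) auto
      also have "\<dots> = c * (\<eta> T - \<eta> 0)" using ftc[of 0] T by simp
      finally show ?thesis using \<eta>0[of 0] \<eta>0[of T] by simp
    qed
    have fHd: "(\<lambda>r. indicator {0<..<T} r * (f r * deriv \<eta> r)) = (\<lambda>r. indicator {0<..<T} r * ((c - H r) * deriv \<eta> r))"
    proof
      fix r show "indicator {0<..<T} r * (f r * deriv \<eta> r) = indicator {0<..<T} r * ((c - H r) * deriv \<eta> r)"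
        using fH[of r] by (auto simp: indicator_def)
    qed
    have "(\<integral>r. f r * deriv \<eta> r \<partial>lebesgue_on {0<..<T}) = (\<integral>t. indicator {0<..<T} t * ((c - H t) * deriv \<eta> t) \<partial>lborel)"
      by (subst conv(2)) (simp_all only: fHd, measurable)
    also have "\<dots> = (\<integral>t. indicator {0..T} t * ((c - H t) * deriv \<eta> t) \<partial>lborel)" by (rule open_closed) measurable
    also have "\<dots> = (\<integral>t. indicator {0..T} t * (c * deriv \<eta> t) - indicator {0..T} t * (H t * deriv \<eta> t) \<partial>lborel)"
      by (intro Bochner_Integration.integral_cong) (auto simp: algebra_simps)
    also have "\<dots> = - (\<integral>t. indicator {0..T} t * (H t * deriv \<eta> t) \<partial>lborel)"
      using di[of "\<lambda>_. c" "\<bar>c\<bar>"] di[of H, OF Hm Hb] c0 by (subst Bochner_Integration.integral_diff) auto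
    also have "\<dots> = (\<integral>r. indicator {0<..<T} r * (h r * \<eta> r) \<partial>lborel)" by (simp add: Fub)
    also have "\<dots> = - (\<integral>r. - h r * \<eta> r \<partial>lebesgue_on {0<..<T})"
      by (subst conv) auto
    finally show "(\<integral>r. f r * deriv \<eta> r \<partial>lebesgue_on {0<..<T}) = - (\<integral>r. - h r * \<eta> r \<partial>lebesgue_on {0<..<T})" .
  qed
qed

section \<open>From the energy inequality to maximal slope\<close>

lemma borel_measurable_ennreal_powr [measurable]:
  assumes [measurable]: "g \<in> borel_measurable M"
  shows "(\<lambda>x. ennreal_powr (g x) a) \<in> borel_measurable M"
  unfolding ennreal_powr_def by measurable

definition slope_action :: "real \<Rightarrow> ('a::metric_space \<Rightarrow> ereal) \<Rightarrow> (real \<Rightarrow> 'a) \<Rightarrow> real \<Rightarrow> ennreal" where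
  "slope_action q \<phi> u t = (\<integral>\<^sup>+ r. ennreal_powr (local_slope \<phi> (u r)) q * indicator {0..t} r \<partial>lborel)"

lemma young_ennreal:
  fixes s :: ennreal and y :: real
  assumes pq: "p > 1" "q > 1" "1 / p + 1 / q = 1" and y: "y \<ge> 0"
  shows "s * ennreal y \<le> ennreal (1 / p) * ennreal (y powr p) + ennreal (1 / q) * ennreal_powr s q"
proof (cases s)
  case (real a)
  have "a * y \<le> y powr p / p + a powr q / q"
    using Youngs_inequality[of p q y a] pq y real by (simp add: mult.commute)
  then have "ennreal (a * y) \<le> ennreal (y powr p / p + a powr q / q)" by (rule ennreal_leI)
  also have "\<dots> = ennreal (1 / p * y powr p) + ennreal (1 / q * a powr q)"
    using pq by (simp add: ennreal_plus)
  finally show ?thesis using real y pq by (simp add: ennreal_powr_def ennreal_mult[symmetric] mult.commute)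
next
  case top
  then show ?thesis using pq by (simp add: ennreal_powr_def ennreal_mult_top)
qed

lemma nn_integral_lebesgue_on_eq:
  "S \<in> sets lebesgue \<Longrightarrow> (\<integral>\<^sup>+ r. g r \<partial>lebesgue_on S) = (\<integral>\<^sup>+ r. g r * indicator S r \<partial>lborel)"
  by (simp add: nn_integral_restrict_space nn_integral_completion)

text \<open>
  The energy inequality makes \<open>u\<close> a curve in \<open>AC\<^sup>p\<close>, so the strong upper gradient property is
  available; with Young's inequality it bounds \<open>\<phi>(u(0)) - \<phi>(u(t))\<close> from above by the same two
  integrals. The resulting equality shows that \<open>\<phi> \<circ> u\<close> is an indefinite integral.
\<close>

lemma (in compact_functional) maximal_slope_of_energy_inequality:
  fixes u :: "real \<Rightarrow> 'a" and m :: "real \<Rightarrow> real"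
  defines "X \<equiv> \<lambda>t. \<integral>\<^sup>+ r. ennreal (m r powr p) * indicator {0..t} r \<partial>lborel"
    and "Y \<equiv> slope_action q \<phi> u"
  assumes T: "T > 0" and sug: "strong_upper_gradient p T \<phi> (local_slope \<phi>)"
    and m[measurable]: "m \<in> borel_measurable borel" and m0: "\<And>x. 0 \<le> m x" and mint: "integrable lborel m"
    and mdist: "\<And>s t. s \<le> t \<Longrightarrow> dist (u s) (u t) \<le> integral {s..t} m"
    and speed: "AE x in lborel. ((\<lambda>s. dist (u s) (u x) / \<bar>s - x\<bar>) \<longlongrightarrow> m x) (at x)"
    and u0: "u 0 \<in> eff_dom \<phi>"
    and ineq: "\<And>t. t \<in> {0..T} \<Longrightarrow>
        \<phi> (u t) + enn2ereal (ennreal (1 / p) * X t) + enn2ereal (ennreal (1 / q) * Y t) \<le> \<phi> (u 0)"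
  shows "curve_of_maximal_slope p q T \<phi> u"
proof -
  have fin: "u t \<in> eff_dom \<phi> \<and> ennreal (1 / p) * X t < \<infinity> \<and> ennreal (1 / q) * Y t < \<infinity>" if "t \<in> {0..T}" for t
  proof -
    have "\<phi> (u t) + enn2ereal (ennreal (1 / p) * X t) + enn2ereal (ennreal (1 / q) * Y t) < \<infinity>"
      using ineq[OF that] u0 by (auto simp: eff_dom_def intro: le_less_trans)
    then have 1: "\<phi> (u t) < \<infinity>" "enn2ereal (ennreal (1 / p) * X t) < \<infinity>" "enn2ereal (ennreal (1 / q) * Y t) < \<infinity>"
      using not_minf[of "u t"] enn2ereal_nonneg[of "ennreal (1 / p) * X t"] enn2ereal_nonneg[of "ennreal (1 / q) * Y t"]
      by (cases "\<phi> (u t)"; cases "enn2ereal (ennreal (1 / p) * X t)"; cases "enn2ereal (ennreal (1 / q) * Y t)"; simp)+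
    have 2: "z < \<infinity>" if "enn2ereal z < \<infinity>" for z using that by (cases z) auto
    show ?thesis using 1 2 by (auto simp: eff_dom_def)
  qed
  have finX: "X t < \<infinity>" and finY: "Y t < \<infinity>" if "t \<in> {0..T}" for t
    using fin[OF that] p q by (auto simp: ennreal_mult_less_top)
  have AC: "AC_curve p T u"
    unfolding AC_curve_def
  proof (intro exI[of _ m] conjI allI impI)
    show "m \<in> borel_measurable (lebesgue_on {0<..<T})"
      by (intro measurable_restrict_space1 measurable_completion) simp
    show "integrable (lebesgue_on {0<..<T}) (\<lambda>r. \<bar>m r\<bar> powr p)"
    proof (rule integrableI_bounded)
      have "(\<lambda>r. \<bar>m r\<bar> powr p) \<in> borel_measurable lebesgue" by (rule measurable_completion) measurable
      then show "(\<lambda>r. \<bar>m r\<bar> powr p) \<in> borel_measurable (lebesgue_on {0<..<T})" by (rule measurable_restrict_space1)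
      have "(\<integral>\<^sup>+ r. ennreal (norm (\<bar>m r\<bar> powr p)) \<partial>lebesgue_on {0<..<T}) \<le> X T"
        unfolding X_def
        by (subst nn_integral_lebesgue_on_eq) (auto intro!: nn_integral_mono simp: m0 indicator_def)
      then show "(\<integral>\<^sup>+ r. ennreal (norm (\<bar>m r\<bar> powr p)) \<partial>lebesgue_on {0<..<T}) < \<infinity>"
        using finX[of T] T by (auto intro: le_less_trans)
    qed
    fix s t :: real assume "0 \<le> s" "s \<le> t" "t \<le> T"
    have "integrable lebesgue m" using mint by (simp add: integrable_completion)
    then have "integrable (lebesgue_on {s..t}) m"
      using integrable_mult_indicator[of "{s..t}" lebesgue m] by (simp add: integrable_restrict_space)
    then have "integral\<^sup>L (lebesgue_on {s..t}) m = integral {s..t} m"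
      by (intro lebesgue_integral_eq_integral) auto
    then show "dist (u s) (u t) \<le> integral\<^sup>L (lebesgue_on {s..t}) m" using mdist[OF \<open>s \<le> t\<close>] by simp
  qed
  have ls: "(\<lambda>r. local_slope \<phi> (u r)) \<in> borel_measurable (restrict_space borel {0..T})"
    and grad: "\<And>t. t \<in> {0..T} \<Longrightarrow> (\<phi> (u 0) = \<infinity> \<and> \<phi> (u t) = \<infinity>) \<or> \<bar>\<phi> (u t) - \<phi> (u 0)\<bar>
             \<le> enn2ereal (\<integral>\<^sup>+ r. local_slope \<phi> (u r) * ennreal (metric_derivative u r) \<partial>lebesgue_on {0..t})"
    using sug AC unfolding strong_upper_gradient_def by auto
  \<comment> \<open>Borel on the whole line, as the slope along \<open>u\<close> is known to be Borel on \<open>[0, T]\<close> only.\<close>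
  define lsl where "lsl = (\<lambda>r. local_slope \<phi> (u r) * indicator {0..T} r)"
  have lsl[measurable]: "lsl \<in> borel_measurable borel"
    unfolding lsl_def using ls by (subst (asm) borel_measurable_restrict_space_iff_ennreal) auto
  have lsl_eq: "lsl r = local_slope \<phi> (u r)" if "r \<in> {0..T}" for r using that by (simp add: lsl_def)
  have md: "AE r in lborel. metric_derivative u r = m r"
    using speed
  proof eventually_elim
    case (elim r)
    then have "((\<lambda>s. dist (u s) (u r) / \<bar>r - s\<bar>) \<longlongrightarrow> m r) (at r)" by (simp add: abs_minus_commute)
    then show ?case unfolding metric_derivative_def by (intro tendsto_Lim) auto
  qed
  have Y_eq: "Y t = (\<integral>\<^sup>+ r. ennreal_powr (lsl r) q * indicator {0..t} r \<partial>lborel)" if "t \<in> {0..T}" for t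
    unfolding Y_def slope_action_def using that by (intro nn_integral_cong) (auto simp: indicator_def lsl_eq)
  have sum_eq: "ennreal (1 / p) * X t + ennreal (1 / q) * Y t =
      (\<integral>\<^sup>+ r. ennreal (1 / p) * (ennreal (m r powr p) * indicator {0..t} r) + ennreal (1 / q) * (ennreal_powr (lsl r) q * indicator {0..t} r) \<partial>lborel)"
    if t: "t \<in> {0..T}" for t
    unfolding Y_eq[OF t] X_def by (simp add: nn_integral_add nn_integral_cmult)
  have upper: "\<phi> (u 0) \<le> \<phi> (u t) + enn2ereal (ennreal (1 / p) * X t + ennreal (1 / q) * Y t)" if t: "t \<in> {0..T}" for t
  proof -
    have "(\<integral>\<^sup>+ r. local_slope \<phi> (u r) * ennreal (metric_derivative u r) \<partial>lebesgue_on {0..t})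
        = (\<integral>\<^sup>+ r. local_slope \<phi> (u r) * ennreal (metric_derivative u r) * indicator {0..t} r \<partial>lborel)"
      by (simp add: nn_integral_lebesgue_on_eq)
    also have "\<dots> \<le> ennreal (1 / p) * X t + ennreal (1 / q) * Y t"
      unfolding sum_eq[OF t]
    proof (rule nn_integral_mono_AE)
      show "AE r in lborel. local_slope \<phi> (u r) * ennreal (metric_derivative u r) * indicator {0..t} r
        \<le> ennreal (1 / p) * (ennreal (m r powr p) * indicator {0..t} r) + ennreal (1 / q) * (ennreal_powr (lsl r) q * indicator {0..t} r)"
        using md
      proof eventually_elim
        case (elim r)
        then show ?case
          using young_ennreal[OF p q pq m0[of r], of "local_slope \<phi> (u r)"] t by (auto simp: indicator_def lsl_eq)
      qed
    qed
    finally have "enn2ereal (\<integral>\<^sup>+ r. local_slope \<phi> (u r) * ennreal (metric_derivative u r) \<partial>lebesgue_on {0..t})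
      \<le> enn2ereal (ennreal (1 / p) * X t + ennreal (1 / q) * Y t)" by (simp only: less_eq_ennreal.rep_eq)
    with grad[OF t] u0 have "\<bar>\<phi> (u t) - \<phi> (u 0)\<bar> \<le> enn2ereal (ennreal (1 / p) * X t + ennreal (1 / q) * Y t)"
      by (auto simp: eff_dom_def)
    then show ?thesis
      using fin[OF t] u0 not_minf[of "u t"] not_minf[of "u 0"]
      by (cases "\<phi> (u t)"; cases "\<phi> (u 0)"; cases "enn2ereal (ennreal (1 / p) * X t + ennreal (1 / q) * Y t)") (auto simp: eff_dom_def)
  qed
  have eq: "\<phi> (u t) + enn2ereal (ennreal (1 / p) * X t) + enn2ereal (ennreal (1 / q) * Y t) = \<phi> (u 0)" if t: "t \<in> {0..T}" for t
    using ineq[OF t] upper[OF t] by (intro antisym) (simp_all add: plus_ennreal.rep_eq add.assoc)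
  define h where "h = (\<lambda>r. indicator {0..T} r * (m r powr p / p + enn2real (ennreal_powr (lsl r) q) / q))"
  have hm[measurable]: "h \<in> borel_measurable borel" unfolding h_def by measurable
  have h0: "0 \<le> h r" for r using p q by (simp add: h_def)
  have "AE r in lborel. ennreal_powr (lsl r) q * indicator {0..T} r \<noteq> \<infinity>"
    using finY[of T] T Y_eq[of T] by (intro nn_integral_PInf_AE) auto
  then have slfin: "AE r in lborel. r \<in> {0..T} \<longrightarrow> ennreal_powr (lsl r) q < \<infinity>"
    by eventually_elim (auto simp: less_top)
  have hsum: "(\<integral>\<^sup>+ r. ennreal (indicator {0..t} r * h r) \<partial>lborel) = ennreal (1 / p) * X t + ennreal (1 / q) * Y t"
    if t: "t \<in> {0..T}" for t
    unfolding sum_eq[OF t]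
  proof (rule nn_integral_cong_AE)
    show "AE r in lborel. ennreal (indicator {0..t} r * h r) =
      ennreal (1 / p) * (ennreal (m r powr p) * indicator {0..t} r) + ennreal (1 / q) * (ennreal_powr (lsl r) q * indicator {0..t} r)"
      using slfin
    proof eventually_elim
      case (elim r)
      show ?case
      proof (cases "r \<in> {0..t}")
        case True
        then obtain b where b: "ennreal_powr (lsl r) q = ennreal b" "b \<ge> 0" using elim t by (cases "ennreal_powr (lsl r) q") auto
        have "ennreal (1 / p) * ennreal (m r powr p) = ennreal (m r powr p / p)"
          "ennreal (1 / q) * ennreal b = ennreal (b / q)"
          using p q b by (simp_all add: ennreal_mult[symmetric])
        then show ?thesis using True t b p q by (simp add: h_def)
      qed simp
    qed
  qed
  have hint: "integrable lborel h"
  proof (rule integrableI_bounded)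
    have "(\<integral>\<^sup>+ r. ennreal (norm (h r)) \<partial>lborel) = (\<integral>\<^sup>+ r. ennreal (indicator {0..T} r * h r) \<partial>lborel)"
      using h0 by (intro nn_integral_cong) (auto simp: h_def indicator_def)
    also have "\<dots> < \<infinity>" using hsum[of T] fin[of T] T by simp
    finally show "(\<integral>\<^sup>+ r. ennreal (norm (h r)) \<partial>lborel) < \<infinity>" .
  qed simp
  have fh: "\<phi>r (u t) = \<phi>r (u 0) - (\<integral>r. indicator {0..t} r * h r \<partial>lborel)" if t: "t \<in> {0..T}" for t
  proof -
    have hti: "integrable lborel (\<lambda>r. indicator {0..t} r * h r)"
      using integrable_mult_indicator[OF _ hint, of "{0..t}"] by simp
    define I where "I = (\<integral>r. indicator {0..t} r * h r \<partial>lborel)"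
    have I0: "0 \<le> I" unfolding I_def using h0 by (intro integral_nonneg_AE) auto
    have "ennreal I = ennreal (1 / p) * X t + ennreal (1 / q) * Y t"
      unfolding hsum[OF t, symmetric] I_def using h0 by (intro nn_integral_eq_integral[symmetric] hti) auto
    then have "enn2ereal (ennreal (1 / p) * X t) + enn2ereal (ennreal (1 / q) * Y t) = ereal I"
      using I0 by (metis enn2ereal_ennreal plus_ennreal.rep_eq)
    then have "\<phi> (u t) + ereal I = \<phi> (u 0)" using eq[OF t] by (simp add: add.assoc)
    then show ?thesis using fin[OF t] u0 not_minf[of "u t"] not_minf[of "u 0"] unfolding I_def[symmetric]
      by (cases "\<phi> (u t)"; cases "\<phi> (u 0)") (auto simp: eff_dom_def)
  qed
  show ?thesis
    unfolding curve_of_maximal_slope_def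
  proof (intro conjI ballI AC)
    show "u t \<in> eff_dom \<phi>" if "t \<in> {0..T}" for t using fin[OF that] by blast
    show "W11 T (\<lambda>t. \<phi>r (u t))" by (rule W11_indefinite_integral[OF T hint fh])
    fix t assume t: "t \<in> {0..T}"
    have "(\<integral>\<^sup>+ r. ennreal (metric_derivative u r powr p) \<partial>lebesgue_on {0..t}) = X t"
    proof (subst nn_integral_lebesgue_on_eq)
      show "(\<integral>\<^sup>+ r. ennreal (metric_derivative u r powr p) * indicator {0..t} r \<partial>lborel) = X t"
        unfolding X_def by (rule nn_integral_cong_AE) (use md in \<open>eventually_elim, simp\<close>)
    qed simp
    moreover have "(\<integral>\<^sup>+ r. ennreal_powr (local_slope \<phi> (u r)) q \<partial>lebesgue_on {0..t}) = Y t"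
      unfolding Y_def slope_action_def by (simp add: nn_integral_lebesgue_on_eq)
    ultimately show "\<phi> (u t)
        + enn2ereal (ennreal (1 / p) *
            (\<integral>\<^sup>+ r. ennreal (metric_derivative u r powr p) \<partial>lebesgue_on {0..t}))
        + enn2ereal (ennreal (1 / q) *
            (\<integral>\<^sup>+ r. ennreal_powr (local_slope \<phi> (u r)) q \<partial>lebesgue_on {0..t}))
        = \<phi> (u 0)" using eq[OF t] by simp
  qed
qed

section \<open>Piecewise constant interpolants\<close>

text \<open>
  Index of the partition cell containing \<open>r\<close>, total in \<open>r\<close>: times before 0 get the index 0 and
  times after \<open>T\<close> the index \<open>N\<close>.
\<close>

definition cell_index :: "nat \<Rightarrow> (nat \<Rightarrow> real) \<Rightarrow> real \<Rightarrow> nat" where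
  "cell_index N t r = (LEAST i. i = N \<or> r \<le> t i)"

lemma cell_index_le: "cell_index N t r \<le> N"
  unfolding cell_index_def by (rule Least_le) simp

lemma cell_index_upper: "cell_index N t r = N \<or> r \<le> t (cell_index N t r)"
  unfolding cell_index_def by (rule LeastI[of _ N]) simp

lemma cell_index_lower: "i < cell_index N t r \<Longrightarrow> t i < r"
  using not_less_Least[of i "\<lambda>i. i = N \<or> r \<le> t i"] by (auto simp: cell_index_def)

lemma cell_index_mono: "s \<le> r \<Longrightarrow> cell_index N t s \<le> cell_index N t r"
  using cell_index_upper[of N t r] cell_index_le[of N t] cell_index_lower[of "cell_index N t r" N t s]
  by (metis leI less_le_trans not_less order_less_irrefl)

lemma cell_index_cell:
  assumes part: "is_partition T N t" and r: "0 < r" "r \<le> T"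
  shows "cell_index N t r \<in> {1..N}" "r \<in> {t (cell_index N t r - 1)<..t (cell_index N t r)}"
proof -
  have up: "r \<le> t (cell_index N t r)" using cell_index_upper[of N t r] r part by (auto simp: is_partition_def)
  then have "cell_index N t r \<noteq> 0" using r part by (metis is_partition_def not_le)
  then show "cell_index N t r \<in> {1..N}" using cell_index_le[of N t r] by simp
  then show "r \<in> {t (cell_index N t r - 1)<..t (cell_index N t r)}"
    using up cell_index_lower[of "cell_index N t r - 1" N t r] by simp
qed

lemma interpolant_eq_cell_index:
  assumes part: "is_partition T N t" and r: "r \<in> {0..T}"
  shows "interpolant N t x r = x (cell_index N t r)"
proof (cases "r = 0")
  case True
  have "cell_index N t 0 = 0" unfolding cell_index_def using part by (intro Least_eq_0) (simp add: is_partition_def)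
  then show ?thesis using True by (simp add: interpolant_def)
next
  case False
  then have r': "0 < r" "r \<le> T" using r by auto
  note c = cell_index_cell[OF part r']
  have "(THE i. i \<in> {1..N} \<and> r \<in> {t (i - 1)<..t i}) = cell_index N t r"
  proof (rule the_equality)
    fix i assume i: "i \<in> {1..N} \<and> r \<in> {t (i - 1)<..t i}"
    have "\<not> i < cell_index N t r" using cell_index_lower[of i N t r] i by auto
    moreover have "\<not> cell_index N t r < i"
    proof
      assume "cell_index N t r < i"
      then have "t (cell_index N t r) \<le> t (i - 1)" using i by (intro partition_mono[OF part]) auto
      then show False using c i by auto
    qed
    ultimately show "i = cell_index N t r" by simp
  qed (use c in simp)
  then show ?thesis using False by (simp add: interpolant_def)
qed

lemma measurable_cell_index: "(\<lambda>r. h (cell_index N t r)) \<in> borel_measurable borel"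
proof -
  have "mono (\<lambda>r. real (cell_index N t r))" by (auto simp: mono_def cell_index_mono)
  then have "(\<lambda>r. real (cell_index N t r)) \<in> borel_measurable borel" by (rule borel_measurable_mono)
  then have "(\<lambda>r. \<lfloor>real (cell_index N t r)\<rfloor>) \<in> measurable borel (count_space UNIV)"
    by (rule measurable_compose) (rule measurable_real_floor)
  then have "(\<lambda>r. (\<lambda>i. h (nat i)) \<lfloor>real (cell_index N t r)\<rfloor>) \<in> borel_measurable borel"
    by (rule measurable_compose) simp
  then show ?thesis by simp
qed

text \<open>
  Rounding up to the partition moves the later time by at most one step and never moves the earlier
  one backwards.
\<close>

lemma cell_time_increment:
  assumes part: "is_partition T N t" and T: "T > 0" and sr: "s \<le> r"
  shows "t (cell_index N t r) - t (cell_index N t s) \<le> max 0 (min T r) - max 0 (min T s) + mesh N t"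
proof -
  have tb: "0 \<le> t i" "t i \<le> T" if "i \<le> N" for i
    using partition_mono[OF part, of 0 i] partition_mono[OF part, of i N] that part by (auto simp: is_partition_def)
  have N: "N \<ge> 1" using part T by (cases N) (auto simp: is_partition_def)
  have m0: "0 < mesh N t" using step_pos[OF part, of 1] step_le_mesh[of 1 N t] N by simp
  have \<kappa>: "max 0 (min T s) \<le> max 0 (min T r)" using sr by auto
  show ?thesis
  proof (cases "cell_index N t r = cell_index N t s")
    case False
    then have lt: "cell_index N t s < cell_index N t r" using cell_index_mono[OF sr, of N t] by simp
    then have "cell_index N t s < N" using cell_index_le[of N t r] by simp
    then have "s \<le> t (cell_index N t s)" using cell_index_upper[of N t s] by auto
    then have 1: "max 0 (min T s) \<le> t (cell_index N t s)" using tb(1)[OF cell_index_le[of N t s]] by auto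
    define i where "i = cell_index N t r"
    have i: "i \<in> {1..N}" using lt cell_index_le[of N t r] by (auto simp: i_def)
    have "t (i - 1) < r" using cell_index_lower[of "i - 1" N t r] i by (auto simp: i_def)
    moreover have "t (i - 1) \<le> T" using i by (intro tb(2)) auto
    ultimately have "t (i - 1) \<le> max 0 (min T r)" by simp
    then have "t i \<le> max 0 (min T r) + mesh N t" using step_le_mesh[OF i, of t] by (simp add: step_def)
    then show ?thesis using 1 unfolding i_def by linarith
  qed (use \<kappa> m0 in simp)
qed

text \<open>
  Young's inequality for each step, applied to \<open>l\<close> and \<open>d/(\<tau> l)\<close>; the bounds for the single steps
  add up by the triangle inequality.
\<close>

lemma chain_young_estimate:
  fixes x :: "nat \<Rightarrow> 'a::metric_space"
  assumes pq: "p > 1" "q > 1" "1 / p + 1 / q = 1" and l: "l > 0" and part: "is_partition T N t"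
    and ik: "i \<le> k" "k \<le> N"
  shows "dist (x i) (x k) \<le> l powr q / q * (t k - t i)
      + l powr (- p) / p * (discrete_action p t x k - discrete_action p t x i)"
  using ik
proof (induction k rule: dec_induct)
  case (step k)
  have "0 < step t (Suc k)" using step_pos[OF part, of "Suc k"] step by simp
  define \<tau> where "\<tau> = step t (Suc k)"
  define d where "d = dist (x k) (x (Suc k))"
  have \<tau>: "\<tau> > 0" unfolding \<tau>_def by fact
  have "l * (d / (\<tau> * l)) \<le> l powr q / q + (d / (\<tau> * l)) powr p / p"
    using Youngs_inequality[of q p l "d / (\<tau> * l)"] pq l \<tau> by (simp add: d_def add.commute)
  then have "d / \<tau> \<le> l powr q / q + (d / (\<tau> * l)) powr p / p" using l by simp
  also have "(d / (\<tau> * l)) powr p = l powr (- p) * (d powr p / \<tau> powr p)"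
    using l \<tau> by (simp add: powr_divide powr_mult powr_minus field_simps d_def)
  finally have "d / \<tau> * \<tau> \<le> (l powr q / q + l powr (- p) * (d powr p / \<tau> powr p) / p) * \<tau>"
    using \<tau> by (intro mult_right_mono) auto
  also have "\<dots> = l powr q / q * \<tau> + l powr (- p) / p * (\<tau> powr (1 - p) * d powr p)"
    using \<tau> by (simp add: powr_diff algebra_simps)
  finally have "d \<le> l powr q / q * \<tau> + l powr (- p) / p * (\<tau> powr (1 - p) * d powr p)" using \<tau> by simp
  moreover have "dist (x i) (x (Suc k)) \<le> dist (x i) (x k) + d" unfolding d_def by (rule dist_triangle)
  ultimately show ?case
    using step unfolding discrete_action_def
    by (simp add: \<tau>_def[symmetric] d_def[symmetric]) (simp add: \<tau>_def step_def algebra_simps add_divide_distrib diff_divide_distrib)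
qed simp

context compact_functional
begin

lemma step_function_slope_integral:
  assumes part: "is_partition T N t" and x: "\<And>i. i \<le> N \<Longrightarrow> x i \<in> slope_dom \<phi>" and r: "r \<le> T"
  shows "slope_action q \<phi> (\<lambda>s. x (cell_index N t s)) r
     \<le> ennreal (\<Sum>j = 1..cell_index N t r. step t j * slope_pow (x j))"
proof -
  let ?k = "cell_index N t r"
  have kN: "?k \<le> N" by (rule cell_index_le)
  have "slope_action q \<phi> (\<lambda>s. x (cell_index N t s)) r
      \<le> (\<integral>\<^sup>+ s. (\<Sum>j = 1..?k. ennreal (slope_pow (x j)) * indicator {t (j - 1)<..t j} s) \<partial>lborel)"
    unfolding slope_action_def
  proof (rule nn_integral_mono_AE)
    show "AE s in lborel. ennreal_powr (local_slope \<phi> (x (cell_index N t s))) q * indicator {0..r} s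
        \<le> (\<Sum>j = 1..?k. ennreal (slope_pow (x j)) * indicator {t (j - 1)<..t j} s)"
      using AE_lborel_singleton[of 0]
    proof eventually_elim
      case (elim s)
      show ?case
      proof (cases "s \<in> {0..r}")
        case True
        then have s: "0 < s" "s \<le> T" "s \<le> r" using elim r by auto
        note c = cell_index_cell[OF part s(1,2)]
        let ?i = "cell_index N t s"
        have "?i \<in> {1..?k}" using c(1) cell_index_mono[OF s(3), of N t] by simp
        then have "ennreal (slope_pow (x ?i)) * indicator {t (?i - 1)<..t ?i} s
            \<le> (\<Sum>j = 1..?k. ennreal (slope_pow (x j)) * indicator {t (j - 1)<..t j} s)"
          by (intro member_le_sum) auto
        then show ?thesis using True c slope_power[OF x[of ?i]] by simp
      qed simp
    qed
  qed
  also have "\<dots> = (\<Sum>j = 1..?k. (\<integral>\<^sup>+ s. ennreal (slope_pow (x j)) * indicator {t (j - 1)<..t j} s \<partial>lborel))"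
    by (intro nn_integral_sum) measurable
  also have "\<dots> = (\<Sum>j = 1..?k. ennreal (step t j * slope_pow (x j)))"
  proof (rule sum.cong[OF refl])
    fix j assume "j \<in> {1..?k}"
    then have "0 < step t j" using step_pos[OF part, of j] kN by simp
    then show "(\<integral>\<^sup>+ s. ennreal (slope_pow (x j)) * indicator {t (j - 1)<..t j} s \<partial>lborel) = ennreal (step t j * slope_pow (x j))"
      by (simp add: step_def nn_integral_cmult_indicator ennreal_mult mult.commute)
  qed
  also have "\<dots> = ennreal (\<Sum>j = 1..?k. step t j * slope_pow (x j))"
    using kN by (intro sum_ennreal mult_nonneg_nonneg less_imp_le[OF step_pos[OF part]]) auto
  finally show ?thesis .
qed

end

section \<open>Passage to the limit\<close>

context compact_functional
begin

lemma discrete_energy_inequality: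
  assumes part: "is_partition T N t" and x: "\<And>i. i \<le> N \<Longrightarrow> x i \<in> slope_dom \<phi>"
    and en: "\<And>i. i \<le> N \<Longrightarrow> \<phi>r (x i) + discrete_action p t x i / p + (\<Sum>j = 1..i. step t j * slope_pow (x j)) / q \<le> K"
    and r: "r \<le> T"
  shows "\<phi> (x (cell_index N t r))
      + ereal (discrete_action p t x (cell_index N t r) / p)
      + enn2ereal (ennreal (1 / q) * slope_action q \<phi> (\<lambda>s. x (cell_index N t s)) r)
      \<le> ereal K"
proof -
  let ?k = "cell_index N t r"
  define a where "a = discrete_action p t x ?k"
  define b where "b = (\<Sum>j = 1..?k. step t j * slope_pow (x j))"
  have k: "?k \<le> N" by (rule cell_index_le)
  have b0: "0 \<le> b" unfolding b_def
    using k by (intro sum_nonneg mult_nonneg_nonneg less_imp_le[OF step_pos[OF part]]) auto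
  have le: "\<phi>r (x ?k) + a / p + b / q \<le> K" using en[OF k] by (simp add: a_def b_def)
  have "ennreal (1 / q) * slope_action q \<phi> (\<lambda>s. x (cell_index N t s)) r
      \<le> ennreal (1 / q) * ennreal b"
    unfolding b_def by (intro mult_left_mono step_function_slope_integral[OF part x r]) auto
  also have "\<dots> = ennreal (b / q)" using q b0 by (simp add: ennreal_mult[symmetric])
  finally have "enn2ereal (ennreal (1 / q) * slope_action q \<phi> (\<lambda>s. x (cell_index N t s)) r)
      \<le> ereal (b / q)" using b0 q by (simp add: less_eq_ennreal.rep_eq)
  then have "\<phi> (x ?k) + ereal (a / p)
      + enn2ereal (ennreal (1 / q) * slope_action q \<phi> (\<lambda>s. x (cell_index N t s)) r)
      \<le> \<phi> (x ?k) + ereal (a / p) + ereal (b / q)" by (intro add_left_mono)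
  also have "\<dots> = ereal (\<phi>r (x ?k) + a / p + b / q)"
    using phi_eq[OF slope_dom_subset[OF x[OF k]]] by (metis plus_ereal.simps(1))
  also have "\<dots> \<le> ereal K" using le by simp
  finally show ?thesis by (simp add: a_def)
qed

end

text \<open>
  Everything the limit needs to know about the discrete scheme: the curves \<open>w\<^sub>n\<close>, their actions \<open>A\<^sub>n\<close>,
  and the discrete energy inequality with right-hand side tending to \<open>\<phi>(u0)\<close>. The three terms on
  its left-hand side are lower semicontinuous separately: \<open>\<phi>\<close> by closedness of the sublevels, the
  action by the bound for the speed of the limit, the slope term by Fatou's lemma and lower
  semicontinuity of the slope.
\<close>

lemma energy_curve_limit_is_maximal_slope:
  fixes \<phi> :: "'a::complete_space \<Rightarrow> ereal" and w :: "nat \<Rightarrow> real \<Rightarrow> 'a" and A :: "nat \<Rightarrow> real \<Rightarrow> real"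
  assumes cf: "compact_functional p q \<phi>" and T: "T > 0"
    and sug: "strong_upper_gradient p T \<phi> (local_slope \<phi>)"
    and A: "\<And>n. mono (A n)" "\<And>n r. 0 \<le> A n r" "\<And>n r. A n r \<le> B"
    and \<delta>: "\<delta> \<longlonglongrightarrow> 0" and K: "K \<longlonglongrightarrow> k0" "\<And>n. K n \<le> K0"
    and est: "\<And>n s t l. l > 0 \<Longrightarrow> s \<le> t \<Longrightarrow> dist (w n s) (w n t)
        \<le> l powr q / q * (max 0 (min T t) - max 0 (min T s) + \<delta> n) + l powr (- p) / p * (A n t - A n s)"
    and meas: "\<And>n. (\<lambda>r. local_slope \<phi> (w n r)) \<in> borel_measurable borel"
    and bound: "\<And>n r. \<phi> (w n r) \<le> ereal (K n)"
    and energy: "\<And>n t. t \<in> {0..T} \<Longrightarrow> \<phi> (w n t) + ereal (A n t / p)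
      + enn2ereal (ennreal (1 / q) * slope_action q \<phi> (w n) t) \<le> ereal (K n)"
    and init: "(\<lambda>n. w n 0) \<longlonglongrightarrow> u0" "\<phi> u0 = ereal k0"
  shows "\<exists>(k :: nat \<Rightarrow> nat) u. strict_mono k \<and> curve_of_maximal_slope p q T \<phi> u \<and> (\<forall>r. (\<lambda>j. w (k j) r) \<longlonglongrightarrow> u r)"
proof -
  interpret compact_functional p q \<phi> by (rule cf)
  have bound0: "\<phi> (w n r) \<le> ereal K0" for n r using bound[of n r] K(2)[of n] by (meson ereal_less_eq(3) order_trans)
  have Kc: "compact {v. \<phi> v \<le> ereal K0}" using compact_sublevels by (simp add: compact_eq_seq_compact_metric)
  define \<kappa> where "\<kappa> = (\<lambda>t. max 0 (min T t))"
  have \<kappa>: "mono \<kappa>" "\<And>s t. s \<le> t \<Longrightarrow> \<kappa> t - \<kappa> s \<le> t - s" by (auto simp: \<kappa>_def mono_def)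
  have est': "dist (w n s) (w n t) \<le> l powr q / q * (\<kappa> t - \<kappa> s + \<delta> n) + l powr (- p) / p * (A n t - A n s)"
    if "l > 0" "s \<le> t" for n s t l
    unfolding \<kappa>_def by (rule est[OF that])
  have w: "w n r \<in> {v. \<phi> v \<le> ereal K0}" for n r using bound0 by simp
  have pq0: "0 < p" "0 < q" using p q by auto
  obtain k :: "nat \<Rightarrow> nat" and u A' where k: "strict_mono k" and u: "\<And>r. (\<lambda>j. w (k j) r) \<longlonglongrightarrow> u r"
     and A': "mono A'" "\<And>a. continuous (at_right a) A'" "\<And>s. 0 \<le> A' s" "\<And>s. A' s \<le> B"
     and dom: "\<And>l. l > 0 \<Longrightarrow> dominates_increments u (\<lambda>t. l powr q / q * \<kappa> t + l powr (- p) / p * A' t)"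
     and lim: "\<And>s t. s < t \<Longrightarrow> ereal (A' s) \<le> liminf (\<lambda>j. ereal (A (k j) t))"
    using compactness_of_curves_with_energy[OF pq0 Kc w A \<delta> \<kappa> est'] by blast
  have dom': "\<exists>c\<ge>0. dominates_increments u (\<lambda>t. c * max 0 (min T t) + \<epsilon> * A' t)" if \<epsilon>: "\<epsilon> > 0" for \<epsilon>
  proof -
    \<comment> \<open>The weight for which the action term has the coefficient \<open>\<epsilon>\<close>.\<close>
    define l where "l = (p * \<epsilon>) powr (- (1 / p))"
    have l: "l > 0" "l powr (- p) / p = \<epsilon>" using p \<epsilon> by (auto simp: l_def powr_powr)
    show ?thesis using dom[OF l(1)] q unfolding l(2) \<kappa>_def by (intro exI[of _ "l powr q / q"]) auto
  qed
  have A'B: "A' t - A' s \<le> B" for s t using A'(3)[of s] A'(4)[of t] by linarith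
  obtain m where m: "m \<in> borel_measurable borel" "\<And>x. 0 \<le> m x" "integrable lborel m"
     "\<And>s t. s \<le> t \<Longrightarrow> dist (u s) (u t) \<le> integral {s..t} m"
     "AE x in lborel. ((\<lambda>s. dist (u s) (u x) / \<bar>s - x\<bar>) \<longlongrightarrow> m x) (at x)"
    using metric_speed_exists[OF less_imp_le[OF T] A'(1,2) A'B dom'] by blast
  have u00: "u 0 = u0"
    using LIMSEQ_unique[OF u[of 0]] LIMSEQ_subseq_LIMSEQ[OF init(1) k] by (simp add: o_def)
  have "curve_of_maximal_slope p q T \<phi> u"
  proof (rule maximal_slope_of_energy_inequality[OF T sug m])
    show "u 0 \<in> eff_dom \<phi>" using init(2) u00 by (simp add: eff_dom_def)
    fix t assume t: "t \<in> {0..T}"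
    let ?X = "\<integral>\<^sup>+ r. ennreal (m r powr p) * indicator {0..t} r \<partial>lborel"
    let ?Y = "slope_action q \<phi> u t"
    show "\<phi> (u t) + enn2ereal (ennreal (1 / p) * ?X) + enn2ereal (ennreal (1 / q) * ?Y) \<le> \<phi> (u 0)"
    proof (cases "t = 0")
      case True
      have z: "(\<integral>\<^sup>+ r. g r * indicator {0..0::real} r \<partial>lborel) = 0" for g :: "real \<Rightarrow> ennreal"
      proof -
        have "(\<integral>\<^sup>+ r. g r * indicator {0..0::real} r \<partial>lborel) = (\<integral>\<^sup>+ r. 0 \<partial>(lborel :: real measure))"
          by (rule nn_integral_cong_AE) (use AE_lborel_singleton[of 0] in \<open>eventually_elim, auto simp: indicator_def\<close>)
        then show ?thesis by simp
      qed
      show ?thesis using True by (simp add: slope_action_def z zero_ennreal.rep_eq)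
    next
      case False
      then have t0: "t > 0" using t by simp
      define Z where "Z = (\<lambda>j. slope_action q \<phi> (w (k j)) t)"
      have "liminf (\<lambda>j. ereal (A (k j) t)) \<le> ereal B" using A(3) by (intro Liminf_le) (auto intro: eventually_frequently)
      moreover have "0 \<le> liminf (\<lambda>j. ereal (A (k j) t))" using A(2) by (intro Liminf_bounded) auto
      ultimately obtain b where b: "liminf (\<lambda>j. ereal (A (k j) t)) = ereal b" "0 \<le> b"
        by (cases "liminf (\<lambda>j. ereal (A (k j) t))") auto
      have X: "?X \<le> ennreal b"
      proof (rule speed_energy_le[OF p q pq A'(1,3) \<kappa>(2) dom m(1,2,5) t0])
        show "A' s \<le> b" if "s < t" for s using lim[OF that] b(1) by simp
      qed auto
      have "ennreal (1 / p) * ?X \<le> ennreal (1 / p) * ennreal b" using X by (intro mult_left_mono) auto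
      also have "\<dots> = ennreal (b / p)" using p b(2) by (simp add: ennreal_mult[symmetric])
      finally have X': "enn2ereal (ennreal (1 / p) * ?X) \<le> ereal (b / p)"
        using p b(2) by (simp add: less_eq_ennreal.rep_eq)
      have la: "ereal (b / p) \<le> liminf (\<lambda>j. ereal (A (k j) t / p))"
        unfolding le_Liminf_iff
      proof (intro allI impI)
        fix y assume y: "y < ereal (b / p)"
        then obtain z where z: "y < ereal z" "ereal z < ereal (b / p)" using ereal_dense2 by blast
        then have "p * z < b" using p by (simp add: field_simps)
        then have "ereal (p * z) < liminf (\<lambda>j. ereal (A (k j) t))" using b(1) by simp
        then have "\<forall>\<^sub>F j in sequentially. ereal (p * z) < ereal (A (k j) t)" by (rule less_LiminfD)
        then show "\<forall>\<^sub>F j in sequentially. y < ereal (A (k j) t / p)"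
        proof eventually_elim
          case (elim j)
          then have "z < A (k j) t / p" using p by (simp add: field_simps)
          then show ?case using z(1) by (meson ereal_less_eq(3) less_imp_le less_le_trans)
        qed
      qed
      have "?Y \<le> (\<integral>\<^sup>+ r. liminf (\<lambda>j. ennreal_powr (local_slope \<phi> (w (k j) r)) q * indicator {0..t} r) \<partial>lborel)"
        unfolding slope_action_def
      proof (rule nn_integral_mono)
        fix r
        have "ennreal 1 * ennreal_powr (local_slope \<phi> (u r)) q \<le> liminf (\<lambda>j. ennreal 1 * ennreal_powr (local_slope \<phi> (w (k j) r)) q)"
          using q by (intro scaled_ennreal_powr_liminf slope_liminf[OF u bound0]) auto
        then show "ennreal_powr (local_slope \<phi> (u r)) q * indicator {0..t} r \<le> liminf (\<lambda>j. ennreal_powr (local_slope \<phi> (w (k j) r)) q * indicator {0..t} r)"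
          by (auto simp: indicator_def)
      qed
      also have "\<dots> \<le> liminf Z"
      proof -
        have "(\<lambda>r. ennreal_powr (local_slope \<phi> (w (k j) r)) q) \<in> borel_measurable lborel" for j
          using borel_measurable_ennreal_powr[OF meas[of "k j"]] by simp
        then show ?thesis unfolding Z_def slope_action_def
          by (intro nn_integral_liminf borel_measurable_times_ennreal borel_measurable_indicator) auto
      qed
      finally have "ennreal (1 / q) * ?Y \<le> ennreal (1 / q) * liminf Z" by (intro mult_left_mono) auto
      also have "\<dots> = liminf (\<lambda>j. ennreal (1 / q) * Z j)"
        by (rule Liminf_compose_continuous_mono[symmetric])
           (auto intro!: ennreal_continuous_on_cmult continuous_on_id mult_left_mono simp: mono_def)
      finally have Y: "enn2ereal (ennreal (1 / q) * ?Y) \<le> liminf (\<lambda>j. enn2ereal (ennreal (1 / q) * Z j))"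
        by (subst Liminf_compose_continuous_mono[OF continuous_on_enn2ereal])
           (auto simp: mono_def less_eq_ennreal.rep_eq)
      have nm: "\<phi> (u t) + ereal (b / p) \<noteq> -\<infinity>" "enn2ereal (ennreal (1 / q) * ?Y) \<noteq> -\<infinity>"
        using not_minf[of "u t"] enn2ereal_nonneg[of "ennreal (1 / q) * ?Y"] by auto
      have "\<phi> (u t) + enn2ereal (ennreal (1 / p) * ?X) + enn2ereal (ennreal (1 / q) * ?Y)
          \<le> \<phi> (u t) + ereal (b / p) + enn2ereal (ennreal (1 / q) * ?Y)"
        using X' by (intro add_mono) auto
      also have "\<dots> \<le> liminf (\<lambda>j. \<phi> (w (k j) t) + ereal (A (k j) t / p) + enn2ereal (ennreal (1 / q) * Z j))"
        by (intro ereal_le_liminf_add[OF _ Y nm] ereal_le_liminf_add[OF phi_lsc[OF u] la not_minf]) auto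
      also have "\<dots> \<le> liminf (\<lambda>j. ereal (K (k j)))"
        unfolding Z_def by (intro Liminf_mono always_eventually allI energy[OF t])
      also have "\<dots> = ereal k0"
        using LIMSEQ_subseq_LIMSEQ[OF K(1) k] by (intro lim_imp_Liminf tendsto_ereal) (auto simp: o_def)
      also have "ereal k0 = \<phi> (u 0)" using init(2) u00 by simp
      finally show ?thesis .
    qed
  qed
  then show ?thesis using k u by blast
qed

theorem theorem3p3:
  fixes p q T \<tau>s C' :: real
    and \<phi> :: "'a::polish_space \<Rightarrow> ereal"
    and u0 :: 'a
    and N :: "nat \<Rightarrow> nat"
    and t :: "nat \<Rightarrow> nat \<Rightarrow> real"
    and x :: "nat \<Rightarrow> nat \<Rightarrow> 'a"
  assumes "p > 1" and "q > 1" and "1 / p + 1 / q = 1" and "T > 0"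
    and "\<And>v. \<phi> v \<noteq> -\<infinity>"
    and "eff_dom \<phi> \<noteq> {}"
    and "\<And>c :: real. seq_compact {v. \<phi> v \<le> ereal c}"
    and "strong_upper_gradient p T \<phi> (local_slope \<phi>)"
    and "seq_lsc_on_bounded_sublevels \<phi> (local_slope \<phi>)"
    and "u0 \<in> eff_dom \<phi>"
    and "\<tau>s > 0" and "taylor_condition p q \<phi> \<tau>s"
    and "\<And>n. is_partition T (N n) (t n)"
    and "\<And>n. mesh (N n) (t n) < \<tau>s"
    and "(\<lambda>n. mesh (N n) (t n)) \<longlonglongrightarrow> 0"
    and "C' > 0"
    and "\<And>n i. i \<in> {2..N n} \<Longrightarrow>
           max (step (t n) i - step (t n) (i - 1)) 0 / step (t n) (i - 1) \<le> C' * mesh (N n) (t n)"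
    and "\<And>n. x n 0 \<in> M_E p \<phi> (mesh (N n) (t n)) u0"
    and "\<And>n i. i \<in> {1..N n} \<Longrightarrow> x n i \<in> M_G p q \<phi> (step (t n) i) (x n (i - 1))"
  shows "(\<lambda>n. \<Sum>i = 1..N n. max (G_fun p q \<phi> (step (t n) i) (x n (i - 1)) (x n i)) 0)
           \<longlonglongrightarrow> 0
         \<and> (\<exists>k :: nat \<Rightarrow> nat. \<exists>u :: real \<Rightarrow> 'a.
              strict_mono k \<and> curve_of_maximal_slope p q T \<phi> u \<and>
              (\<forall>r\<in>{0..T}.
                 (\<lambda>j. interpolant (N (k j)) (t (k j)) (x (k j)) r) \<longlonglongrightarrow> u r))"
proof -
  interpret compact_functional p q \<phi>
    by unfold_locales (use assms in auto)
  note T = assms(4) and part = assms(13) and small = assms(14) and step_ratio = assms(17)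
  note xE = assms(18) and xG = assms(19)
  have u0: "u0 \<in> eff_dom \<phi>" by (rule assms)
  obtain c where c: "\<And>w. ereal c \<le> \<phi> w" using phi_bounded_below by blast
  have cu0: "c \<le> \<phi>r u0" using c[of u0] phi_eq[OF u0] by (metis ereal_less_eq(3))
  \<comment> \<open>\<open>C\<close> must be fixed before \<open>g\<close>, hence independently of \<open>n\<close>.\<close>
  define C where "C = 1 + \<bar>\<phi>r u0\<bar> + p * (\<phi>r u0 - c) + (1 + C' * \<tau>s) * q * (\<phi>r u0 + 1 - c)"
  have "0 \<le> p * (\<phi>r u0 - c)" "0 \<le> (1 + C' * \<tau>s) * q * (\<phi>r u0 + 1 - c)"
    using cu0 p q assms(11,16) by auto
  then have "C > 0" unfolding C_def using abs_ge_zero[of "\<phi>r u0"] by linarith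
  with assms(12) obtain g :: "real \<Rightarrow> ennreal" where g: "g \<in> borel_measurable (lebesgue_on {0<..<\<tau>s})"
      and mono: "mono_on {0<..<\<tau>s} (\<lambda>\<tau>. ennreal (1 / \<tau>) * (\<integral>\<^sup>+ r. g r \<partial>lebesgue_on {0<..<\<tau>}))"
      and lim: "((\<lambda>\<tau>. ennreal (1 / \<tau>) * (\<integral>\<^sup>+ r. g r \<partial>lebesgue_on {0<..<\<tau>})) \<longlongrightarrow> 0) (at_right 0)"
      and taylor: "taylor_estimate p q \<phi> \<tau>s C g"
    unfolding taylor_condition_def taylor_estimate_def by blast
  have N: "N n \<ge> 1" for n using part[of n] T by (cases "N n") (auto simp: is_partition_def)
  define \<delta> where "\<delta> = (\<lambda>n. mesh (N n) (t n))"
  have \<delta>0: "0 < \<delta> n" for n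
    using step_pos[OF part, of 1 n] step_le_mesh[of 1 "N n" "t n"] N[of n] by (simp add: \<delta>_def)
  have \<delta>lim: "\<delta> \<longlonglongrightarrow> 0" using assms(15) by (simp add: \<delta>_def)
  define mean where "mean = (\<lambda>n. ennreal (1 / \<delta> n) * (\<integral>\<^sup>+ r. g r \<partial>lebesgue_on {0<..<\<delta> n}))"
  have "filterlim \<delta> (at_right 0) sequentially"
    unfolding filterlim_at using \<delta>lim \<delta>0 by (auto intro!: always_eventually simp: less_imp_neq[OF \<delta>0, symmetric])
  from filterlim_compose[OF lim this] have mean0: "mean \<longlonglongrightarrow> 0" by (simp add: mean_def)
  define \<eta> where "\<eta> = (\<lambda>n. enn2real (mean n))"
  have \<eta>lim: "\<eta> \<longlonglongrightarrow> 0" unfolding \<eta>_def using mean0 by (intro tendsto_enn2real) auto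
  have \<eta>0: "0 \<le> \<eta> n" for n by (simp add: \<eta>_def)
  have "(\<lambda>n. T * \<eta> n) \<longlonglongrightarrow> T * 0" by (intro tendsto_intros \<eta>lim)
  from order_tendstoD(2)[OF this, of q] have "\<forall>\<^sub>F n in sequentially. T * \<eta> n < q" using q by simp
  moreover have "\<forall>\<^sub>F n in sequentially. mean n < 1" using order_tendstoD(2)[OF mean0, of 1] by simp
  \<comment> \<open>The mean of \<open>g\<close> may be infinite for the first few partitions.\<close>
  ultimately have "\<forall>\<^sub>F n in sequentially. T * \<eta> n \<le> q \<and> mean n = ennreal (\<eta> n)"
  proof eventually_elim
    case (elim n)
    then have "mean n < top" by (auto intro: less_trans)
    then show ?case using elim by (auto simp: \<eta>_def)
  qed
  then obtain n0 where n0: "\<And>n. n \<ge> n0 \<Longrightarrow> T * \<eta> n \<le> q \<and> mean n = ennreal (\<eta> n)"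
    by (auto simp: eventually_sequentially)
  have estimate: "\<And>i. i \<le> N n \<Longrightarrow> x n i \<in> slope_dom \<phi>"
    "\<And>i. i \<in> {1..N n} \<Longrightarrow> gap (step (t n) i) (x n (i - 1)) (x n i) \<le> step (t n) i * \<eta> n / q"
    "\<And>i. i \<le> N n \<Longrightarrow> \<phi>r (x n i) + discrete_action p (t n) (x n) i / p + (\<Sum>j = 1..i. step (t n) j * slope_pow (x n j)) / q
             \<le> \<phi>r u0 + t n i * \<eta> n / q"
    if n: "n \<ge> n0" for n
  proof -
    have le: "ennreal (1 / mesh (N n) (t n)) * (\<integral>\<^sup>+ r. g r \<partial>lebesgue_on {0<..<mesh (N n) (t n)}) \<le> ennreal (\<eta> n)"
      using n0[OF n] by (simp add: mean_def \<delta>_def)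
    note E = scheme_energy_estimate[OF T part small assms(16) step_ratio u0 xE xG c C_def g mono taylor le \<eta>0]
    show "\<And>i. i \<le> N n \<Longrightarrow> x n i \<in> slope_dom \<phi>"
      "\<And>i. i \<in> {1..N n} \<Longrightarrow> gap (step (t n) i) (x n (i - 1)) (x n i) \<le> step (t n) i * \<eta> n / q"
      "\<And>i. i \<le> N n \<Longrightarrow> \<phi>r (x n i) + discrete_action p (t n) (x n) i / p + (\<Sum>j = 1..i. step (t n) j * slope_pow (x n j)) / q
             \<le> \<phi>r u0 + t n i * \<eta> n / q"
      using E n0[OF n] by auto
  qed
  have tT: "t n i \<le> T" if "i \<le> N n" for n i
    using partition_mono[OF part[of n] that] part[of n] by (simp add: is_partition_def)
  have conv: "(\<lambda>n. \<Sum>i = 1..N n. max (G_fun p q \<phi> (step (t n) i) (x n (i - 1)) (x n i)) 0) \<longlonglongrightarrow> 0"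
  proof (rule tendsto_sandwich[OF _ _ tendsto_const])
    show "\<forall>\<^sub>F n in sequentially. 0 \<le> (\<Sum>i = 1..N n. max (G_fun p q \<phi> (step (t n) i) (x n (i - 1)) (x n i)) 0)"
      by (intro always_eventually allI sum_nonneg) simp
    have "(\<lambda>n. T * \<eta> n / q) \<longlonglongrightarrow> T * 0 / q" using q by (intro tendsto_intros \<eta>lim) auto
    then show "(\<lambda>n. ereal (T * \<eta> n / q)) \<longlonglongrightarrow> 0"
      using tendsto_ereal[of _ "T * 0 / q"] by (simp add: zero_ereal_def)
    have "(\<Sum>i = 1..N n. max (G_fun p q \<phi> (step (t n) i) (x n (i - 1)) (x n i)) 0) \<le> ereal (T * \<eta> n / q)"
      if n: "n \<ge> n0" for n
    proof -
      have "max (G_fun p q \<phi> (step (t n) i) (x n (i - 1)) (x n i)) 0 \<le> ereal (step (t n) i * \<eta> n / q)"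
        if i: "i \<in> {1..N n}" for i
      proof -
        have "i \<le> N n" "i - 1 \<le> N n" using i by auto
        then have s: "x n i \<in> slope_dom \<phi>" "x n (i - 1) \<in> eff_dom \<phi>"
          using estimate(1)[OF n] slope_dom_subset by auto
        have "0 \<le> step (t n) i" using step_pos[OF part i] by simp
        then show ?thesis using G_fun_eq[OF s] estimate(2)[OF n i] \<eta>0[of n] q by simp
      qed
      then have "(\<Sum>i = 1..N n. max (G_fun p q \<phi> (step (t n) i) (x n (i - 1)) (x n i)) 0)
          \<le> (\<Sum>i = 1..N n. ereal (step (t n) i * \<eta> n / q))" by (intro sum_mono) auto
      also have "\<dots> = ereal ((\<Sum>i = 1..N n. step (t n) i) * \<eta> n / q)"
        by (simp add: sum_distrib_right sum_divide_distrib)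
      also have "(\<Sum>i = 1..N n. step (t n) i) = T" using sum_step[OF part] part[of n] by (simp add: is_partition_def)
      finally show ?thesis .
    qed
    then show "\<forall>\<^sub>F n in sequentially. (\<Sum>i = 1..N n. max (G_fun p q \<phi> (step (t n) i) (x n (i - 1)) (x n i)) 0) \<le> ereal (T * \<eta> n / q)"
      by (auto simp: eventually_sequentially)
  qed
  \<comment> \<open>The estimates hold from the index \<open>n0\<close> on, so the sequence is shifted by \<open>n0\<close>.\<close>
  define ix where "ix = (\<lambda>n. cell_index (N (n + n0)) (t (n + n0)))"
  define w where "w = (\<lambda>n r. x (n + n0) (ix n r))"
  define E where "E = (\<lambda>n. discrete_action p (t (n + n0)) (x (n + n0)))"
  define A where "A = (\<lambda>n r. E n (ix n r))"
  define K where "K = (\<lambda>n. \<phi>r u0 + T * \<eta> (n + n0) / q)"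
  have ixN: "ix n r \<le> N (n + n0)" for n r by (simp add: ix_def cell_index_le)
  have E0: "0 \<le> E n i" for n i unfolding E_def discrete_action_def by (intro sum_nonneg) simp
  have Emono: "E n i \<le> E n k" if "i \<le> k" for n i k
    unfolding E_def discrete_action_def using that by (intro sum_mono2) auto
  have energy: "\<phi>r (x (n + n0) i) + E n i / p + (\<Sum>j = 1..i. step (t (n + n0)) j * slope_pow (x (n + n0) j)) / q \<le> K n"
    if i: "i \<le> N (n + n0)" for n i
  proof -
    have "t (n + n0) i * \<eta> (n + n0) / q \<le> T * \<eta> (n + n0) / q"
      using tT[OF i] \<eta>0 q by (intro divide_right_mono mult_right_mono) auto
    then show ?thesis using estimate(3)[OF _ i] by (simp add: K_def E_def)
  qed
  have K0: "K n \<le> \<phi>r u0 + 1" for n using n0[of "n + n0"] q by (simp add: K_def)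
  have fK: "\<phi>r (x (n + n0) i) + E n i / p \<le> K n" if i: "i \<le> N (n + n0)" for n i
  proof -
    have "0 \<le> (\<Sum>j = 1..i. step (t (n + n0)) j * slope_pow (x (n + n0) j)) / q"
      using i q by (intro divide_nonneg_pos sum_nonneg mult_nonneg_nonneg less_imp_le[OF step_pos[OF part]]) auto
    then show ?thesis using energy[OF i] by linarith
  qed
  have cf: "c \<le> \<phi>r (x (n + n0) i)" if "i \<le> N (n + n0)" for n i
    using c[of "x (n + n0) i"] phi_eq[OF slope_dom_subset[OF estimate(1)[OF _ that]]] by (metis ereal_less_eq(3) le_add2)
  have "\<exists>(k :: nat \<Rightarrow> nat) u. strict_mono k \<and> curve_of_maximal_slope p q T \<phi> u \<and> (\<forall>r. (\<lambda>j. w (k j) r) \<longlonglongrightarrow> u r)"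
  proof (rule energy_curve_limit_is_maximal_slope[where A = A and K = K and \<delta> = "\<lambda>n. \<delta> (n + n0)"
        and B = "p * (\<phi>r u0 + 1 - c)" and ?K0.0 = "\<phi>r u0 + 1" and ?k0.0 = "\<phi>r u0" and ?u0.0 = u0])
    show "compact_functional p q \<phi>" ..
    show "T > 0" by (rule T)
    show "strong_upper_gradient p T \<phi> (local_slope \<phi>)" by (rule assms)
    show "mono (A n)" for n by (auto simp: mono_def A_def ix_def intro!: Emono cell_index_mono)
    show "0 \<le> A n r" for n r by (simp add: A_def E0)
    show "A n r \<le> p * (\<phi>r u0 + 1 - c)" for n r
    proof -
      have "A n r / p \<le> \<phi>r u0 + 1 - c" using fK[OF ixN[of n r]] cf[OF ixN[of n r]] K0[of n] by (simp add: A_def)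
      then show ?thesis using p by (simp add: field_simps)
    qed
    show "(\<lambda>n. \<delta> (n + n0)) \<longlonglongrightarrow> 0" by (rule LIMSEQ_ignore_initial_segment[OF \<delta>lim])
    have "K \<longlonglongrightarrow> \<phi>r u0 + T * 0 / q"
      unfolding K_def using q by (intro tendsto_intros LIMSEQ_ignore_initial_segment[OF \<eta>lim]) auto
    then show "K \<longlonglongrightarrow> \<phi>r u0" by simp
    show "K n \<le> \<phi>r u0 + 1" for n by (rule K0)
    show "dist (w n s) (w n r) \<le> l powr q / q * (max 0 (min T r) - max 0 (min T s) + \<delta> (n + n0)) + l powr (- p) / p * (A n r - A n s)"
      if l: "l > 0" and sr: "s \<le> r" for n s r l
    proof -
      have "dist (w n s) (w n r) \<le> l powr q / q * (t (n + n0) (ix n r) - t (n + n0) (ix n s)) + l powr (- p) / p * (A n r - A n s)"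
        unfolding w_def A_def E_def ix_def
        by (intro chain_young_estimate[OF p q pq l part] cell_index_mono[OF sr] cell_index_le)
      moreover have "l powr q / q * (t (n + n0) (ix n r) - t (n + n0) (ix n s))
          \<le> l powr q / q * (max 0 (min T r) - max 0 (min T s) + \<delta> (n + n0))"
        unfolding ix_def \<delta>_def using cell_time_increment[OF part T sr] q by (intro mult_left_mono) auto
      ultimately show ?thesis by linarith
    qed
    show "(\<lambda>r. local_slope \<phi> (w n r)) \<in> borel_measurable borel" for n
      unfolding w_def ix_def by (rule measurable_cell_index)
    show "\<phi> (w n r) \<le> ereal (K n)" for n r
    proof -
      have "0 \<le> E n (ix n r) / p" using E0 p by simp
      then have "\<phi>r (w n r) \<le> K n" using fK[OF ixN[of n r]] by (simp add: w_def)
      then show ?thesis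
        using phi_eq[OF slope_dom_subset[OF estimate(1)[OF _ ixN[of n r]]]] by (metis ereal_less_eq(3) le_add2 w_def)
    qed
    show "\<phi> (w n r) + ereal (A n r / p)
      + enn2ereal (ennreal (1 / q) * slope_action q \<phi> (w n) r) \<le> ereal (K n)"
      if "r \<in> {0..T}" for n r
      unfolding w_def A_def E_def ix_def
      using that by (intro discrete_energy_inequality[OF part _ energy[unfolded E_def]] estimate(1)) auto
    have init: "x n 0 \<in> slope_dom \<phi>" "\<phi>r (x n 0) + \<delta> n powr (1 - p) / p * dist u0 (x n 0) powr p \<le> \<phi>r u0" for n
      using M_E_D(1,2)[OF xE u0 \<delta>0[of n, unfolded \<delta>_def]] by (simp_all add: \<delta>_def)
    have xl: "(\<lambda>n. x n 0) \<longlonglongrightarrow> u0"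
    proof -
      have near: "dist (x n 0) u0 \<le> (p * (\<phi>r u0 - c) * \<delta> n powr (p - 1)) powr (1 / p)" for n
      proof -
        have "c \<le> \<phi>r (x n 0)" using c[of "x n 0"] phi_eq[OF slope_dom_subset[OF init(1)]] by (metis ereal_less_eq(3))
        then have "\<delta> n powr (1 - p) / p * dist u0 (x n 0) powr p \<le> \<phi>r u0 - c" using init(2)[of n] by linarith
        then have "\<delta> n powr (p - 1) * p * (\<delta> n powr (1 - p) / p * dist u0 (x n 0) powr p) \<le> \<delta> n powr (p - 1) * p * (\<phi>r u0 - c)"
          using p by (intro mult_left_mono) auto
        moreover have "\<delta> n powr (p - 1) * \<delta> n powr (1 - p) = 1" using \<delta>0[of n] by (simp add: powr_add[symmetric])
        then have "\<delta> n powr (p - 1) * p * (\<delta> n powr (1 - p) / p * dist u0 (x n 0) powr p) = dist u0 (x n 0) powr p"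
          using p by (simp add: mult.assoc[symmetric])
        ultimately have "dist u0 (x n 0) powr p \<le> p * (\<phi>r u0 - c) * \<delta> n powr (p - 1)" by (simp add: mult_ac)
        then have "(dist u0 (x n 0) powr p) powr (1 / p) \<le> (p * (\<phi>r u0 - c) * \<delta> n powr (p - 1)) powr (1 / p)"
          using p by (intro powr_mono2) auto
        then show ?thesis using p by (simp add: powr_powr dist_commute)
      qed
      have "(\<lambda>n. (p * (\<phi>r u0 - c) * \<delta> n powr (p - 1)) powr (1 / p)) \<longlonglongrightarrow> (p * (\<phi>r u0 - c) * 0 powr (p - 1)) powr (1 / p)"
        using p \<delta>lim less_imp_le[OF \<delta>0] cu0 by (intro tendsto_intros tendsto_powr') auto
      then have zero: "(\<lambda>n. (p * (\<phi>r u0 - c) * \<delta> n powr (p - 1)) powr (1 / p)) \<longlonglongrightarrow> 0" using p by simp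
      have "(\<lambda>n. dist (x n 0) u0) \<longlonglongrightarrow> 0"
        by (rule tendsto_sandwich[OF _ _ tendsto_const zero]) (use near in \<open>auto intro!: always_eventually\<close>)
      then show ?thesis by (rule iffD2[OF tendsto_dist_iff])
    qed
    have "ix n 0 = 0" for n
      unfolding ix_def cell_index_def using part[of "n + n0"] by (intro Least_eq_0) (simp add: is_partition_def)
    then show "(\<lambda>n. w n 0) \<longlonglongrightarrow> u0" unfolding w_def using LIMSEQ_ignore_initial_segment[OF xl, of n0] by simp
    show "\<phi> u0 = ereal (\<phi>r u0)" by (rule phi_eq[OF u0])
  qed
  then obtain k :: "nat \<Rightarrow> nat" and u where k: "strict_mono k" and u: "curve_of_maximal_slope p q T \<phi> u"
    and wl: "\<And>r. (\<lambda>j. w (k j) r) \<longlonglongrightarrow> u r" by blast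
  have "strict_mono (\<lambda>j. k j + n0)" using k by (simp add: strict_mono_def)
  moreover have "(\<lambda>j. interpolant (N (k j + n0)) (t (k j + n0)) (x (k j + n0)) r) \<longlonglongrightarrow> u r" if "r \<in> {0..T}" for r
    using wl[of r] by (simp add: interpolant_eq_cell_index[OF part that] w_def ix_def)
  ultimately show ?thesis using conv u by blast
qed

end
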